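(* Let $k\ge1$, let $n\in\{3,5,6,7,\dots\}\cup\{\infty\}$ (so $n\ne2,4$), and let $\Gamma=\underbrace{\mathbb Z_n\times\mathbb Z_n\times\cdots\times\mathbb Z_n}_{k\text{ copies}}$ with its standard symmetric generating set. Then $\mathbb Q(\Gamma)\cong C(ISO(\Gamma))$.
   Context: A compact quantum group (CQG) is a unital $C^*$-algebra $\mathcal Q$ with a coassociative unital $*$-homomorphism $\Delta:\mathcal Q\to\mathcal Q\hat\otimes\mathcal Q$ ($\hat\otimes$ the spatial tensor product) such that the linear spans of $\Delta(\mathcal Q)(1\otimes\mathcal Q)$ and $\Delta(\mathcal Q)(\mathcal Q\otimes 1)$ are norm-dense. A CQG morphism is a unital $*$-homomorphism intertwining the coproducts. An action of $\mathcal Q$ on a unital $C^*$-algebra $B$ is a unital $*$-homomorphism $\alpha:B\to B\hat\otimes\mathcal Q$ with $(\alpha\otimes id)\alpha=(id\otimes\Delta)\alpha$ and with the linear span of $\alpha(B)(1\otimes\mathcal Q)$ dense in $B\hat\otimes\mathcal Q$. Let $\Gamma$ be a discrete group with finite symmetric generating set $S$ ($a\in S\Rightarrow a^{-1}\in S$, elements of order 2 listed once), with word length $l$, canonical unitaries $\lambda_g\in C^*_r(\Gamma)$ and canonical trace $\tau$. $\mathbb Q(\Gamma)=\mathbb Q(\Gamma,S)$ denotes the quantum isometry group $QISO^+(\mathbb C\Gamma,\ell^2(\Gamma),D_\Gamma)$ of the spectral triple with $D_\Gamma\delta_g=l(g)\delta_g$. Equivalently it is the universal object in the category of pairs $(\mathcal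 Q,\alpha)$ where $\mathcal Q$ is a CQG and $\alpha$ is a $\tau$-preserving action of $\mathcal Q$ on $C^*_r(\Gamma)$ mapping $\mathrm{span}\{\lambda_g:l(g)=r\}$ into $\mathrm{span}\{\lambda_g:l(g)=r\}\otimes\mathcal Q$ for every $r\ge0$ (morphisms are CQG morphisms intertwining the actions; universality means that for every object there is a unique morphism from $\mathbb Q(\Gamma,S)$ to it). $\mathbb Z_\infty=\mathbb Z$. The standard symmetric generating set of a product of cyclic groups consists of $a_i^{\pm1}$, with $a_i$ the standard generator of the $i$-th cyclic factor. For $\Gamma$ commutative, $C(ISO(\Gamma))$ denotes the maximal commutative quantum subgroup (abelianization) of $\mathbb Q(\Gamma)$, i.e. the quotient of $\mathbb Q(\Gamma)$ by the closed two-sided ideal generated by all commutators, with the induced coproduct. *)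

theory Defs
  imports "HOL-Analysis.Analysis" "HOL-Algebra.Algebra" "HOL-Library.Extended_Nat"
begin

section \<open>Bounded operators on l2\<close>

text \<open>A bounded operator on the Hilbert space of square summable families over the index type 'i is
  identified with its matrix (M i j is the inner product of M(delta_j) with delta_i); the matrices
  that occur are those whose sesquilinear form on finitely supported vectors is bounded, and the
  operator norm is the least such bound.\<close>

type_synonym 'i op = "'i \<Rightarrow> 'i \<Rightarrow> complex"

definition op_bound :: "real \<Rightarrow> 'i op \<Rightarrow> bool" where
  "op_bound C M \<longleftrightarrow> (\<forall>F x y. finite F \<longrightarrow>
     cmod (\<Sum>i\<in>F. \<Sum>j\<in>F. cnj (x i) * M i j * y j)
       \<le> C * L2_set (\<lambda>i. cmod (x i)) F * L2_set (\<lambda>j. cmod (y j)) F)"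

definition bounded_op :: "'i op \<Rightarrow> bool" where
  "bounded_op M \<longleftrightarrow> (\<exists>C. op_bound C M)"

definition op_norm :: "'i op \<Rightarrow> real" where
  "op_norm M = Inf {C. op_bound C M}"

definition op_zero :: "'i op" where
  "op_zero = (\<lambda>i j. 0)"

definition op_add :: "'i op \<Rightarrow> 'i op \<Rightarrow> 'i op" where
  "op_add M N = (\<lambda>i j. M i j + N i j)"

definition op_diff :: "'i op \<Rightarrow> 'i op \<Rightarrow> 'i op" where
  "op_diff M N = (\<lambda>i j. M i j - N i j)"

definition op_scale :: "complex \<Rightarrow> 'i op \<Rightarrow> 'i op" where
  "op_scale c M = (\<lambda>i j. c * M i j)"

definition op_mult :: "'i op \<Rightarrow> 'i op \<Rightarrow> 'i op" where
  "op_mult M N = (\<lambda>i j. \<Sum>\<^sub>\<infinity>k. M i k * N k j)"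

definition op_adj :: "'i op \<Rightarrow> 'i op" where
  "op_adj M = (\<lambda>i j. cnj (M j i))"

definition op_tensor :: "'i op \<Rightarrow> 'j op \<Rightarrow> ('i \<times> 'j) op" where
  "op_tensor M N = (\<lambda>(i, k) (j, l). M i j * N k l)"

text \<open>The identification of operators on (H1 x H2) x H3 with operators on H1 x (H2 x H3).\<close>

definition op_assoc :: "(('i \<times> 'j) \<times> 'k) op \<Rightarrow> ('i \<times> ('j \<times> 'k)) op" where
  "op_assoc T = (\<lambda>(i, j, k) (i', j', k'). T ((i, j), k) ((i', j'), k'))"

text \<open>The slice map by the vector state of delta_e in the first tensor leg.\<close>

definition op_slice :: "'i \<Rightarrow> ('i \<times> 'j) op \<Rightarrow> 'j op" where
  "op_slice e T = (\<lambda>k l. T (e, k) (e, l))"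

definition op_span :: "'i op set \<Rightarrow> 'i op set" where
  "op_span S = {(\<lambda>i j. \<Sum>t\<in>F. c t * t i j) | F c. finite F \<and> F \<subseteq> S}"

definition op_closure :: "'i op set \<Rightarrow> 'i op set" where
  "op_closure S = {T. bounded_op T \<and> (\<forall>e>0. \<exists>s\<in>S. op_norm (op_diff T s) < e)}"

section \<open>Unital C*-algebras and the spatial tensor product\<close>

definition is_unit_of :: "'i op set \<Rightarrow> 'i op \<Rightarrow> bool" where
  "is_unit_of A u \<longleftrightarrow> u \<in> A \<and> (\<forall>a\<in>A. op_mult u a = a \<and> op_mult a u = a)"

definition unit_of :: "'i op set \<Rightarrow> 'i op" where
  "unit_of A = (THE u. is_unit_of A u)"

text \<open>C*-algebras are taken in a faithful representation, i.e. as norm-closed *-subalgebras of the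
  bounded operators. The representation may be degenerate: the unit is a unit of the algebra and
  need not be the identity operator, so the algebras on l2('i) with 'i infinite include, up to
  isomorphism, all algebras acting on a Hilbert space of dimension at most the cardinality
  of 'i.\<close>

definition unital_cstar_algebra :: "'i op set \<Rightarrow> bool" where
  "unital_cstar_algebra A \<longleftrightarrow>
     (\<forall>a\<in>A. bounded_op a) \<and>
     (\<forall>a\<in>A. \<forall>b\<in>A. op_add a b \<in> A) \<and>
     (\<forall>c. \<forall>a\<in>A. op_scale c a \<in> A) \<and>
     (\<forall>a\<in>A. \<forall>b\<in>A. op_mult a b \<in> A) \<and>
     (\<forall>a\<in>A. op_adj a \<in> A) \<and>
     op_closure A \<subseteq> A \<and>
     (\<exists>u. is_unit_of A u)"

text \<open>Only the values of a homomorphism on its domain A are meaningful.\<close>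

definition unital_star_hom :: "'i op set \<Rightarrow> 'j op set \<Rightarrow> ('i op \<Rightarrow> 'j op) \<Rightarrow> bool" where
  "unital_star_hom A B \<phi> \<longleftrightarrow>
     (\<forall>a\<in>A. \<phi> a \<in> B) \<and>
     (\<forall>a\<in>A. \<forall>b\<in>A. \<phi> (op_add a b) = op_add (\<phi> a) (\<phi> b)) \<and>
     (\<forall>c. \<forall>a\<in>A. \<phi> (op_scale c a) = op_scale c (\<phi> a)) \<and>
     (\<forall>a\<in>A. \<forall>b\<in>A. \<phi> (op_mult a b) = op_mult (\<phi> a) (\<phi> b)) \<and>
     (\<forall>a\<in>A. \<phi> (op_adj a) = op_adj (\<phi> a)) \<and>
     \<phi> (unit_of A) = unit_of B"

definition spatial_tensor :: "'i op set \<Rightarrow> 'j op set \<Rightarrow> ('i \<times> 'j) op set" where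
  "spatial_tensor A B = op_closure (op_span {op_tensor a b | a b. a \<in> A \<and> b \<in> B})"

text \<open>The map \<Phi> is the tensor product of the unital *-homomorphisms \<phi> : A \<rightarrow> A' and \<psi> : B \<rightarrow> B'.
  For spatial tensor products such a \<Phi> always exists and is unique on the tensor product of
  A and B.\<close>

definition is_hom_tensor ::
  "'i op set \<Rightarrow> 'j op set \<Rightarrow> 'k op set \<Rightarrow> 'l op set \<Rightarrow> ('i op \<Rightarrow> 'k op) \<Rightarrow> ('j op \<Rightarrow> 'l op)
     \<Rightarrow> (('i \<times> 'j) op \<Rightarrow> ('k \<times> 'l) op) \<Rightarrow> bool" where
  "is_hom_tensor A B A' B' \<phi> \<psi> \<Phi> \<longleftrightarrow>
     unital_star_hom (spatial_tensor A B) (spatial_tensor A' B') \<Phi> \<and>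
     (\<forall>a\<in>A. \<forall>b\<in>B. \<Phi> (op_tensor a b) = op_tensor (\<phi> a) (\<psi> b))"

section \<open>Compact quantum groups and their actions\<close>

definition compact_quantum_group :: "'i op set \<Rightarrow> ('i op \<Rightarrow> ('i \<times> 'i) op) \<Rightarrow> bool" where
  "compact_quantum_group Q \<Delta> \<longleftrightarrow>
     unital_cstar_algebra Q \<and>
     unital_star_hom Q (spatial_tensor Q Q) \<Delta> \<and>
     (\<exists>\<Phi> \<Psi>. is_hom_tensor Q Q (spatial_tensor Q Q) Q \<Delta> id \<Phi> \<and>
            is_hom_tensor Q Q Q (spatial_tensor Q Q) id \<Delta> \<Psi> \<and>
            (\<forall>a\<in>Q. op_assoc (\<Phi> (\<Delta> a)) = \<Psi> (\<Delta> a))) \<and>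
     spatial_tensor Q Q \<subseteq> op_closure (op_span
       {op_mult (\<Delta> a) (op_tensor (unit_of Q) b) | a b. a \<in> Q \<and> b \<in> Q}) \<and>
     spatial_tensor Q Q \<subseteq> op_closure (op_span
       {op_mult (\<Delta> a) (op_tensor b (unit_of Q)) | a b. a \<in> Q \<and> b \<in> Q})"

definition cqg_morphism ::
  "'i op set \<Rightarrow> ('i op \<Rightarrow> ('i \<times> 'i) op) \<Rightarrow> 'j op set \<Rightarrow> ('j op \<Rightarrow> ('j \<times> 'j) op)
     \<Rightarrow> ('i op \<Rightarrow> 'j op) \<Rightarrow> bool" where
  "cqg_morphism Q \<Delta> R \<Delta>' \<phi> \<longleftrightarrow>
     unital_star_hom Q R \<phi> \<and>
     (\<exists>\<Phi>. is_hom_tensor Q Q R R \<phi> \<phi> \<Phi> \<and> (\<forall>a\<in>Q. \<Phi> (\<Delta> a) = \<Delta>' (\<phi> a)))"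

definition cqg_isomorphic ::
  "'i op set \<Rightarrow> ('i op \<Rightarrow> ('i \<times> 'i) op) \<Rightarrow> 'j op set \<Rightarrow> ('j op \<Rightarrow> ('j \<times> 'j) op) \<Rightarrow> bool" where
  "cqg_isomorphic Q \<Delta> R \<Delta>' \<longleftrightarrow> (\<exists>\<phi>. cqg_morphism Q \<Delta> R \<Delta>' \<phi> \<and> bij_betw \<phi> Q R)"

definition cqg_action ::
  "'b op set \<Rightarrow> 'i op set \<Rightarrow> ('i op \<Rightarrow> ('i \<times> 'i) op) \<Rightarrow> ('b op \<Rightarrow> ('b \<times> 'i) op) \<Rightarrow> bool" where
  "cqg_action B Q \<Delta> \<alpha> \<longleftrightarrow>
     unital_star_hom B (spatial_tensor B Q) \<alpha> \<and>
     (\<exists>\<Phi> \<Psi>. is_hom_tensor B Q (spatial_tensor B Q) Q \<alpha> id \<Phi> \<and>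
            is_hom_tensor B Q B (spatial_tensor Q Q) id \<Delta> \<Psi> \<and>
            (\<forall>b\<in>B. op_assoc (\<Phi> (\<alpha> b)) = \<Psi> (\<alpha> b))) \<and>
     spatial_tensor B Q \<subseteq> op_closure (op_span
       {op_mult (\<alpha> b) (op_tensor (unit_of B) q) | b q. b \<in> B \<and> q \<in> Q})"

definition closed_ideal :: "'i op set \<Rightarrow> 'i op set \<Rightarrow> bool" where
  "closed_ideal Q J \<longleftrightarrow>
     J \<subseteq> Q \<and> op_zero \<in> J \<and>
     (\<forall>a\<in>J. \<forall>b\<in>J. op_add a b \<in> J) \<and>
     (\<forall>c. \<forall>a\<in>J. op_scale c a \<in> J) \<and>
     (\<forall>q\<in>Q. \<forall>a\<in>J. op_mult q a \<in> J \<and> op_mult a q \<in> J) \<and>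
     op_closure J \<subseteq> J"

definition commutator_ideal :: "'i op set \<Rightarrow> 'i op set" where
  "commutator_ideal Q = \<Inter>{J. closed_ideal Q J \<and>
     (\<forall>a\<in>Q. \<forall>b\<in>Q. op_diff (op_mult a b) (op_mult b a) \<in> J)}"

text \<open>(R, \<Delta>') together with \<pi> is (a faithful representation of) the quotient of Q by its commutator
  ideal: \<pi> induces an isomorphism of C*-algebras from the quotient onto R, and \<Delta>' is the induced
  coproduct because \<pi> intertwines the coproducts and is surjective.\<close>

definition is_abelianization ::
  "'i op set \<Rightarrow> ('i op \<Rightarrow> ('i \<times> 'i) op) \<Rightarrow> 'j op set \<Rightarrow> ('j op \<Rightarrow> ('j \<times> 'j) op)
     \<Rightarrow> ('i op \<Rightarrow> 'j op) \<Rightarrow> bool" where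
  "is_abelianization Q \<Delta> R \<Delta>' \<pi> \<longleftrightarrow>
     compact_quantum_group R \<Delta>' \<and>
     cqg_morphism Q \<Delta> R \<Delta>' \<pi> \<and>
     \<pi> ` Q = R \<and>
     {a \<in> Q. \<pi> a = op_zero} = commutator_ideal Q"

section \<open>Discrete groups and their quantum isometry groups\<close>

text \<open>The unitary \<lambda>_g acts on l2(carrier G), regarded as a subspace of l2('g).\<close>

definition regular_op :: "('g, 'm) monoid_scheme \<Rightarrow> 'g \<Rightarrow> 'g op" where
  "regular_op G g = (\<lambda>h k. if h \<in> carrier G \<and> k \<in> carrier G \<and> h = g \<otimes>\<^bsub>G\<^esub> k then 1 else 0)"

definition reduced_group_algebra :: "('g, 'm) monoid_scheme \<Rightarrow> 'g op set" where
  "reduced_group_algebra G = op_closure (op_span (regular_op G ` carrier G))"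

definition canonical_trace :: "('g, 'm) monoid_scheme \<Rightarrow> 'g op \<Rightarrow> complex" where
  "canonical_trace G T = T \<one>\<^bsub>G\<^esub> \<one>\<^bsub>G\<^esub>"

definition word_length :: "('g, 'm) monoid_scheme \<Rightarrow> 'g set \<Rightarrow> 'g \<Rightarrow> nat" where
  "word_length G S g =
     (LEAST r. \<exists>ws. set ws \<subseteq> S \<and> length ws = r \<and> foldr (\<lambda>a b. a \<otimes>\<^bsub>G\<^esub> b) ws \<one>\<^bsub>G\<^esub> = g)"

definition sphere :: "('g, 'm) monoid_scheme \<Rightarrow> 'g set \<Rightarrow> nat \<Rightarrow> 'g set" where
  "sphere G S r = {g \<in> carrier G. word_length G S g = r}"

text \<open>Objects of the category defining the quantum isometry group, for a group G with finite symmetric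
  generating set S. The canonical trace is the vector state of delta_1, so its slice map
  on the tensor product is op_slice at the neutral element.\<close>

definition qiso_object ::
  "('g, 'm) monoid_scheme \<Rightarrow> 'g set \<Rightarrow> 'i op set \<Rightarrow> ('i op \<Rightarrow> ('i \<times> 'i) op)
     \<Rightarrow> ('g op \<Rightarrow> ('g \<times> 'i) op) \<Rightarrow> bool" where
  "qiso_object G S Q \<Delta> \<alpha> \<longleftrightarrow>
     compact_quantum_group Q \<Delta> \<and>
     cqg_action (reduced_group_algebra G) Q \<Delta> \<alpha> \<and>
     (\<forall>b\<in>reduced_group_algebra G.
        op_slice \<one>\<^bsub>G\<^esub> (\<alpha> b) = op_scale (canonical_trace G b) (unit_of Q)) \<and>
     (\<forall>r. \<alpha> ` op_span (regular_op G ` sphere G S r) \<subseteq>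
        op_span {op_tensor (regular_op G h) q | h q. h \<in> sphere G S r \<and> q \<in> Q})"

definition qiso_morphism ::
  "('g, 'm) monoid_scheme
     \<Rightarrow> 'i op set \<Rightarrow> ('i op \<Rightarrow> ('i \<times> 'i) op) \<Rightarrow> ('g op \<Rightarrow> ('g \<times> 'i) op)
     \<Rightarrow> 'j op set \<Rightarrow> ('j op \<Rightarrow> ('j \<times> 'j) op) \<Rightarrow> ('g op \<Rightarrow> ('g \<times> 'j) op)
     \<Rightarrow> ('i op \<Rightarrow> 'j op) \<Rightarrow> bool" where
  "qiso_morphism G Q \<Delta> \<alpha> Q' \<Delta>' \<alpha>' \<phi> \<longleftrightarrow>
     cqg_morphism Q \<Delta> Q' \<Delta>' \<phi> \<and>
     (\<exists>\<Phi>. is_hom_tensor (reduced_group_algebra G) Q (reduced_group_algebra G) Q' id \<phi> \<Phi> \<and>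
          (\<forall>b\<in>reduced_group_algebra G. \<Phi> (\<alpha> b) = \<alpha>' b))"

text \<open>Universality is tested on all objects whose algebra acts on l2('i). If 'i is infinite, this is
  no restriction: the coefficients of the action of any object generate a separable object,
  which acts on l2('i) up to isomorphism, and through which the universal morphism
  factors.\<close>

definition is_quantum_isometry_group ::
  "('g, 'm) monoid_scheme \<Rightarrow> 'g set \<Rightarrow> 'i op set \<Rightarrow> ('i op \<Rightarrow> ('i \<times> 'i) op)
     \<Rightarrow> ('g op \<Rightarrow> ('g \<times> 'i) op) \<Rightarrow> bool" where
  "is_quantum_isometry_group G S Q \<Delta> \<alpha> \<longleftrightarrow>
     qiso_object G S Q \<Delta> \<alpha> \<and>
     (\<forall>(Q' :: 'i op set) \<Delta>' \<alpha>'. qiso_object G S Q' \<Delta>' \<alpha>' \<longrightarrow>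
        (\<exists>\<phi>. qiso_morphism G Q \<Delta> \<alpha> Q' \<Delta>' \<alpha>' \<phi> \<and>
           (\<forall>\<psi>. qiso_morphism G Q \<Delta> \<alpha> Q' \<Delta>' \<alpha>' \<psi> \<longrightarrow> (\<forall>a\<in>Q. \<psi> a = \<phi> a))))"

section \<open>Powers of a cyclic group\<close>

definition cyclic_group :: "enat \<Rightarrow> int monoid" where
  "cyclic_group n = (case n of enat m \<Rightarrow> integer_mod_group m | \<infinity> \<Rightarrow> integer_group)"

definition cyclic_power :: "nat \<Rightarrow> enat \<Rightarrow> (nat \<Rightarrow> int) monoid" where
  "cyclic_power k n = product_group {..<k} (\<lambda>_. cyclic_group n)"

text \<open>The integer 1 represents the standard generator of the cyclic group of order n for n \<ge> 2.\<close>

definition standard_generator :: "nat \<Rightarrow> nat \<Rightarrow> nat \<Rightarrow> int" where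
  "standard_generator k i = (\<lambda>j\<in>{..<k}. if j = i then 1 else 0)"

definition standard_generators :: "nat \<Rightarrow> enat \<Rightarrow> (nat \<Rightarrow> int) set" where
  "standard_generators k n =
     standard_generator k ` {..<k} \<union>
     (\<lambda>i. inv\<^bsub>cyclic_power k n\<^esub> (standard_generator k i)) ` {..<k}"

end

theory Submission
  imports Defs
begin

text \<open>
The quotient map \<pi> from \<open>Q\<close> onto its abelianization is a morphism of compact quantum groups, and it
is injective as soon as \<open>Q\<close> is commutative, since then the commutator ideal is zero. So everything
rests on the commutativity of the quantum isometry group (\<open>quantum_isometry_group_commutative\<close>).

Write \<open>w h g\<close> for the coefficient of \<open>\<lambda>_h\<close> in \<open>\<alpha> \<lambda>_g\<close>. The action preserves word length, so for a
generator \<open>g\<close> only generators \<open>h\<close> occur. As \<open>\<alpha>\<close> is multiplicative and the group is abelian, comparing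
\<open>\<alpha> \<lambda>_g \<alpha> \<lambda>_h\<close> with \<open>\<alpha> \<lambda>_h \<alpha> \<lambda>_g\<close>, coefficient by coefficient, yields quadratic relations between the
columns of the matrix \<open>w\<close>. They are short, because a non-trivial product \<open>s t\<close> of two generators
determines the unordered pair \<open>{s, t}\<close>; in \<open>Z_n^k\<close> this fails exactly when the square of a generator
is its own inverse, that is for \<open>n = 4\<close>, while for \<open>n = 2\<close> the generators are involutions.

The matrix \<open>w\<close> on the generators is unitary: it is isometric because \<open>\<alpha>\<close> preserves the trace
(\<open>w_isometry\<close>) and coisometric because of the density condition on the action (\<open>w_coisometry\<close>).
Hence \<open>w\<close> intertwines not only the multiplication map \<open>(s, t) \<mapsto> s t\<close> but also its adjoint, and the
transposed matrix satisfies the same quadratic relations (\<open>transposed_product\<close>). From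
the relations for \<open>w\<close> and its transpose it follows by a computation with squares that
distinct entries of a column or a row have product zero, that all entries are normal, and finally
that all entries commute (\<open>column_products_vanish\<close>,
\<open>coefficients_commute\<close>).

It remains to see that the coefficients generate \<open>Q\<close>. The C*-algebra \<open>Q0\<close> generated by them, with the
restricted coproduct and the same action, is again an object of the category
(\<open>qiso_object_Q0\<close>). By universality there is a morphism from \<open>Q\<close> to \<open>Q0\<close>, and its composition with
the inclusion is an endomorphism of \<open>Q\<close>, hence the identity; thus \<open>Q = Q0\<close>. That the structure maps
restrict to \<open>Q0\<close> uses one piece of C*-theory, the contractivity of *-homomorphisms
(\<open>star_hom_contractive\<close>). For a selfadjoint contraction \<open>b\<close> it is obtained by completing \<open>b\<close> to the
unitary \<open>b + i sqrt (1 - b\<^sup>2)\<close>, with the square root given by the binomial series. The operators are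
matrices here, so the Banach *-algebra that carries this argument is built first.\<close>

section \<open>Square summable families and bounded matrices\<close>

text \<open>The bound is imposed on finite partial sums, which is what survives when an estimate for finitely
  supported vectors is carried to a limit.\<close>
definition l2_bound :: "real \<Rightarrow> ('i \<Rightarrow> complex) \<Rightarrow> bool" where
  "l2_bound C x \<longleftrightarrow> (\<forall>F. finite F \<longrightarrow> L2_set (\<lambda>i. cmod (x i)) F \<le> C)"

lemma l2_boundD: "l2_bound C x \<Longrightarrow> finite F \<Longrightarrow> L2_set (\<lambda>i. cmod (x i)) F \<le> C"
  by (simp add: l2_bound_def)

lemma l2_bound_nonneg: "l2_bound C x \<Longrightarrow> 0 \<le> C"
  using l2_boundD[of C x "{}"] by simp

lemma L2_set_mono_set:
  assumes "finite B" "A \<subseteq> B"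
  shows "L2_set f A \<le> L2_set f B"
  unfolding L2_set_def by (intro real_sqrt_le_mono sum_mono2) (use assms in auto)

lemma l2_bound_finite_support:
  assumes "finite F" "\<And>i. i \<notin> F \<Longrightarrow> x i = 0"
  shows "l2_bound (L2_set (\<lambda>i. cmod (x i)) F) x"
proof -
  have "L2_set (\<lambda>i. cmod (x i)) G \<le> L2_set (\<lambda>i. cmod (x i)) F" if "finite G" for G
  proof -
    have "(\<Sum>i\<in>G. (cmod (x i))\<^sup>2) = (\<Sum>i\<in>G\<inter>F. (cmod (x i))\<^sup>2)"
      by (rule sum.mono_neutral_right) (use that assms in auto)
    hence "L2_set (\<lambda>i. cmod (x i)) G = L2_set (\<lambda>i. cmod (x i)) (G \<inter> F)"
      by (simp add: L2_set_def)
    also have "\<dots> \<le> L2_set (\<lambda>i. cmod (x i)) F"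
      by (rule L2_set_mono_set) (use assms in auto)
    finally show ?thesis .
  qed
  thus ?thesis by (simp add: l2_bound_def)
qed

lemma cmod_sum_mult_le_L2:
  "cmod (\<Sum>i\<in>F. x i * y i) \<le> L2_set (\<lambda>i. cmod (x i)) F * L2_set (\<lambda>i. cmod (y i)) F"
proof -
  have "cmod (\<Sum>i\<in>F. x i * y i) \<le> (\<Sum>i\<in>F. \<bar>cmod (x i)\<bar> * \<bar>cmod (y i)\<bar>)"
    by (rule order_trans[OF norm_sum]) (simp add: norm_mult)
  also have "\<dots> \<le> L2_set (\<lambda>i. cmod (x i)) F * L2_set (\<lambda>i. cmod (y i)) F"
    by (rule L2_set_mult_ineq)
  finally show ?thesis .
qed

lemma l2_mult_abs_summable:
  assumes "l2_bound C x" "l2_bound D y"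
  shows "(\<lambda>i. norm (x i * y i)) summable_on A"
    and "cmod (\<Sum>\<^sub>\<infinity>i\<in>A. x i * y i) \<le> C * D"
proof -
  have fin: "(\<Sum>i\<in>F. cmod (x i * y i)) \<le> C * D" if "finite F" for F
  proof -
    have "(\<Sum>i\<in>F. cmod (x i * y i)) = (\<Sum>i\<in>F. \<bar>cmod (x i)\<bar> * \<bar>cmod (y i)\<bar>)"
      by (simp add: norm_mult)
    also have "\<dots> \<le> L2_set (\<lambda>i. cmod (x i)) F * L2_set (\<lambda>i. cmod (y i)) F"
      by (rule L2_set_mult_ineq)
    also have "\<dots> \<le> C * D"
      using l2_bound_nonneg[OF assms(1)]
      by (intro mult_mono l2_boundD[OF assms(1)] l2_boundD[OF assms(2)] that) auto
    finally show ?thesis .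
  qed
  show s: "(\<lambda>i. norm (x i * y i)) summable_on A"
    by (rule nonneg_bdd_above_summable_on) (auto intro!: bdd_aboveI2[where M="C*D"] fin)
  show "cmod (\<Sum>\<^sub>\<infinity>i\<in>A. x i * y i) \<le> C * D"
    by (rule order_trans[OF norm_infsum_bound[OF s]])
       (rule infsum_le_finite_sums[OF s fin])
qed

lemma l2_mult_summable:
  assumes "l2_bound C x" "l2_bound D y"
  shows "(\<lambda>i. x i * y i) summable_on A"
  by (rule abs_summable_summable[OF l2_mult_abs_summable(1)[OF assms]])

text \<open>Pairing the vector with itself gives its squared norm.\<close>

lemma L2_set_le_by_duality:
  assumes "finite F" "0 \<le> K"
    and le: "\<And>z. cmod (\<Sum>i\<in>F. cnj (z i) * w i) \<le> K * L2_set (\<lambda>i. cmod (z i)) F"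
  shows "L2_set (\<lambda>i. cmod (w i)) F \<le> K"
proof -
  let ?l = "L2_set (\<lambda>i. cmod (w i)) F"
  have "(\<Sum>i\<in>F. cnj (w i) * w i) = complex_of_real (\<Sum>i\<in>F. (cmod (w i))\<^sup>2)"
    by (simp add: complex_norm_square mult.commute del: of_real_power)
  hence "cmod (\<Sum>i\<in>F. cnj (w i) * w i) = ?l\<^sup>2"
    by (simp add: L2_set_def sum_nonneg del: of_real_sum)
  hence "?l * ?l \<le> K * ?l" using le[of w] by (simp add: power2_eq_square)
  thus ?thesis
    using assms(2) L2_set_nonneg[of "\<lambda>i. cmod (w i)" F]
    by (cases "?l = 0") (auto simp: mult_le_cancel_right)
qed

lemma op_bound_nonneg:
  assumes "op_bound C M" shows "0 \<le> C"
proof -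
  have "cmod (M undefined undefined) \<le> C"
    using assms[unfolded op_bound_def, rule_format, of "{undefined}" "\<lambda>_. 1" "\<lambda>_. 1"] by simp
  thus ?thesis using norm_ge_zero[of "M undefined undefined"] by linarith
qed

lemma has_sum_sum:
  fixes f :: "'a \<Rightarrow> 'b \<Rightarrow> 'c::topological_comm_monoid_add"
  assumes "\<And>i. i \<in> F \<Longrightarrow> (f i has_sum s i) A"
  shows "((\<lambda>x. \<Sum>i\<in>F. f i x) has_sum (\<Sum>i\<in>F. s i)) A"
  using assms by (induction F rule: infinite_finite_induct) (auto intro: has_sum_add)

text \<open>Extending both vectors by zero to the union of their supports reduces a rectangular block of the
  matrix to a square one.\<close>
lemma op_bound_rectangle:
  assumes M: "op_bound C M" and F: "finite F" "finite G"
  shows "cmod (\<Sum>i\<in>F. \<Sum>j\<in>G. cnj (x i) * M i j * y j)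
       \<le> C * L2_set (\<lambda>i. cmod (x i)) F * L2_set (\<lambda>j. cmod (y j)) G"
proof -
  let ?x = "\<lambda>i. if i \<in> F then x i else 0" and ?y = "\<lambda>j. if j \<in> G then y j else 0"
  have "(\<Sum>i\<in>F\<union>G. \<Sum>j\<in>F\<union>G. cnj (?x i) * M i j * ?y j) = (\<Sum>i\<in>F\<union>G. \<Sum>j\<in>G. cnj (?x i) * M i j * ?y j)"
    by (intro sum.cong sum.mono_neutral_right) (use F in auto)
  also have "\<dots> = (\<Sum>i\<in>F. \<Sum>j\<in>G. cnj (?x i) * M i j * ?y j)"
    by (intro sum.mono_neutral_right) (use F in auto)
  also have "\<dots> = (\<Sum>i\<in>F. \<Sum>j\<in>G. cnj (x i) * M i j * y j)"
    by (intro sum.cong) auto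
  finally have 1: "(\<Sum>i\<in>F. \<Sum>j\<in>G. cnj (x i) * M i j * y j)
    = (\<Sum>i\<in>F\<union>G. \<Sum>j\<in>F\<union>G. cnj (?x i) * M i j * ?y j)" by simp
  have 2: "(\<Sum>i\<in>F\<union>G. (cmod (?x i))\<^sup>2) = (\<Sum>i\<in>F. (cmod (x i))\<^sup>2)"
    by (rule sum.mono_neutral_cong_right) (use F in auto)
  have 3: "(\<Sum>i\<in>F\<union>G. (cmod (?y i))\<^sup>2) = (\<Sum>i\<in>G. (cmod (y i))\<^sup>2)"
    by (rule sum.mono_neutral_cong_right) (use F in auto)
  have "cmod (\<Sum>i\<in>F\<union>G. \<Sum>j\<in>F\<union>G. cnj (?x i) * M i j * ?y j)
     \<le> C * L2_set (\<lambda>i. cmod (?x i)) (F\<union>G) * L2_set (\<lambda>j. cmod (?y j)) (F\<union>G)"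
    by (rule M[unfolded op_bound_def, rule_format]) (use F in simp)
  thus ?thesis unfolding 1 by (simp only: L2_set_def 2 3)
qed

lemma op_boundI:
  assumes "\<And>F x y. finite F \<Longrightarrow> cmod (\<Sum>i\<in>F. \<Sum>j\<in>F. cnj (x i) * M i j * y j)
       \<le> C * L2_set (\<lambda>i. cmod (x i)) F * L2_set (\<lambda>j. cmod (y j)) F"
  shows "op_bound C M"
  using assms by (simp add: op_bound_def)

lemma op_bound_entry:
  assumes "op_bound C M" shows "cmod (M i j) \<le> C"
  using op_bound_rectangle[OF assms, of "{i}" "{j}" "\<lambda>_. 1" "\<lambda>_. 1"] by simp

lemma op_bound_mono:
  assumes "op_bound C M" "C \<le> D" shows "op_bound D M"
proof (rule op_boundI)
  fix F :: "'a set" and x y assume "finite F"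
  hence "cmod (\<Sum>i\<in>F. \<Sum>j\<in>F. cnj (x i) * M i j * y j)
       \<le> C * (L2_set (\<lambda>i. cmod (x i)) F * L2_set (\<lambda>j. cmod (y j)) F)"
    using op_bound_rectangle[OF assms(1), of F F x y] by (simp add: mult.assoc)
  also have "\<dots> \<le> D * (L2_set (\<lambda>i. cmod (x i)) F * L2_set (\<lambda>j. cmod (y j)) F)"
    by (rule mult_right_mono[OF assms(2)]) simp
  finally show "cmod (\<Sum>i\<in>F. \<Sum>j\<in>F. cnj (x i) * M i j * y j)
       \<le> D * L2_set (\<lambda>i. cmod (x i)) F * L2_set (\<lambda>j. cmod (y j)) F"
    by (simp add: mult.assoc)
qed

lemma op_bound_adj:
  assumes "op_bound C M" shows "op_bound C (op_adj M)"
proof (rule op_boundI)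
  fix F :: "'a set" and x y assume F: "finite F"
  have "(\<Sum>i\<in>F. \<Sum>j\<in>F. cnj (x i) * op_adj M i j * y j) = cnj (\<Sum>j\<in>F. \<Sum>i\<in>F. cnj (y j) * M j i * x i)"
    by (subst sum.swap) (simp add: op_adj_def algebra_simps)
  hence "cmod (\<Sum>i\<in>F. \<Sum>j\<in>F. cnj (x i) * op_adj M i j * y j)
    = cmod (\<Sum>j\<in>F. \<Sum>i\<in>F. cnj (y j) * M j i * x i)"
    by (simp only: complex_mod_cnj)
  also have "\<dots> \<le> C * L2_set (\<lambda>i. cmod (y i)) F * L2_set (\<lambda>j. cmod (x j)) F"
    by (rule op_bound_rectangle[OF assms F F])
  finally show "cmod (\<Sum>i\<in>F. \<Sum>j\<in>F. cnj (x i) * op_adj M i j * y j)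
    \<le> C * L2_set (\<lambda>i. cmod (x i)) F * L2_set (\<lambda>j. cmod (y j)) F"
    by (simp add: mult_ac)
qed

lemma op_bound_row_l2:
  assumes "op_bound C M" shows "l2_bound C (M i)"
  unfolding l2_bound_def
proof (intro allI impI)
  fix F :: "'a set" assume F: "finite F"
  show "L2_set (\<lambda>j. cmod (M i j)) F \<le> C"
  proof (rule L2_set_le_by_duality[OF F op_bound_nonneg[OF assms]])
    fix z
    show "cmod (\<Sum>j\<in>F. cnj (z j) * M i j) \<le> C * L2_set (\<lambda>i. cmod (z i)) F"
      using op_bound_rectangle[OF assms, of "{i}" F "\<lambda>_. 1" "\<lambda>j. cnj (z j)"] F
      by (simp add: mult.commute)
  qed
qed

lemma op_bound_col_l2:
  assumes "op_bound C M" shows "l2_bound C (\<lambda>i. M i j)"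
  using op_bound_row_l2[OF op_bound_adj[OF assms], of j]
  by (simp add: op_adj_def l2_bound_def)

definition op_apply :: "'i op \<Rightarrow> ('i \<Rightarrow> complex) \<Rightarrow> 'i \<Rightarrow> complex" where
  "op_apply M y = (\<lambda>i. \<Sum>\<^sub>\<infinity>j. M i j * y j)"

text \<open>By duality it suffices to pair with finitely supported vectors; these pairings are limits of the
  finite forms that the operator bound controls.\<close>
lemma l2_bound_op_apply:
  assumes M: "op_bound C M" and y: "l2_bound D y"
  shows "l2_bound (C * D) (op_apply M y)"
  unfolding l2_bound_def
proof (intro allI impI)
  fix F :: "'a set" assume F: "finite F"
  have D0: "0 \<le> D" and C0: "0 \<le> C" using l2_bound_nonneg[OF y] op_bound_nonneg[OF M] .
  show "L2_set (\<lambda>i. cmod (op_apply M y i)) F \<le> C * D"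
  proof (rule L2_set_le_by_duality[OF F])
    fix z
    have row: "(\<lambda>j. M i j * y j) summable_on UNIV" for i
      by (rule l2_mult_summable[OF op_bound_row_l2[OF M] y])
    have "((\<lambda>j. \<Sum>i\<in>F. cnj (z i) * (M i j * y j)) has_sum (\<Sum>i\<in>F. cnj (z i) * op_apply M y i)) UNIV"
      unfolding op_apply_def
      by (intro has_sum_sum has_sum_cmult_right has_sum_infsum row)
    hence lim: "((\<lambda>G. cmod (\<Sum>j\<in>G. \<Sum>i\<in>F. cnj (z i) * (M i j * y j)))
       \<longlongrightarrow> cmod (\<Sum>i\<in>F. cnj (z i) * op_apply M y i)) (finite_subsets_at_top UNIV)"
      unfolding has_sum_def by (rule tendsto_norm)
    have "cmod (\<Sum>j\<in>G. \<Sum>i\<in>F. cnj (z i) * (M i j * y j)) \<le> C * D * L2_set (\<lambda>i. cmod (z i)) F"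
      if "finite G" for G
    proof -
      have "(\<Sum>j\<in>G. \<Sum>i\<in>F. cnj (z i) * (M i j * y j)) = (\<Sum>i\<in>F. \<Sum>j\<in>G. cnj (z i) * M i j * y j)"
        by (subst sum.swap) (simp add: mult.assoc)
      hence "cmod (\<Sum>j\<in>G. \<Sum>i\<in>F. cnj (z i) * (M i j * y j)) \<le>
        C * L2_set (\<lambda>i. cmod (z i)) F * L2_set (\<lambda>j. cmod (y j)) G"
        using op_bound_rectangle[OF M F that, of z y] by simp
      also have "\<dots> \<le> C * L2_set (\<lambda>i. cmod (z i)) F * D"
        by (intro mult_left_mono l2_boundD[OF y that] mult_nonneg_nonneg C0) auto
      finally show ?thesis by (simp add: mult_ac)
    qed
    hence "eventually (\<lambda>G. cmod (\<Sum>j\<in>G. \<Sum>i\<in>F. cnj (z i) * (M i j * y j)) \<le> C * D * L2_set (\<lambda>i. cmod (z i)) F)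
       (finite_subsets_at_top UNIV)"
      by (auto simp: eventually_finite_subsets_at_top)
    thus "cmod (\<Sum>i\<in>F. cnj (z i) * op_apply M y i) \<le> C * D * L2_set (\<lambda>i. cmod (z i)) F"
      by (rule tendsto_upperbound[OF lim]) simp
  qed (use C0 D0 in simp)
qed

lemma l2_tail_small:
  assumes y: "l2_bound D y" and e: "0 < e"
  obtains G where "finite G" "\<And>H. finite H \<Longrightarrow> G \<subseteq> H \<Longrightarrow> l2_bound e (\<lambda>j. if j \<in> H then 0 else y j)"
proof -
  have "l2_bound D (\<lambda>j. cnj (y j))" using y by (simp add: l2_bound_def)
  from l2_mult_abs_summable(1)[OF this y]
  have s: "(\<lambda>j. (cmod (y j))\<^sup>2) summable_on UNIV"
    by (simp add: norm_mult power2_eq_square)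
  define S where "S = (\<Sum>\<^sub>\<infinity>j. (cmod (y j))\<^sup>2)"
  from infsum_finite_approximation[OF s, of "e\<^sup>2"] e
  obtain G where G: "finite G" "dist (\<Sum>j\<in>G. (cmod (y j))\<^sup>2) S \<le> e\<^sup>2"
    by (auto simp: S_def)
  have "l2_bound e (\<lambda>j. if j \<in> H then 0 else y j)" if H: "finite H" "G \<subseteq> H" for H
    unfolding l2_bound_def
  proof (intro allI impI)
    fix F :: "'a set" assume F: "finite F"
    have "(\<Sum>j\<in>F. (cmod (if j \<in> H then 0 else y j))\<^sup>2) = (\<Sum>j\<in>F - H. (cmod (y j))\<^sup>2)"
      by (rule sum.mono_neutral_cong_right) (use F in auto)
    also have "\<dots> \<le> (\<Sum>j\<in>F - G. (cmod (y j))\<^sup>2)"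
      by (rule sum_mono2) (use F H in auto)
    also have "\<dots> = (\<Sum>j\<in>(F - G) \<union> G. (cmod (y j))\<^sup>2) - (\<Sum>j\<in>G. (cmod (y j))\<^sup>2)"
      by (subst sum.union_disjoint) (use F G in auto)
    also have "(\<Sum>j\<in>(F - G) \<union> G. (cmod (y j))\<^sup>2) \<le> S"
      unfolding S_def by (rule finite_sum_le_infsum[OF s]) (use F G in auto)
    also have "S - (\<Sum>j\<in>G. (cmod (y j))\<^sup>2) \<le> e\<^sup>2"
      using G by (simp add: dist_real_def)
    finally have "(\<Sum>j\<in>F. (cmod (if j \<in> H then 0 else y j))\<^sup>2) \<le> e\<^sup>2" by simp
    thus "L2_set (\<lambda>j. cmod (if j \<in> H then 0 else y j)) F \<le> e"
      unfolding L2_set_def using e by (simp add: real_le_lsqrt sum_nonneg)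
  qed
  with G show ?thesis by (intro that[of G]) auto
qed

text \<open>A double series x M y need not converge absolutely, so its two iterated sums are compared
  by truncating y.\<close>

lemma op_apply_transpose:
  assumes M: "op_bound C M" and x: "l2_bound D x" and y: "l2_bound E y"
  shows "(\<Sum>\<^sub>\<infinity>i. x i * (\<Sum>\<^sub>\<infinity>j. M i j * y j)) = (\<Sum>\<^sub>\<infinity>j. (\<Sum>\<^sub>\<infinity>i. x i * M i j) * y j)"
proof -
  have D0: "0 \<le> D" and C0: "0 \<le> C" using l2_bound_nonneg[OF x] op_bound_nonneg[OF M] .
  let ?L = "\<Sum>\<^sub>\<infinity>i. x i * (\<Sum>\<^sub>\<infinity>j. M i j * y j)"
  let ?r = "\<lambda>j. \<Sum>\<^sub>\<infinity>i. x i * M i j"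
  have "l2_bound (C * D) (op_apply (\<lambda>i j. M j i) x)"
  proof (rule l2_bound_op_apply[OF _ x])
    show "op_bound C (\<lambda>i j. M j i)"
    proof (rule op_boundI)
      fix F :: "'a set" and z w assume F: "finite F"
      show "cmod (\<Sum>i\<in>F. \<Sum>j\<in>F. cnj (z i) * M j i * w j)
        \<le> C * L2_set (\<lambda>i. cmod (z i)) F * L2_set (\<lambda>j. cmod (w j)) F"
        using op_bound_rectangle[OF M F F, of "\<lambda>i. cnj (w i)" "\<lambda>i. cnj (z i)"]
        by (subst sum.swap) (simp add: mult.commute mult.left_commute)
    qed
  qed
  hence r: "l2_bound (C * D) ?r" by (simp add: op_apply_def mult.commute)
  have row: "(\<lambda>j. M i j * z j) summable_on UNIV" if "l2_bound E' z" for i z E'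
    by (rule l2_mult_summable[OF op_bound_row_l2[OF M] that])
  have "((\<lambda>G. \<Sum>j\<in>G. ?r j * y j) \<longlongrightarrow> ?L) (finite_subsets_at_top UNIV)"
  proof (rule tendstoI)
    fix e :: real assume e: "0 < e"
    define d where "d = e / 2 / (C * D + 1)"
    have CD: "0 < C * D + 1" using C0 D0 by (simp add: add_nonneg_pos)
    have d: "0 < d" unfolding d_def using e CD by (intro divide_pos_pos) auto
    have "(C * D + 1) * d = e / 2" unfolding d_def using CD by (metis less_numeral_extra(3) nonzero_mult_div_cancel_left times_divide_eq_right)
    hence small: "D * (C * d) < e" using d e by (simp add: algebra_simps)
    from l2_tail_small[OF y d] obtain G where G: "finite G"
      "\<And>H. finite H \<Longrightarrow> G \<subseteq> H \<Longrightarrow> l2_bound d (\<lambda>j. if j \<in> H then 0 else y j)" by blast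
    have "dist (\<Sum>j\<in>H. ?r j * y j) ?L < e" if H: "finite H" "G \<subseteq> H" for H
    proof -
      let ?t = "\<lambda>j. if j \<in> H then 0 else y j" and ?h = "\<lambda>j. if j \<in> H then y j else 0"
      have t: "l2_bound d ?t" by (rule G(2)[OF H])
      have h: "l2_bound (L2_set (\<lambda>j. cmod (?h j)) H) ?h" by (rule l2_bound_finite_support) (use H in auto)
      have hM: "(\<Sum>\<^sub>\<infinity>j. M i j * ?h j) = (\<Sum>j\<in>H. M i j * y j)" for i
      proof -
        have "(\<Sum>\<^sub>\<infinity>j. M i j * ?h j) = (\<Sum>\<^sub>\<infinity>j\<in>H. M i j * y j)"
          by (rule infsum_cong_neutral) auto
        thus ?thesis using H by simp
      qed
      have "(\<Sum>\<^sub>\<infinity>j. M i j * y j) = (\<Sum>\<^sub>\<infinity>j. M i j * ?h j + M i j * ?t j)" for i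
        by (rule infsum_cong) auto
      hence split: "(\<Sum>\<^sub>\<infinity>j. M i j * y j) = (\<Sum>j\<in>H. M i j * y j) + op_apply M ?t i" for i
        unfolding op_apply_def hM[symmetric]
        by (simp only: infsum_add[OF row[OF h] row[OF t]])
      have xMh: "((\<lambda>i. x i * (\<Sum>j\<in>H. M i j * y j)) has_sum (\<Sum>j\<in>H. ?r j * y j)) UNIV"
      proof -
        have "((\<lambda>i. \<Sum>j\<in>H. x i * M i j * y j) has_sum (\<Sum>j\<in>H. ?r j * y j)) UNIV"
          by (intro has_sum_sum has_sum_cmult_left has_sum_infsum
              l2_mult_summable[OF x op_bound_col_l2[OF M]])
        thus ?thesis by (simp only: sum_distrib_left mult.assoc)
      qed
      note Mt = l2_bound_op_apply[OF M t]
      have "?L = (\<Sum>\<^sub>\<infinity>i. x i * (\<Sum>j\<in>H. M i j * y j) + x i * op_apply M ?t i)"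
        by (simp only: split distrib_left)
      also have "\<dots> = (\<Sum>j\<in>H. ?r j * y j) + (\<Sum>\<^sub>\<infinity>i. x i * op_apply M ?t i)"
        using infsum_add[OF has_sum_imp_summable[OF xMh] l2_mult_summable[OF x Mt]]
        by (simp add: infsumI[OF xMh])
      finally have "?L - (\<Sum>j\<in>H. ?r j * y j) = (\<Sum>\<^sub>\<infinity>i. x i * op_apply M ?t i)" by simp
      hence "dist ?L (\<Sum>j\<in>H. ?r j * y j) \<le> D * (C * d)"
        using l2_mult_abs_summable(2)[OF x Mt, of UNIV] by (simp add: dist_norm)
      thus ?thesis using small by (simp add: dist_commute)
    qed
    thus "eventually (\<lambda>G. dist (\<Sum>j\<in>G. ?r j * y j) ?L < e) (finite_subsets_at_top UNIV)"
      unfolding eventually_finite_subsets_at_top using G(1) by blast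
  qed
  hence "((\<lambda>j. ?r j * y j) has_sum ?L) UNIV" by (simp add: has_sum_def)
  thus ?thesis by (simp add: infsumI)
qed

section \<open>The Banach *-algebra of bounded operators\<close>

lemma op_apply_finite:
  assumes "finite F" "\<And>j. j \<notin> F \<Longrightarrow> y j = 0"
  shows "op_apply M y i = (\<Sum>j\<in>F. M i j * y j)"
proof -
  have "op_apply M y i = (\<Sum>\<^sub>\<infinity>j\<in>F. M i j * y j)"
    unfolding op_apply_def by (rule infsum_cong_neutral) (use assms in auto)
  thus ?thesis using assms by simp
qed

text \<open>Columns of the product are obtained by applying one matrix after the other; this is how norm
  estimates for products reduce to those for vectors.\<close>
lemma op_mult_form:
  assumes M: "op_bound C M" and N: "op_bound D N" and F: "finite F"
  shows "(\<Sum>j\<in>F. op_mult M N i j * y j)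
    = op_apply M (op_apply N (\<lambda>j. if j \<in> F then y j else 0)) i"
proof -
  let ?w = "op_apply N (\<lambda>j. if j \<in> F then y j else 0)"
  have "((\<lambda>k. \<Sum>j\<in>F. M i k * N k j * y j) has_sum (\<Sum>j\<in>F. op_mult M N i j * y j)) UNIV"
    unfolding op_mult_def
    by (intro has_sum_sum has_sum_cmult_left has_sum_infsum
        l2_mult_summable[OF op_bound_row_l2[OF M] op_bound_col_l2[OF N]])
  moreover have "?w k = (\<Sum>j\<in>F. N k j * y j)" for k
    by (subst op_apply_finite[OF F]) auto
  ultimately have "((\<lambda>k. M i k * ?w k) has_sum (\<Sum>j\<in>F. op_mult M N i j * y j)) UNIV"
    by (simp add: sum_distrib_left mult.assoc)
  thus ?thesis by (simp add: op_apply_def infsumI)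
qed

lemma l2_bound_restrict:
  assumes "finite F"
  shows "l2_bound (L2_set (\<lambda>j. cmod (y j)) F) (\<lambda>j. if j \<in> F then y j else 0)"
proof -
  have "L2_set (\<lambda>j. cmod (if j \<in> F then y j else 0)) F = L2_set (\<lambda>j. cmod (y j)) F"
    by (rule L2_set_cong) auto
  thus ?thesis
    using l2_bound_finite_support[OF assms, of "\<lambda>j. if j \<in> F then y j else 0"] by simp
qed

lemma op_bound_by_vectors:
  assumes C: "0 \<le> C"
    and le: "\<And>F y. finite F \<Longrightarrow>
      L2_set (\<lambda>i. cmod (\<Sum>j\<in>F. M i j * y j)) F \<le> C * L2_set (\<lambda>j. cmod (y j)) F"
  shows "op_bound C M"
proof (rule op_boundI)
  fix F :: "'a set" and x y assume F: "finite F"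
  have "(\<Sum>i\<in>F. \<Sum>j\<in>F. cnj (x i) * M i j * y j) = (\<Sum>i\<in>F. cnj (x i) * (\<Sum>j\<in>F. M i j * y j))"
    by (simp only: sum_distrib_left mult.assoc)
  also have "cmod \<dots> \<le> L2_set (\<lambda>i. cmod (cnj (x i))) F * L2_set (\<lambda>i. cmod (\<Sum>j\<in>F. M i j * y j)) F"
    by (rule cmod_sum_mult_le_L2)
  also have "\<dots> \<le> L2_set (\<lambda>i. cmod (cnj (x i))) F * (C * L2_set (\<lambda>j. cmod (y j)) F)"
    by (rule mult_left_mono[OF le[OF F]]) simp
  finally show "cmod (\<Sum>i\<in>F. \<Sum>j\<in>F. cnj (x i) * M i j * y j)
    \<le> C * L2_set (\<lambda>i. cmod (x i)) F * L2_set (\<lambda>j. cmod (y j)) F"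
    by (simp add: mult.commute mult.left_commute)
qed

lemma op_bound_mult:
  assumes M: "op_bound C M" and N: "op_bound D N"
  shows "op_bound (C * D) (op_mult M N)"
proof (rule op_bound_by_vectors)
  fix F :: "'a set" and y assume F: "finite F"
  show "L2_set (\<lambda>i. cmod (\<Sum>j\<in>F. op_mult M N i j * y j)) F
      \<le> C * D * L2_set (\<lambda>j. cmod (y j)) F"
    using l2_boundD[OF l2_bound_op_apply[OF M l2_bound_op_apply[OF N l2_bound_restrict[OF F, of y]]] F]
    by (simp add: op_mult_form[OF M N F] mult.assoc)
qed (use op_bound_nonneg[OF M] op_bound_nonneg[OF N] in simp)

lemma op_mult_assoc:
  assumes M: "bounded_op M" and N: "bounded_op N" and P: "bounded_op P"
  shows "op_mult (op_mult M N) P = op_mult M (op_mult N P)"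
proof (intro ext)
  fix i j
  from M N P obtain C D E where *: "op_bound C M" "op_bound D N" "op_bound E P"
    by (auto simp: bounded_op_def)
  show "op_mult (op_mult M N) P i j = op_mult M (op_mult N P) i j"
    unfolding op_mult_def
    by (rule op_apply_transpose[OF *(2) op_bound_row_l2[OF *(1)] op_bound_col_l2[OF *(3)], symmetric])
qed

lemma op_adj_mult: "op_adj (op_mult M N) = op_mult (op_adj N) (op_adj M)"
  by (intro ext) (simp add: op_adj_def op_mult_def mult.commute flip: infsum_cnj)

text \<open>The nontrivial half of the C*-identity: the form of \<open>M* M\<close> at a vector \<open>y\<close> is the squared norm
  of \<open>M y\<close>.\<close>
lemma op_bound_of_adj_mult:
  assumes K: "op_bound K (op_mult (op_adj M) M)" and M: "op_bound C M"
  shows "op_bound (sqrt K) M"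
proof (rule op_bound_by_vectors)
  fix F :: "'a set" and y assume F: "finite F"
  note K0 = op_bound_nonneg[OF K]
  define w where "w = op_apply M (\<lambda>j. if j \<in> F then y j else 0)"
  have w: "w i = (\<Sum>j\<in>F. M i j * y j)" for i
    unfolding w_def by (subst op_apply_finite[OF F]) auto
  have wl: "l2_bound (C * L2_set (\<lambda>j. cmod (y j)) F) w"
    unfolding w_def by (rule l2_bound_op_apply[OF M l2_bound_restrict[OF F]])
  have w2: "(\<lambda>i. (cmod (w i))\<^sup>2) summable_on UNIV"
    using l2_mult_abs_summable(1)[OF wl wl] by (simp add: norm_mult power2_eq_square)
  have "((\<lambda>i. \<Sum>k\<in>F. \<Sum>j\<in>F. cnj (y k) * (op_adj M k i * M i j) * y j)
     has_sum (\<Sum>k\<in>F. \<Sum>j\<in>F. cnj (y k) * op_mult (op_adj M) M k j * y j)) UNIV"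
    unfolding op_mult_def
    by (intro has_sum_sum has_sum_cmult_left has_sum_cmult_right has_sum_infsum
        l2_mult_summable[OF op_bound_row_l2[OF op_bound_adj[OF M]] op_bound_col_l2[OF M]])
  moreover have "(\<Sum>k\<in>F. \<Sum>j\<in>F. cnj (y k) * (op_adj M k i * M i j) * y j) = complex_of_real ((cmod (w i))\<^sup>2)" for i
  proof -
    have "(\<Sum>k\<in>F. \<Sum>j\<in>F. cnj (y k) * (op_adj M k i * M i j) * y j)
      = (\<Sum>k\<in>F. \<Sum>j\<in>F. cnj (M i k * y k) * (M i j * y j))"
      by (simp add: op_adj_def mult.commute mult.left_commute)
    also have "\<dots> = cnj (w i) * w i"
      by (simp add: w sum_product)
    finally show ?thesis by (simp only: complex_norm_square mult.commute)
  qed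
  ultimately have "((\<lambda>i. complex_of_real ((cmod (w i))\<^sup>2))
     has_sum (\<Sum>k\<in>F. \<Sum>j\<in>F. cnj (y k) * op_mult (op_adj M) M k j * y j)) UNIV" by simp
  moreover have "((\<lambda>i. complex_of_real ((cmod (w i))\<^sup>2))
     has_sum complex_of_real (\<Sum>\<^sub>\<infinity>i. (cmod (w i))\<^sup>2)) UNIV"
    by (rule has_sum_of_real[OF has_sum_infsum[OF w2]])
  ultimately have "(\<Sum>k\<in>F. \<Sum>j\<in>F. cnj (y k) * op_mult (op_adj M) M k j * y j)
     = complex_of_real (\<Sum>\<^sub>\<infinity>i. (cmod (w i))\<^sup>2)" by (rule has_sum_unique)
  hence form: "\<bar>\<Sum>\<^sub>\<infinity>i. (cmod (w i))\<^sup>2\<bar> \<le> K * L2_set (\<lambda>j. cmod (y j)) F * L2_set (\<lambda>j. cmod (y j)) F"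
    using op_bound_rectangle[OF K F F, of y y] by (simp del: of_real_power)
  have "(\<Sum>i\<in>F. (cmod (w i))\<^sup>2) \<le> (\<Sum>\<^sub>\<infinity>i. (cmod (w i))\<^sup>2)"
    by (rule finite_sum_le_infsum[OF w2 F]) auto
  also have "\<dots> \<le> K * (L2_set (\<lambda>j. cmod (y j)) F)\<^sup>2"
    using form by (simp add: power2_eq_square mult.assoc)
  finally have "L2_set (\<lambda>i. cmod (w i)) F \<le> sqrt (K * (L2_set (\<lambda>j. cmod (y j)) F)\<^sup>2)"
    unfolding L2_set_def by (rule real_sqrt_le_mono)
  thus "L2_set (\<lambda>i. cmod (\<Sum>j\<in>F. M i j * y j)) F \<le> sqrt K * L2_set (\<lambda>j. cmod (y j)) F"
    by (simp add: w real_sqrt_mult)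
qed (use op_bound_nonneg[OF K] in simp)

lemma op_bound_add:
  assumes M: "op_bound C M" and N: "op_bound D N" shows "op_bound (C + D) (op_add M N)"
proof (rule op_boundI)
  fix F :: "'a set" and x y assume F: "finite F"
  have "(\<Sum>i\<in>F. \<Sum>j\<in>F. cnj (x i) * op_add M N i j * y j)
     = (\<Sum>i\<in>F. \<Sum>j\<in>F. cnj (x i) * M i j * y j) + (\<Sum>i\<in>F. \<Sum>j\<in>F. cnj (x i) * N i j * y j)"
    by (simp add: op_add_def sum.distrib distrib_left distrib_right)
  also have "cmod \<dots> \<le> C * L2_set (\<lambda>i. cmod (x i)) F * L2_set (\<lambda>j. cmod (y j)) F
     + D * L2_set (\<lambda>i. cmod (x i)) F * L2_set (\<lambda>j. cmod (y j)) F"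
    by (rule norm_triangle_mono[OF op_bound_rectangle[OF M F F] op_bound_rectangle[OF N F F]])
  finally show "cmod (\<Sum>i\<in>F. \<Sum>j\<in>F. cnj (x i) * op_add M N i j * y j)
     \<le> (C + D) * L2_set (\<lambda>i. cmod (x i)) F * L2_set (\<lambda>j. cmod (y j)) F"
    by (simp add: distrib_right)
qed

lemma op_bound_scale:
  assumes M: "op_bound C M" shows "op_bound (cmod c * C) (op_scale c M)"
proof (rule op_boundI)
  fix F :: "'a set" and x y assume F: "finite F"
  have "(\<Sum>i\<in>F. \<Sum>j\<in>F. cnj (x i) * op_scale c M i j * y j)
     = c * (\<Sum>i\<in>F. \<Sum>j\<in>F. cnj (x i) * M i j * y j)"
    by (simp add: op_scale_def sum_distrib_left mult.commute mult.left_commute)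
  thus "cmod (\<Sum>i\<in>F. \<Sum>j\<in>F. cnj (x i) * op_scale c M i j * y j)
     \<le> cmod c * C * L2_set (\<lambda>i. cmod (x i)) F * L2_set (\<lambda>j. cmod (y j)) F"
    using mult_left_mono[OF op_bound_rectangle[OF M F F, of x y], of "cmod c"]
    by (simp add: norm_mult mult.assoc)
qed

lemma op_bound_zero: "op_bound 0 op_zero"
  by (simp add: op_bound_def op_zero_def)

lemma op_bound_identity: "op_bound 1 (\<lambda>i j. if i = j then 1 else 0)"
proof (rule op_bound_by_vectors)
  fix F :: "'a set" and y :: "'a \<Rightarrow> complex" assume F: "finite F"
  have "(\<Sum>j\<in>F. (if i = j then 1 else 0) * y j) = (if i \<in> F then y i else 0)" for i
  proof -
    have "(\<Sum>j\<in>F. (if i = j then 1 else 0) * y j) = (\<Sum>j\<in>F. if i = j then y j else 0)"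
      by (rule sum.cong) auto
    thus ?thesis using F by simp
  qed
  thus "L2_set (\<lambda>i. cmod (\<Sum>j\<in>F. (if i = j then 1 else 0) * y j)) F \<le> 1 * L2_set (\<lambda>j. cmod (y j)) F"
    by (simp add: L2_set_def)
qed simp

text \<open>The infimum in the norm is attained, since each of the defining inequalities is closed.\<close>
lemma op_norm_bound:
  assumes "bounded_op M" shows "op_bound (op_norm M) M"
proof (rule op_boundI)
  fix F :: "'a set" and x y assume F: "finite F"
  let ?a = "cmod (\<Sum>i\<in>F. \<Sum>j\<in>F. cnj (x i) * M i j * y j)"
  let ?l = "L2_set (\<lambda>i. cmod (x i)) F * L2_set (\<lambda>j. cmod (y j)) F"
  have le: "?a \<le> C * ?l" if "op_bound C M" for C
    using op_bound_rectangle[OF that F F, of x y] by (simp add: mult.assoc)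
  have ne: "{C. op_bound C M} \<noteq> {}" using assms by (auto simp: bounded_op_def)
  show "?a \<le> op_norm M * L2_set (\<lambda>i. cmod (x i)) F * L2_set (\<lambda>j. cmod (y j)) F"
  proof (cases "?l = 0")
    case True
    obtain C where "op_bound C M" using assms by (auto simp: bounded_op_def)
    with le[OF this] True show ?thesis by (auto simp del: mult_eq_0_iff simp add: mult.assoc)
  next
    case False
    hence l: "0 < ?l" by (metis L2_set_nonneg mult_nonneg_nonneg order_le_less)
    have "?a / ?l \<le> op_norm M"
      unfolding op_norm_def
      by (rule cInf_greatest[OF ne]) (use le l in \<open>simp add: divide_le_eq\<close>)
    thus ?thesis using l by (simp add: divide_le_eq mult.assoc)
  qed
qed

lemma op_norm_le: "op_bound C M \<Longrightarrow> op_norm M \<le> C"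
  unfolding op_norm_def by (rule cInf_lower) (auto intro!: bdd_belowI op_bound_nonneg)

lemma op_norm_nonneg: "bounded_op M \<Longrightarrow> 0 \<le> op_norm M"
  using op_bound_nonneg op_norm_bound by blast

lemma bounded_opI: "op_bound C M \<Longrightarrow> bounded_op M"
  by (auto simp: bounded_op_def)

lemma summable_op_mult:
  assumes "bounded_op M" "bounded_op N"
  shows "(\<lambda>k. M i k * N k j) summable_on UNIV"
  using l2_mult_summable[OF op_bound_row_l2[OF op_norm_bound[OF assms(1)]]
      op_bound_col_l2[OF op_norm_bound[OF assms(2)]]] .

lemma op_scale_norm:
  assumes "bounded_op M" shows "op_norm (op_scale c M) = cmod c * op_norm M"
proof (rule antisym)
  show "op_norm (op_scale c M) \<le> cmod c * op_norm M"
    by (rule op_norm_le[OF op_bound_scale[OF op_norm_bound[OF assms]]])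
  have b: "bounded_op (op_scale c M)"
    using op_bound_scale[OF op_norm_bound[OF assms]] by (rule bounded_opI)
  show "cmod c * op_norm M \<le> op_norm (op_scale c M)"
  proof (cases "c = 0")
    case True
    thus ?thesis using op_norm_nonneg[OF b] by simp
  next
    case False
    have "op_scale (inverse c) (op_scale c M) = M"
      using False by (simp add: op_scale_def flip: mult.assoc)
    hence "op_norm M \<le> cmod (inverse c) * op_norm (op_scale c M)"
      using op_norm_le[OF op_bound_scale[OF op_norm_bound[OF b]], of "inverse c"] by simp
    thus ?thesis using False by (simp add: norm_inverse norm_divide field_simps)
  qed
qed

text \<open>As a type, the bounded operators form a Banach algebra in the sense of the type classes, which
  makes power series and topological closures available.\<close>
typedef 'i bop = "{M :: 'i op. bounded_op M}" morphisms mat_of Bop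
  using bounded_opI[OF op_bound_zero] by auto

setup_lifting type_definition_bop

instantiation bop :: (type) real_normed_algebra_1
begin

lift_definition zero_bop :: "'a bop" is op_zero
  by (rule bounded_opI[OF op_bound_zero])

lift_definition one_bop :: "'a bop" is "\<lambda>i j. if i = j then 1 else 0"
  by (rule bounded_opI[OF op_bound_identity])

lift_definition plus_bop :: "'a bop \<Rightarrow> 'a bop \<Rightarrow> 'a bop" is op_add
  by (meson bounded_op_def op_bound_add)

lift_definition uminus_bop :: "'a bop \<Rightarrow> 'a bop" is "op_scale (- 1)"
  by (meson bounded_op_def op_bound_scale)

definition minus_bop :: "'a bop \<Rightarrow> 'a bop \<Rightarrow> 'a bop" where
  "minus_bop x y = x + - y"

lift_definition scaleR_bop :: "real \<Rightarrow> 'a bop \<Rightarrow> 'a bop" is "\<lambda>r. op_scale (complex_of_real r)"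
  by (meson bounded_op_def op_bound_scale)

lift_definition times_bop :: "'a bop \<Rightarrow> 'a bop \<Rightarrow> 'a bop" is op_mult
  by (meson bounded_op_def op_bound_mult)

lift_definition norm_bop :: "'a bop \<Rightarrow> real" is op_norm .

definition dist_bop :: "'a bop \<Rightarrow> 'a bop \<Rightarrow> real" where
  "dist_bop x y = norm (x - y)"

definition sgn_bop :: "'a bop \<Rightarrow> 'a bop" where
  "sgn_bop x = inverse (norm x) *\<^sub>R x"

definition uniformity_bop :: "('a bop \<times> 'a bop) filter" where
  "uniformity_bop = (INF e\<in>{0 <..}. principal {(x, y). dist x y < e})"

definition open_bop :: "'a bop set \<Rightarrow> bool" where
  "open_bop U \<longleftrightarrow> (\<forall>x\<in>U. \<forall>\<^sub>F (x', y) in uniformity. x' = x \<longrightarrow> y \<in> U)"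

instance
proof
  fix x y z :: "'a bop" and a b r s :: real
  show "x - y = x + - y" by (simp add: minus_bop_def)
  show "x + y + z = x + (y + z)" by transfer (simp add: op_add_def add.assoc)
  show "x + y = y + x" by transfer (simp add: op_add_def add.commute)
  show "0 + x = x" by transfer (simp add: op_add_def op_zero_def)
  show "- x + x = 0" by transfer (simp add: op_add_def op_zero_def op_scale_def)
  show "a *\<^sub>R (x + y) = a *\<^sub>R x + a *\<^sub>R y" by transfer (simp add: op_add_def op_scale_def distrib_left)
  show "(a + b) *\<^sub>R x = a *\<^sub>R x + b *\<^sub>R x" by transfer (simp add: op_add_def op_scale_def distrib_right)
  show "a *\<^sub>R b *\<^sub>R x = (a * b) *\<^sub>R x" by transfer (simp add: op_scale_def mult.assoc)
  show "1 *\<^sub>R x = x" by transfer (simp add: op_scale_def)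
  show "x * y * z = x * (y * z)" by transfer (rule op_mult_assoc)
  show "1 * x = x"
  proof (transfer, intro ext)
    fix x :: "'a op" and i j
    have "(\<Sum>\<^sub>\<infinity>k. (if i = k then 1 else 0) * x k j) = (\<Sum>\<^sub>\<infinity>k\<in>{i}. x k j)"
      by (rule infsum_cong_neutral) auto
    thus "op_mult (\<lambda>i j. if i = j then 1 else 0) x i j = x i j" by (simp add: op_mult_def)
  qed
  show "x * 1 = x"
  proof (transfer, intro ext)
    fix x :: "'a op" and i j
    have "(\<Sum>\<^sub>\<infinity>k. x i k * (if k = j then 1 else 0)) = (\<Sum>\<^sub>\<infinity>k\<in>{j}. x i k)"
      by (rule infsum_cong_neutral) auto
    thus "op_mult x (\<lambda>i j. if i = j then 1 else 0) i j = x i j" by (simp add: op_mult_def)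
  qed
  show "(x + y) * z = x * z + y * z"
    by transfer (simp add: op_mult_def op_add_def distrib_right infsum_add summable_op_mult)
  show "x * (y + z) = x * y + x * z"
    by transfer (simp add: op_mult_def op_add_def distrib_left infsum_add summable_op_mult)
  show "a *\<^sub>R x * y = a *\<^sub>R (x * y)"
    by transfer (simp add: op_mult_def op_scale_def mult.assoc infsum_cmult_right summable_op_mult)
  show "x * a *\<^sub>R y = a *\<^sub>R (x * y)"
    by transfer (simp add: op_mult_def op_scale_def mult.left_commute infsum_cmult_right summable_op_mult)
  show "(0::'a bop) \<noteq> 1"
    by transfer (auto simp: op_zero_def fun_eq_iff)
  show "dist x y = norm (x - y)" by (simp add: dist_bop_def)
  show "sgn x = inverse (norm x) *\<^sub>R x" by (simp add: sgn_bop_def)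
  show "(norm x = 0) = (x = 0)"
  proof transfer
    fix x :: "'a op" assume x: "bounded_op x"
    have "x = op_zero" if "op_norm x = 0"
      using op_bound_entry[OF op_norm_bound[OF x]] that by (auto simp: op_zero_def fun_eq_iff)
    moreover have "op_norm (op_zero :: 'a op) = 0"
      using op_norm_le[OF op_bound_zero] op_norm_nonneg[OF bounded_opI[OF op_bound_zero]] by (rule antisym)
    ultimately show "(op_norm x = 0) = (x = op_zero)" by auto
  qed
  show "norm (x + y) \<le> norm x + norm y"
    by transfer (intro op_norm_le op_bound_add op_norm_bound)
  show "norm (a *\<^sub>R x) = \<bar>a\<bar> * norm x"
    by transfer (simp add: op_scale_norm)
  show "norm (x * y) \<le> norm x * norm y"
    by transfer (intro op_norm_le op_bound_mult op_norm_bound)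
  show "norm (1 :: 'a bop) = 1"
  proof (transfer, rule antisym)
    show "op_norm (\<lambda>i j. if i = j then 1 else 0 :: complex) \<le> 1"
      by (rule op_norm_le[OF op_bound_identity])
    show "1 \<le> op_norm (\<lambda>i j :: 'a. if i = j then 1 else 0 :: complex)"
      using op_bound_entry[OF op_norm_bound[OF bounded_opI[OF op_bound_identity]], of undefined undefined] by simp
  qed
  show "uniformity = (INF e\<in>{0 <..}. principal {(x, y :: 'a bop). dist x y < e})"
    by (simp add: uniformity_bop_def)
  show "open U = (\<forall>x\<in>U. \<forall>\<^sub>F (x', y) in uniformity. x' = x \<longrightarrow> y \<in> U)" for U :: "'a bop set"
    by (simp add: open_bop_def)
qed

end

text \<open>A Cauchy sequence converges entrywise, and the bounds on the finite forms pass to the limit.\<close>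
instance bop :: (type) banach
proof
  fix f :: "nat \<Rightarrow> 'a bop" assume f: "Cauchy f"
  have ent: "cmod (mat_of x i j) \<le> norm x" for x :: "'a bop" and i j
    by transfer (rule op_bound_entry[OF op_norm_bound])
  have diff: "mat_of (x - y) = op_diff (mat_of x) (mat_of y)" for x y :: "'a bop"
    unfolding minus_bop_def by transfer (simp add: op_add_def op_diff_def op_scale_def)
  have "Cauchy (\<lambda>n. mat_of (f n) i j)" for i j
  proof (rule CauchyI)
    fix e :: real assume "0 < e"
    then obtain N where N: "\<And>m n. m \<ge> N \<Longrightarrow> n \<ge> N \<Longrightarrow> norm (f m - f n) < e"
      using CauchyD[OF f] by blast
    have "norm (mat_of (f m) i j - mat_of (f n) i j) < e" if "m \<ge> N" "n \<ge> N" for m n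
      using ent[of "f m - f n" i j] N[OF that] by (simp add: diff op_diff_def)
    thus "\<exists>M. \<forall>m\<ge>M. \<forall>n\<ge>M. norm (mat_of (f m) i j - mat_of (f n) i j) < e" by blast
  qed
  hence "\<exists>l. (\<lambda>n. mat_of (f n) i j) \<longlonglongrightarrow> l" for i j
    using Cauchy_convergent convergent_def by blast
  then obtain L where L: "\<And>i j. (\<lambda>n. mat_of (f n) i j) \<longlonglongrightarrow> L i j" by metis
  have main: "\<exists>N. \<forall>m\<ge>N. op_bound e (op_diff (mat_of (f m)) L)" if e: "0 < e" for e
  proof -
    obtain N where N: "\<And>m n. m \<ge> N \<Longrightarrow> n \<ge> N \<Longrightarrow> norm (f m - f n) < e"
      using CauchyD[OF f e] by blast
    have "op_bound e (op_diff (mat_of (f m)) L)" if m: "m \<ge> N" for m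
    proof (rule op_boundI)
      fix F :: "'a set" and x y assume F: "finite F"
      have lim: "(\<lambda>n. cmod (\<Sum>i\<in>F. \<Sum>j\<in>F. cnj (x i) * op_diff (mat_of (f m)) (mat_of (f n)) i j * y j))
         \<longlonglongrightarrow> cmod (\<Sum>i\<in>F. \<Sum>j\<in>F. cnj (x i) * op_diff (mat_of (f m)) L i j * y j)"
        unfolding op_diff_def by (intro tendsto_intros L)
      show "cmod (\<Sum>i\<in>F. \<Sum>j\<in>F. cnj (x i) * op_diff (mat_of (f m)) L i j * y j)
         \<le> e * L2_set (\<lambda>i. cmod (x i)) F * L2_set (\<lambda>j. cmod (y j)) F"
      proof (rule LIMSEQ_le_const2[OF lim], intro exI allI impI)
        fix n assume n: "n \<ge> N"
        have "op_bound (norm (f m - f n)) (mat_of (f m - f n))"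
          unfolding norm_bop.rep_eq using mat_of by (auto intro: op_norm_bound)
        hence "op_bound e (op_diff (mat_of (f m)) (mat_of (f n)))"
          using op_bound_mono[OF _ less_imp_le[OF N[OF m n]]] by (simp add: diff)
        thus "cmod (\<Sum>i\<in>F. \<Sum>j\<in>F. cnj (x i) * op_diff (mat_of (f m)) (mat_of (f n)) i j * y j)
         \<le> e * L2_set (\<lambda>i. cmod (x i)) F * L2_set (\<lambda>j. cmod (y j)) F"
          by (rule op_bound_rectangle[OF _ F F])
      qed
    qed
    thus ?thesis by blast
  qed
  have "bounded_op L"
  proof -
    obtain N where N: "op_bound 1 (op_diff (mat_of (f N)) L)" using main[of 1] by auto
    have "L = op_add (mat_of (f N)) (op_scale (- 1) (op_diff (mat_of (f N)) L))"
      by (simp add: op_add_def op_scale_def op_diff_def)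
    moreover have "op_bound (op_norm (mat_of (f N))) (mat_of (f N))" using mat_of[of "f N"] by (simp add: op_norm_bound)
    ultimately show ?thesis
      by (metis N bounded_opI op_bound_add op_bound_scale)
  qed
  then obtain l where l: "L = mat_of l" using Bop_inverse[of L] by (metis mem_Collect_eq)
  have "f \<longlonglongrightarrow> l"
  proof (rule LIMSEQ_I)
    fix e :: real assume "0 < e"
    hence "0 < e / 2" by simp
    from main[OF this] obtain N where N: "\<And>m. m \<ge> N \<Longrightarrow> op_bound (e / 2) (op_diff (mat_of (f m)) L)" by blast
    have "norm (f m - l) < e" if "m \<ge> N" for m
    proof -
      have "op_norm (mat_of (f m - l)) \<le> e / 2"
        using op_norm_le[OF N[OF that]] by (simp only: l diff)
      thus ?thesis using \<open>0 < e\<close> by (simp add: norm_bop.rep_eq)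
    qed
    thus "\<exists>no. \<forall>n\<ge>no. norm (f n - l) < e" by blast
  qed
  thus "convergent f" by (auto simp: convergent_def)
qed

lift_definition star :: "'i bop \<Rightarrow> 'i bop" is op_adj
  by (meson bounded_op_def op_bound_adj)

lift_definition cscale :: "complex \<Rightarrow> 'i bop \<Rightarrow> 'i bop" is op_scale
  by (meson bounded_op_def op_bound_scale)

lemma star_star [simp]: "star (star x) = x"
  by transfer (simp add: op_adj_def)

lemma star_add: "star (x + y) = star x + star y"
  by transfer (simp add: op_adj_def op_add_def)

lemma star_mult: "star (x * y) = star y * star x"
  by transfer (rule op_adj_mult)

lemma star_zero [simp]: "star 0 = 0"
  by transfer (simp add: op_adj_def op_zero_def)

lemma star_cscale: "star (cscale c x) = cscale (cnj c) (star x)"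
  by transfer (simp add: op_adj_def op_scale_def)

lemma cscale_add: "cscale c (x + y) = cscale c x + cscale c y"
  by transfer (simp add: op_scale_def op_add_def distrib_left)

lemma cscale_cscale: "cscale c (cscale d x) = cscale (c * d) x"
  by transfer (simp add: op_scale_def mult.assoc)

lemma cscale_of_real: "cscale (complex_of_real r) x = r *\<^sub>R x"
  by transfer simp

lemma norm_cscale [simp]: "norm (cscale c x) = cmod c * norm x"
  by transfer (rule op_scale_norm)

lemma cscale_mult_left: "cscale c x * y = cscale c (x * y)"
  by transfer (simp add: op_mult_def op_scale_def mult.assoc infsum_cmult_right summable_op_mult)

lemma cscale_mult_right: "x * cscale c y = cscale c (x * y)"
  by transfer (simp add: op_mult_def op_scale_def mult.left_commute infsum_cmult_right summable_op_mult)

lemma norm_star [simp]: "norm (star x) = norm x"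
proof -
  have "norm (star x) \<le> norm x" for x :: "'a bop"
    by transfer (intro op_norm_le op_bound_adj op_norm_bound)
  from this[of x] this[of "star x"] show ?thesis by simp
qed

lemma norm_star_mult_self: "norm (star x * x) = (norm x)\<^sup>2"
proof (rule antisym)
  show "norm (star x * x) \<le> (norm x)\<^sup>2"
    using norm_mult_ineq[of "star x" x] by (simp add: power2_eq_square)
  have "norm x \<le> sqrt (norm (star x * x))"
  proof transfer
    fix x :: "'a op" assume x: "bounded_op x"
    from x have "bounded_op (op_mult (op_adj x) x)"
      by (meson bounded_op_def op_bound_adj op_bound_mult)
    from op_bound_of_adj_mult[OF op_norm_bound[OF this] op_norm_bound[OF x]]
    show "op_norm x \<le> sqrt (op_norm (op_mult (op_adj x) x))" by (rule op_norm_le)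
  qed
  thus "(norm x)\<^sup>2 \<le> norm (star x * x)"
    using power_mono[of "norm x" "sqrt (norm (star x * x))" 2] by simp
qed

text \<open>This turns the vanishing of \<open>x* x\<close> into that of \<open>x\<close>, and is the tool by which products of
  coefficients are shown to be zero.\<close>
lemma star_mult_self_eq_0: "star x * x = 0 \<Longrightarrow> x = 0"
  using norm_star_mult_self[of x] by simp

lemma bounded_linear_star: "bounded_linear star"
proof (rule bounded_linear_intro[where K = 1])
  show "star (r *\<^sub>R x) = r *\<^sub>R star x" for r and x :: "'a bop"
    by (simp flip: cscale_of_real add: star_cscale)
qed (simp_all add: star_add)

lemma bounded_linear_cscale: "bounded_linear (cscale c)"
proof (rule bounded_linear_intro[where K = "cmod c"])
  show "cscale c (r *\<^sub>R x) = r *\<^sub>R cscale c x" for r x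
    by (simp flip: cscale_of_real add: cscale_cscale mult.commute)
qed (simp_all add: cscale_add mult.commute)

section \<open>Tensor products of operators and slices\<close>

lemma op_bound_sum_squares:
  assumes M: "op_bound C M" and F: "finite F" "finite G"
  shows "(\<Sum>i\<in>F. (cmod (\<Sum>j\<in>G. M i j * y j))\<^sup>2) \<le> C\<^sup>2 * (\<Sum>j\<in>G. (cmod (y j))\<^sup>2)"
proof -
  have "op_apply M (\<lambda>j. if j \<in> G then y j else 0) i = (\<Sum>j\<in>G. M i j * y j)" for i
    by (subst op_apply_finite[OF F(2)]) auto
  hence "L2_set (\<lambda>i. cmod (\<Sum>j\<in>G. M i j * y j)) F \<le> C * L2_set (\<lambda>j. cmod (y j)) G"
    using l2_boundD[OF l2_bound_op_apply[OF M l2_bound_restrict[OF F(2), of y]] F(1)] by simp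
  hence "(L2_set (\<lambda>i. cmod (\<Sum>j\<in>G. M i j * y j)) F)\<^sup>2 \<le> (C * L2_set (\<lambda>j. cmod (y j)) G)\<^sup>2"
    by (rule power_mono) simp
  thus ?thesis by (simp add: L2_set_def power_mult_distrib sum_nonneg)
qed

text \<open>Apply \<open>N\<close> in the second leg first, for each fixed first index, and then \<open>M\<close> in the first leg, for
  each fixed second index; each step is a sum of estimates for a single operator.\<close>
lemma op_bound_tensor:
  assumes M: "op_bound C M" and N: "op_bound D N"
  shows "op_bound (C * D) (op_tensor M N)"
proof (rule op_bound_by_vectors)
  show CD: "0 \<le> C * D" using op_bound_nonneg[OF M] op_bound_nonneg[OF N] by simp
  fix F :: "('a \<times> 'b) set" and y :: "'a \<times> 'b \<Rightarrow> complex" assume F: "finite F"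
  define A B where "A = fst ` F" and "B = snd ` F"
  have fin: "finite A" "finite B" using F by (auto simp: A_def B_def)
  have FAB: "F \<subseteq> A \<times> B" by (force simp: A_def B_def)
  define z where "z = (\<lambda>p. if p \<in> F then y p else 0)"
  define w where "w = (\<lambda>j k. \<Sum>l\<in>B. N k l * z (j, l))"
  have T: "(\<Sum>q\<in>F. op_tensor M N p q * y q) = (\<Sum>j\<in>A. M (fst p) j * w j (snd p))" for p
  proof -
    have "(\<Sum>q\<in>F. op_tensor M N p q * y q) = (\<Sum>q\<in>A\<times>B. op_tensor M N p q * z q)"
      by (rule sum.mono_neutral_cong_left) (use fin FAB in \<open>auto simp: z_def\<close>)
    also have "\<dots> = (\<Sum>j\<in>A. \<Sum>l\<in>B. op_tensor M N p (j, l) * z (j, l))"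
      by (simp add: sum.cartesian_product)
    also have "\<dots> = (\<Sum>j\<in>A. M (fst p) j * w j (snd p))"
      by (cases p) (simp add: w_def op_tensor_def sum_distrib_left mult.assoc)
    finally show ?thesis .
  qed
  have "(\<Sum>p\<in>F. (cmod (\<Sum>q\<in>F. op_tensor M N p q * y q))\<^sup>2)
    \<le> (\<Sum>p\<in>A\<times>B. (cmod (\<Sum>j\<in>A. M (fst p) j * w j (snd p)))\<^sup>2)"
    unfolding T by (rule sum_mono2) (use fin FAB in auto)
  also have "\<dots> = (\<Sum>k\<in>B. \<Sum>i\<in>A. (cmod (\<Sum>j\<in>A. M i j * w j k))\<^sup>2)"
    by (subst sum.swap) (simp add: sum.cartesian_product case_prod_beta)
  also have "\<dots> \<le> (\<Sum>k\<in>B. C\<^sup>2 * (\<Sum>j\<in>A. (cmod (w j k))\<^sup>2))"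
    by (rule sum_mono[OF op_bound_sum_squares[OF M fin(1) fin(1)]])
  also have "\<dots> = C\<^sup>2 * (\<Sum>j\<in>A. \<Sum>k\<in>B. (cmod (\<Sum>l\<in>B. N k l * z (j, l)))\<^sup>2)"
    unfolding w_def by (subst sum.swap) (simp add: sum_distrib_left)
  also have "\<dots> \<le> C\<^sup>2 * (\<Sum>j\<in>A. D\<^sup>2 * (\<Sum>l\<in>B. (cmod (z (j, l)))\<^sup>2))"
    by (intro mult_left_mono sum_mono op_bound_sum_squares[OF N fin(2) fin(2)]) simp
  also have "(\<Sum>j\<in>A. D\<^sup>2 * (\<Sum>l\<in>B. (cmod (z (j, l)))\<^sup>2)) = D\<^sup>2 * (\<Sum>q\<in>A\<times>B. (cmod (z q))\<^sup>2)"
    by (simp add: sum_distrib_left sum.cartesian_product)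
  also have "(\<Sum>q\<in>A\<times>B. (cmod (z q))\<^sup>2) = (\<Sum>q\<in>F. (cmod (y q))\<^sup>2)"
    by (rule sum.mono_neutral_cong_right) (use fin FAB in \<open>auto simp: z_def\<close>)
  finally have "(\<Sum>p\<in>F. (cmod (\<Sum>q\<in>F. op_tensor M N p q * y q))\<^sup>2)
     \<le> (C * D)\<^sup>2 * (\<Sum>q\<in>F. (cmod (y q))\<^sup>2)" by (simp add: power_mult_distrib)
  hence "L2_set (\<lambda>p. cmod (\<Sum>q\<in>F. op_tensor M N p q * y q)) F
     \<le> sqrt ((C * D)\<^sup>2 * (\<Sum>q\<in>F. (cmod (y q))\<^sup>2))"
    unfolding L2_set_def by (rule real_sqrt_le_mono)
  also have "\<dots> = C * D * L2_set (\<lambda>q. cmod (y q)) F"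
    using CD by (simp add: L2_set_def real_sqrt_mult)
  finally show "L2_set (\<lambda>p. cmod (\<Sum>q\<in>F. op_tensor M N p q * y q)) F
     \<le> C * D * L2_set (\<lambda>q. cmod (y q)) F" .
qed

lift_definition tensor :: "'i bop \<Rightarrow> 'j bop \<Rightarrow> ('i \<times> 'j) bop" is op_tensor
  by (meson bounded_op_def op_bound_tensor)

lemma norm_tensor_le: "norm (tensor x y) \<le> norm x * norm y"
  by transfer (intro op_norm_le op_bound_tensor op_norm_bound)

lemma tensor_add_left: "tensor (x + x') y = tensor x y + tensor x' y"
  by transfer (auto simp: op_tensor_def op_add_def fun_eq_iff distrib_right)

lemma tensor_add_right: "tensor x (y + y') = tensor x y + tensor x y'"
  by transfer (auto simp: op_tensor_def op_add_def fun_eq_iff distrib_left)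

lemma tensor_cscale_left: "tensor (cscale c x) y = cscale c (tensor x y)"
  by transfer (auto simp: op_tensor_def op_scale_def fun_eq_iff)

lemma tensor_cscale_right: "tensor x (cscale c y) = cscale c (tensor x y)"
  by transfer (auto simp: op_tensor_def op_scale_def fun_eq_iff)

lemma bounded_bilinear_tensor: "bounded_bilinear tensor"
proof
  show "tensor (r *\<^sub>R x) y = r *\<^sub>R tensor x y" "tensor x (r *\<^sub>R y) = r *\<^sub>R tensor x y"
    for r and x :: "'a bop" and y :: "'b bop"
    by (simp_all flip: cscale_of_real add: tensor_cscale_left tensor_cscale_right)
  show "\<exists>K. \<forall>x y. norm (tensor x y) \<le> norm x * norm y * K"
    by (rule exI[of _ 1]) (simp add: norm_tensor_le)
qed (simp_all add: tensor_add_left tensor_add_right)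

lemma star_tensor: "star (tensor x y) = tensor (star x) (star y)"
  by transfer (auto simp: op_tensor_def op_adj_def fun_eq_iff)

text \<open>Both factors of the entry are absolutely convergent series, being pairings of a row with a column,
  so their product is an absolutely convergent double series.\<close>
lemma tensor_mult: "tensor x y * tensor x' y' = tensor (x * x') (y * y')"
proof (transfer, intro ext)
  fix a c :: "'a op" and b d :: "'b op" and p q :: "'a \<times> 'b"
  assume bd: "bounded_op a" "bounded_op b" "bounded_op c" "bounded_op d"
  obtain i k j l where pq: "p = (i, k)" "q = (j, l)" by (cases p, cases q)
  let ?f = "\<lambda>m. a i m * c m j" and ?g = "\<lambda>m. b k m * d m l"
  have f: "(\<lambda>m. norm (?f m)) summable_on UNIV"
    by (rule l2_mult_abs_summable(1)[OF op_bound_row_l2[OF op_norm_bound[OF bd(1)]]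
          op_bound_col_l2[OF op_norm_bound[OF bd(3)]]])
  have g: "(\<lambda>m. norm (?g m)) summable_on UNIV"
    by (rule l2_mult_abs_summable(1)[OF op_bound_row_l2[OF op_norm_bound[OF bd(2)]]
          op_bound_col_l2[OF op_norm_bound[OF bd(4)]]])
  have "(\<lambda>x. norm (case x of (m, n) \<Rightarrow> ?f m * ?g n)) summable_on (UNIV \<times> UNIV)"
  proof (subst Infinite_Sum.abs_summable_on_Sigma_iff, intro conjI ballI)
    show "(\<lambda>n. norm (case (m, n) of (m, n) \<Rightarrow> ?f m * ?g n)) summable_on UNIV" for m
      using summable_on_cmult_right[OF g, of "norm (?f m)"] by (simp add: norm_mult)
    have "(\<Sum>\<^sub>\<infinity>n. norm (case (m, n) of (m, n) \<Rightarrow> ?f m * ?g n)) = norm (?f m) * (\<Sum>\<^sub>\<infinity>n. norm (?g n))" for m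
      using infsum_cmult_right[OF g, of "norm (?f m)"] by (simp add: norm_mult mult.assoc)
    hence eq: "(\<lambda>m. norm (\<Sum>\<^sub>\<infinity>n. norm (case (m, n) of (m, n) \<Rightarrow> ?f m * ?g n)))
       = (\<lambda>m. norm (?f m) * norm (\<Sum>\<^sub>\<infinity>n. norm (?g n)))"
      by (simp add: abs_mult norm_mult)
    show "(\<lambda>m. norm (\<Sum>\<^sub>\<infinity>n. norm (case (m, n) of (m, n) \<Rightarrow> ?f m * ?g n))) summable_on UNIV"
      unfolding eq by (rule summable_on_cmult_left[OF f])
  qed
  hence "(\<lambda>(m, n). ?f m * ?g n) summable_on (UNIV \<times> UNIV)"
    by (rule abs_summable_summable)
  from infsum_Sigma'_banach[OF this]
  have "(\<Sum>\<^sub>\<infinity>(m, n). ?f m * ?g n) = (\<Sum>\<^sub>\<infinity>m. \<Sum>\<^sub>\<infinity>n. ?f m * ?g n)" by simp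
  also have "\<dots> = (\<Sum>\<^sub>\<infinity>m. ?f m * (\<Sum>\<^sub>\<infinity>n. ?g n))"
    by (rule infsum_cong[OF infsum_cmult_right]) (rule abs_summable_summable[OF g])
  also have "\<dots> = (\<Sum>\<^sub>\<infinity>m. ?f m) * (\<Sum>\<^sub>\<infinity>n. ?g n)"
    by (rule infsum_cmult_left) (rule abs_summable_summable[OF f])
  finally have "(\<Sum>\<^sub>\<infinity>(m, n). ?f m * ?g n) = (\<Sum>\<^sub>\<infinity>m. ?f m) * (\<Sum>\<^sub>\<infinity>n. ?g n)" .
  moreover have "op_mult (op_tensor a b) (op_tensor c d) p q = (\<Sum>\<^sub>\<infinity>(m, n). ?f m * ?g n)"
    unfolding op_mult_def op_tensor_def pq
    by (rule infsum_cong) (auto simp: mult.commute mult.left_commute)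
  ultimately show "op_mult (op_tensor a b) (op_tensor c d) p q = op_tensor (op_mult a c) (op_mult b d) p q"
    by (simp add: op_tensor_def op_mult_def pq)
qed

lemma op_bound_slice:
  assumes T: "op_bound C T" shows "op_bound C (\<lambda>k l. T (e, k) (f, l))"
proof (rule op_boundI)
  fix F :: "'b set" and x y :: "'b \<Rightarrow> complex" assume F: "finite F"
  have "cmod (\<Sum>p\<in>Pair e ` F. \<Sum>q\<in>Pair f ` F. cnj (x (snd p)) * T p q * y (snd q))
    \<le> C * L2_set (\<lambda>p. cmod (x (snd p))) (Pair e ` F) * L2_set (\<lambda>q. cmod (y (snd q))) (Pair f ` F)"
    by (rule op_bound_rectangle[OF T]) (use F in auto)
  thus "cmod (\<Sum>i\<in>F. \<Sum>j\<in>F. cnj (x i) * T (e, i) (f, j) * y j)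
    \<le> C * L2_set (\<lambda>i. cmod (x i)) F * L2_set (\<lambda>j. cmod (y j)) F"
    by (simp add: L2_set_def sum.reindex inj_on_def)
qed

text \<open>The matrix coefficient of the first leg at \<open>(e, f)\<close>. For \<open>e = f\<close> it is the slice by a vector state;
  for \<open>f = 1\<close> in a group it extracts from an element of the group algebra tensor \<open>Q\<close> the coefficient
  of \<open>\<lambda>_e\<close>.\<close>
lift_definition slice :: "'i \<Rightarrow> 'i \<Rightarrow> ('i \<times> 'j) bop \<Rightarrow> 'j bop" is
  "\<lambda>e f T k l. T (e, k) (f, l)"
  unfolding bounded_op_def by (blast intro: op_bound_slice)

lemma slice_add: "slice e f (x + y) = slice e f x + slice e f y"
  by transfer (simp add: op_add_def)

lemma slice_cscale: "slice e f (cscale c x) = cscale c (slice e f x)"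
  by transfer (simp add: op_scale_def)

lemma norm_slice_le: "norm (slice e f x) \<le> norm x"
  by transfer (intro op_norm_le op_bound_slice op_norm_bound)

lemma bounded_linear_slice: "bounded_linear (slice e f)"
  by (rule bounded_linear_intro[where K = 1])
     (simp_all flip: cscale_of_real add: slice_add slice_cscale norm_slice_le)

lemma slice_tensor: "slice e f (tensor x y) = cscale (mat_of x e f) y"
  by transfer (simp add: op_tensor_def op_scale_def)

lemma mat_entry_bounded: "cmod (mat_of x i j) \<le> norm x"
  by transfer (rule op_bound_entry[OF op_norm_bound])

lemma bounded_linear_entry: "bounded_linear (\<lambda>x. mat_of x i j)"
proof (rule bounded_linear_intro[where K = 1])
  show "mat_of (x + y) i j = mat_of x i j + mat_of y i j" for x y :: "'a bop"
    by transfer (simp add: op_add_def)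
  show "mat_of (r *\<^sub>R x) i j = r *\<^sub>R mat_of x i j" for r and x :: "'a bop"
    by transfer (simp add: op_scale_def scaleR_conv_of_real)
qed (simp add: mat_entry_bounded)

section \<open>C*-algebras of operators\<close>

text \<open>Passage from sets of matrices to sets in the type of bounded operators; for sets of bounded matrices
  it is inverse to taking the image under \<open>mat_of\<close>.\<close>
definition lift_set :: "'i op set \<Rightarrow> 'i bop set" where
  "lift_set A = {x. mat_of x \<in> A}"

lemma mat_of_mem_iff [simp]: "x \<in> lift_set A \<longleftrightarrow> mat_of x \<in> A"
  by (simp add: lift_set_def)

lemma mat_of_bounded [simp]: "bounded_op (mat_of x)"
  using mat_of[of x] by simp

lemma mat_of_Bop: "bounded_op M \<Longrightarrow> mat_of (Bop M) = M"
  by (simp add: Bop_inverse)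

lemma mat_of_simps:
  "op_add (mat_of x) (mat_of y) = mat_of (x + y)"
  "op_mult (mat_of x) (mat_of y) = mat_of (x * y)"
  "op_adj (mat_of x) = mat_of (star x)"
  "op_scale c (mat_of x) = mat_of (cscale c x)"
  "op_zero = mat_of 0"
  "op_tensor (mat_of x) (mat_of z) = mat_of (tensor x z)"
  "op_norm (mat_of x) = norm x"
  by (simp_all add: plus_bop.rep_eq times_bop.rep_eq star.rep_eq cscale.rep_eq zero_bop.rep_eq
      tensor.rep_eq norm_bop.rep_eq)

lemma op_diff_mat_of: "op_diff (mat_of x) (mat_of y) = mat_of (x - y)"
  unfolding minus_bop_def by transfer (simp add: op_add_def op_diff_def op_scale_def)

lemma mat_of_eq_iff [simp]: "mat_of x = mat_of y \<longleftrightarrow> x = y"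
  by (rule mat_of_inject)

lemma mat_of_op_closure_iff:
  assumes "\<And>s. s \<in> S \<Longrightarrow> bounded_op s"
  shows "mat_of x \<in> op_closure S \<longleftrightarrow> x \<in> closure (lift_set S)"
proof -
  have "(\<exists>s\<in>S. op_norm (op_diff (mat_of x) s) < e) \<longleftrightarrow> (\<exists>y\<in>lift_set S. dist y x < e)" for e
  proof
    assume "\<exists>s\<in>S. op_norm (op_diff (mat_of x) s) < e"
    then obtain s where s: "s \<in> S" "op_norm (op_diff (mat_of x) s) < e" by blast
    hence "op_norm (op_diff (mat_of x) (mat_of (Bop s))) < e" using assms by (simp add: mat_of_Bop)
    hence "dist (Bop s) x < e"
      by (simp add: op_diff_mat_of mat_of_simps dist_norm norm_minus_commute)
    moreover have "Bop s \<in> lift_set S" using s assms by (simp add: mat_of_Bop)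
    ultimately show "\<exists>y\<in>lift_set S. dist y x < e" by blast
  next
    assume "\<exists>y\<in>lift_set S. dist y x < e"
    then obtain y where "mat_of y \<in> S" "dist y x < e" by auto
    thus "\<exists>s\<in>S. op_norm (op_diff (mat_of x) s) < e"
      by (intro bexI[of _ "mat_of y"]) (simp_all add: op_diff_mat_of mat_of_simps dist_norm norm_minus_commute)
  qed
  thus ?thesis by (simp add: op_closure_def closure_approachable)
qed

lemma lift_set_op_closure:
  assumes "\<And>s. s \<in> S \<Longrightarrow> bounded_op s"
  shows "lift_set (op_closure S) = closure (lift_set S)"
  using mat_of_op_closure_iff[OF assms] by auto

lemma op_closure_bounded: "T \<in> op_closure S \<Longrightarrow> bounded_op T"
  by (simp add: op_closure_def)

lemma op_span_superset: "S \<subseteq> op_span S"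
proof
  fix s assume "s \<in> S"
  thus "s \<in> op_span S"
    unfolding op_span_def by (intro CollectI exI[of _ "{s}"] exI[of _ "\<lambda>_. 1"]) auto
qed

lemma op_span_zero: "op_zero \<in> op_span S"
  unfolding op_span_def op_zero_def by (intro CollectI exI[of _ "{}"]) auto

lemma op_span_scale: "x \<in> op_span S \<Longrightarrow> op_scale a x \<in> op_span S"
proof -
  assume "x \<in> op_span S"
  then obtain F c where "finite F" "F \<subseteq> S" "x = (\<lambda>i j. \<Sum>t\<in>F. c t * t i j)"
    by (auto simp: op_span_def)
  thus ?thesis
    unfolding op_span_def op_scale_def
    by (intro CollectI exI[of _ F] exI[of _ "\<lambda>t. a * c t"]) (auto simp: sum_distrib_left mult.assoc)
qed

lemma op_span_add: "x \<in> op_span S \<Longrightarrow> y \<in> op_span S \<Longrightarrow> op_add x y \<in> op_span S"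
proof -
  assume "x \<in> op_span S" "y \<in> op_span S"
  then obtain F c G d where *: "finite F" "F \<subseteq> S" "x = (\<lambda>i j. \<Sum>t\<in>F. c t * t i j)"
     "finite G" "G \<subseteq> S" "y = (\<lambda>i j. \<Sum>t\<in>G. d t * t i j)"
    by (auto simp: op_span_def)
  have "(\<Sum>t\<in>F. c t * t i j) = (\<Sum>t\<in>F\<union>G. (if t \<in> F then c t else 0) * t i j)"
    "(\<Sum>t\<in>G. d t * t i j) = (\<Sum>t\<in>F\<union>G. (if t \<in> G then d t else 0) * t i j)" for i j
    by (rule sum.mono_neutral_cong_left; use * in auto)+
  hence "op_add x y = (\<lambda>i j. \<Sum>t\<in>F\<union>G. ((if t \<in> F then c t else 0) + (if t \<in> G then d t else 0)) * t i j)"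
    by (simp only: *(3,6) op_add_def sum.distrib distrib_right)
  moreover have "finite (F \<union> G)" "F \<union> G \<subseteq> S" using * by auto
  ultimately show ?thesis unfolding op_span_def by (intro CollectI exI conjI)
qed

lemma op_span_induct [consumes 1, case_names zero base add scale]:
  assumes x: "x \<in> op_span S"
    and "P op_zero"
    and "\<And>s. s \<in> S \<Longrightarrow> P s"
    and "\<And>x y. P x \<Longrightarrow> P y \<Longrightarrow> P (op_add x y)"
    and "\<And>a x. P x \<Longrightarrow> P (op_scale a x)"
  shows "P x"
proof -
  obtain F c where F: "finite F" "F \<subseteq> S" "x = (\<lambda>i j. \<Sum>t\<in>F. c t * t i j)"
    using x by (auto simp: op_span_def)
  have "P (\<lambda>i j. \<Sum>t\<in>F. c t * t i j)" using F(1,2)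
  proof (induction F)
    case empty
    thus ?case using assms(2) by (simp add: op_zero_def)
  next
    case (insert t F)
    hence "P (op_add (op_scale (c t) t) (\<lambda>i j. \<Sum>t\<in>F. c t * t i j))" using assms by auto
    moreover have "op_add (op_scale (c t) t) (\<lambda>i j. \<Sum>t\<in>F. c t * t i j) = (\<lambda>i j. \<Sum>t\<in>insert t F. c t * t i j)"
      using insert by (simp add: op_add_def op_scale_def)
    ultimately show ?case by simp
  qed
  thus ?thesis using F by simp
qed

lemma cscale_zero [simp]: "cscale c 0 = 0"
  by transfer (simp add: op_scale_def op_zero_def)

lemma cscale_one [simp]: "cscale 1 x = x"
  by transfer (simp add: op_scale_def)

lemma cscale_uminus: "cscale (- c) x = - cscale c x"
  by transfer (simp add: op_scale_def)

lemma cscale_two: "cscale 2 x = x + x"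
  by transfer (simp add: op_scale_def op_add_def)

lemma cscale_diff: "cscale c (x - y) = cscale c x - cscale c y"
  using cscale_add[of c "x - y" y] by (simp add: algebra_simps)

text \<open>Complex subspaces; the scalar multiplication of the type class is only real.\<close>
definition csubspace :: "'i bop set \<Rightarrow> bool" where
  "csubspace W \<longleftrightarrow> 0 \<in> W \<and> (\<forall>x\<in>W. \<forall>y\<in>W. x + y \<in> W) \<and> (\<forall>c. \<forall>x\<in>W. cscale c x \<in> W)"

definition star_algebra :: "'i bop set \<Rightarrow> bool" where
  "star_algebra W \<longleftrightarrow> csubspace W \<and> (\<forall>x\<in>W. \<forall>y\<in>W. x * y \<in> W) \<and> (\<forall>x\<in>W. star x \<in> W)"

text \<open>The unit is a parameter because it may differ from the identity operator.\<close>
definition cstar_algebra :: "'i bop set \<Rightarrow> 'i bop \<Rightarrow> bool" where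
  "cstar_algebra W u \<longleftrightarrow> star_algebra W \<and> closed W \<and> u \<in> W \<and> (\<forall>x\<in>W. u * x = x \<and> x * u = x)"

definition star_hom_on :: "'i bop set \<Rightarrow> ('i bop \<Rightarrow> 'j bop) \<Rightarrow> bool" where
  "star_hom_on W f \<longleftrightarrow> (\<forall>x\<in>W. \<forall>y\<in>W. f (x + y) = f x + f y \<and> f (x * y) = f x * f y) \<and>
     (\<forall>x\<in>W. f (star x) = star (f x)) \<and> (\<forall>c. \<forall>x\<in>W. f (cscale c x) = cscale c (f x))"

lemma csubspaceD:
  assumes "csubspace W"
  shows "0 \<in> W" "x \<in> W \<Longrightarrow> y \<in> W \<Longrightarrow> x + y \<in> W" "x \<in> W \<Longrightarrow> cscale c x \<in> W"
    "x \<in> W \<Longrightarrow> r *\<^sub>R x \<in> W" "x \<in> W \<Longrightarrow> - x \<in> W" "x \<in> W \<Longrightarrow> y \<in> W \<Longrightarrow> x - y \<in> W"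
proof -
  show *: "0 \<in> W" "x \<in> W \<Longrightarrow> y \<in> W \<Longrightarrow> x + y \<in> W" "x \<in> W \<Longrightarrow> cscale c x \<in> W" for x y c
    using assms by (auto simp: csubspace_def)
  show **: "x \<in> W \<Longrightarrow> r *\<^sub>R x \<in> W" for x r
    using *(3)[of x "complex_of_real r"] by (simp add: cscale_of_real)
  show ***: "x \<in> W \<Longrightarrow> - x \<in> W" for x using **[of x "-1"] by simp
  show "x \<in> W \<Longrightarrow> y \<in> W \<Longrightarrow> x - y \<in> W"
    using *(2)[of x "- y"] ***[of y] by simp
qed

lemma csubspace_sum: "csubspace W \<Longrightarrow> (\<And>i. i \<in> I \<Longrightarrow> f i \<in> W) \<Longrightarrow> sum f I \<in> W"
  by (induction I rule: infinite_finite_induct) (auto intro: csubspaceD)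

lemma star_algebraD:
  assumes "star_algebra W"
  shows "csubspace W" "x \<in> W \<Longrightarrow> y \<in> W \<Longrightarrow> x * y \<in> W" "x \<in> W \<Longrightarrow> star x \<in> W"
  using assms by (auto simp: star_algebra_def)

lemma cstar_algebraD:
  assumes "cstar_algebra W u"
  shows "star_algebra W" "csubspace W" "closed W" "u \<in> W" "x \<in> W \<Longrightarrow> u * x = x" "x \<in> W \<Longrightarrow> x * u = x"
  using assms by (auto simp: cstar_algebra_def star_algebra_def)

text \<open>The adjoint of the unit is a unit as well.\<close>
lemma cstar_algebra_unit_selfadjoint:
  assumes "cstar_algebra W u" shows "star u = u"
proof -
  note W = cstar_algebraD[OF assms]
  have e: "u * star u = star u" by (rule W(5)[OF star_algebraD(3)[OF W(1,4)]])
  have "star (u * star u) = u * star u" by (simp only: star_mult star_star)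
  thus ?thesis by (simp add: e)
qed

text \<open>Closure properties pass from a set to its topological closure whenever the operation is continuous,
  for binary operations in each argument separately.\<close>

lemma closure_closed_under:
  assumes "continuous_on UNIV f" "\<And>x. x \<in> S \<Longrightarrow> f x \<in> T" "x \<in> closure S"
  shows "f x \<in> closure T"
proof -
  have "f ` closure S \<subseteq> closure T"
    by (rule image_closure_subset[OF continuous_on_subset[OF assms(1)]])
       (use assms(2) closure_subset[of T] in auto)
  thus ?thesis using assms(3) by blast
qed

lemma closure_closed_under2:
  assumes f: "\<And>y. continuous_on UNIV (\<lambda>x. f x y)" "\<And>x. continuous_on UNIV (f x)"
    and S: "\<And>x y. x \<in> S \<Longrightarrow> y \<in> S' \<Longrightarrow> f x y \<in> T" and x: "x \<in> closure S" and y: "y \<in> closure S'"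
  shows "f x y \<in> closure T"
proof -
  have "f x y \<in> closure T" if "y \<in> S'" for y
    by (rule closure_closed_under[OF f(1) _ x]) (rule S[OF _ that])
  hence "f x y \<in> closure (closure T)"
    by (rule closure_closed_under[OF f(2) _ y])
  thus ?thesis by simp
qed

lemma continuous_on_star: "continuous_on S star"
  by (rule linear_continuous_on[OF bounded_linear_star])

lemma continuous_on_cscale: "continuous_on S (cscale c)"
  by (rule linear_continuous_on[OF bounded_linear_cscale])

lemma csubspace_closure:
  assumes "csubspace W" shows "csubspace (closure W)"
  unfolding csubspace_def
proof (intro conjI ballI allI)
  note W = csubspaceD[OF assms]
  show "0 \<in> closure W" using W(1) closure_subset by blast
  show "x + y \<in> closure W" if "x \<in> closure W" "y \<in> closure W" for x y
    by (rule closure_closed_under2[where f = "(+)", OF _ _ _ that]) (intro continuous_intros W; assumption)+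
  show "cscale c x \<in> closure W" if "x \<in> closure W" for x c
    by (rule closure_closed_under[OF continuous_on_cscale _ that]) (rule W)
qed

lemma star_algebra_closure:
  assumes "star_algebra W" shows "star_algebra (closure W)"
  unfolding star_algebra_def
proof (intro conjI ballI)
  note W = star_algebraD[OF assms]
  show "csubspace (closure W)" by (rule csubspace_closure[OF W(1)])
  show "x * y \<in> closure W" if "x \<in> closure W" "y \<in> closure W" for x y
    by (rule closure_closed_under2[where f = "(*)", OF _ _ _ that]) (intro continuous_intros W; assumption)+
  show "star x \<in> closure W" if "x \<in> closure W" for x
    by (rule closure_closed_under[OF continuous_on_star _ that]) (rule W)
qed

definition cspan :: "'i bop set \<Rightarrow> 'i bop set" where
  "cspan P = lift_set (op_span (mat_of ` P))"

lemma lift_set_image [simp]: "lift_set (mat_of ` W) = W"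
  by (auto simp: lift_set_def)

lemma image_lift_set:
  assumes "\<And>a. a \<in> A \<Longrightarrow> bounded_op a" shows "mat_of ` lift_set A = A"
proof -
  have "a \<in> mat_of ` lift_set A" if "a \<in> A" for a
    by (rule image_eqI[of _ _ "Bop a"]) (use that assms in \<open>auto simp: mat_of_Bop\<close>)
  thus ?thesis by auto
qed

lemma op_span_bounded:
  assumes "x \<in> op_span S" "\<And>s. s \<in> S \<Longrightarrow> bounded_op s" shows "bounded_op x"
  using assms(1)
proof (induction rule: op_span_induct)
  case (add x y)
  thus ?case by (meson bounded_op_def op_bound_add)
next
  case (scale a x)
  thus ?case by (meson bounded_op_def op_bound_scale)
qed (use assms(2) op_bound_zero in \<open>auto simp: bounded_op_def\<close>)

lemma op_span_eq_cspan: "op_span (mat_of ` P) = mat_of ` cspan P"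
  unfolding cspan_def by (rule image_lift_set[symmetric]) (auto intro: op_span_bounded)

lemma op_closure_eq_closure: "op_closure (mat_of ` W) = mat_of ` closure W"
proof -
  have "op_closure (mat_of ` W) = mat_of ` lift_set (op_closure (mat_of ` W))"
    by (rule image_lift_set[symmetric]) (rule op_closure_bounded)
  also have "lift_set (op_closure (mat_of ` W)) = closure W"
    by (subst lift_set_op_closure) auto
  finally show ?thesis .
qed

lemma op_closure_op_span_eq: "op_closure (op_span (mat_of ` P)) = mat_of ` closure (cspan P)"
  by (simp only: op_span_eq_cspan op_closure_eq_closure)

lemma csubspace_cspan: "csubspace (cspan P)"
  unfolding csubspace_def cspan_def
  using op_span_zero[of "mat_of ` P"] op_span_add[of _ "mat_of ` P"] op_span_scale[of _ "mat_of ` P"]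
  by (auto simp flip: mat_of_simps)

lemma cspan_superset: "P \<subseteq> cspan P"
  unfolding cspan_def using op_span_superset[of "mat_of ` P"] by auto

lemma cspan_minimal:
  assumes "P \<subseteq> W" "csubspace W" shows "cspan P \<subseteq> W"
proof
  fix x assume "x \<in> cspan P"
  hence "mat_of x \<in> op_span (mat_of ` P)" by (simp add: cspan_def)
  hence "mat_of x \<in> mat_of ` W"
  proof (induction rule: op_span_induct)
    case zero
    show ?case unfolding mat_of_simps using csubspaceD(1)[OF assms(2)] by (rule imageI)
  next
    case (base s)
    thus ?case using assms(1) by blast
  next
    case (add M N)
    thus ?case using csubspaceD(2)[OF assms(2)] by (auto simp: mat_of_simps)
  next
    case (scale a M)
    thus ?case using csubspaceD(3)[OF assms(2)] by (auto simp: mat_of_simps)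
  qed
  thus "x \<in> W" by auto
qed

lemma closure_cspan_minimal:
  assumes "P \<subseteq> W" "csubspace W" "closed W" shows "closure (cspan P) \<subseteq> W"
  using cspan_minimal[OF assms(1,2)] assms(3) closure_minimal by blast

lemma csubspace_linear_preimage:
  assumes "csubspace W" "\<And>x y. f (x + y) = f x + f y" "\<And>c x. f (cscale c x) = cscale c (f x)"
  shows "csubspace {x. f x \<in> W}"
proof -
  have "f 0 = 0" using assms(2)[of 0 0] by simp
  thus ?thesis using csubspaceD[OF assms(1)] by (simp add: csubspace_def assms)
qed

lemma closed_linear_preimage:
  assumes "closed W" "bounded_linear f" shows "closed {x. f x \<in> W}"
  using continuous_closed_vimage[OF assms(1), of f] linear_continuous_at[OF assms(2)]
  by (simp add: vimage_def)

text \<open>Bilinearity reduces closure under products to the spanning set, one factor at a time.\<close>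
lemma star_algebra_cspan:
  assumes mult: "\<And>x y. x \<in> P \<Longrightarrow> y \<in> P \<Longrightarrow> x * y \<in> P" and adj: "\<And>x. x \<in> P \<Longrightarrow> star x \<in> P"
  shows "star_algebra (cspan P)"
  unfolding star_algebra_def
proof (intro conjI ballI)
  note C = csubspace_cspan[of P]
  show "csubspace (cspan P)" by (rule C)
  have 1: "x * y \<in> cspan P" if "x \<in> P" "y \<in> cspan P" for x y
  proof -
    have "cspan P \<subseteq> {y. x * y \<in> cspan P}"
      by (rule cspan_minimal)
         (use mult[OF that(1)] cspan_superset in
          \<open>auto intro!: csubspace_linear_preimage[OF C] simp: distrib_left cscale_mult_right\<close>)
    thus ?thesis using that by blast
  qed
  show "x * y \<in> cspan P" if "x \<in> cspan P" "y \<in> cspan P" for x y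
  proof -
    have "cspan P \<subseteq> {x. x * y \<in> cspan P}"
      by (rule cspan_minimal)
         (use 1 that in \<open>auto intro!: csubspace_linear_preimage[OF C] simp: distrib_right cscale_mult_left\<close>)
    thus ?thesis using that by blast
  qed
  show "star x \<in> cspan P" if "x \<in> cspan P" for x
  proof -
    have "csubspace {x. star x \<in> cspan P}"
      using csubspaceD[OF C] by (simp add: csubspace_def star_add star_cscale)
    hence "cspan P \<subseteq> {x. star x \<in> cspan P}"
      using adj cspan_superset by (intro cspan_minimal) auto
    thus ?thesis using that by blast
  qed
qed

lemma cstar_algebra_closure_cspan:
  assumes mult: "\<And>x y. x \<in> P \<Longrightarrow> y \<in> P \<Longrightarrow> x * y \<in> P" and adj: "\<And>x. x \<in> P \<Longrightarrow> star x \<in> P"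
    and u: "u \<in> P" "\<And>x. x \<in> P \<Longrightarrow> u * x = x" "\<And>x. x \<in> P \<Longrightarrow> x * u = x"
  shows "cstar_algebra (closure (cspan P)) u"
  unfolding cstar_algebra_def
proof (intro conjI ballI)
  show "star_algebra (closure (cspan P))"
    by (rule star_algebra_closure[OF star_algebra_cspan[OF mult adj]])
  show "u \<in> closure (cspan P)" using u(1) cspan_superset closure_subset by blast
  have "closure (cspan P) \<subseteq> {x. u * x = x}"
    by (rule closure_cspan_minimal)
       (use u in \<open>auto intro!: closed_Collect_eq continuous_intros
         simp: csubspace_def distrib_left cscale_mult_right cscale_zero\<close>)
  thus "u * x = x" if "x \<in> closure (cspan P)" for x using that by auto
  have "closure (cspan P) \<subseteq> {x. x * u = x}"
    by (rule closure_cspan_minimal)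
       (use u in \<open>auto intro!: closed_Collect_eq continuous_intros
         simp: csubspace_def distrib_right cscale_mult_left cscale_zero\<close>)
  thus "x * u = x" if "x \<in> closure (cspan P)" for x using that by auto
qed simp

section \<open>Star homomorphisms are contractive\<close>

text \<open>By the Vandermonde convolution for the exponent \<open>1/2 + 1/2 = 1\<close>, the Cauchy square of the binomial
  series collapses to its first two terms.\<close>

lemma sqrt_series:
  fixes x :: "'a::{real_normed_algebra_1, banach}"
  assumes x: "norm x < 1"
  defines "a \<equiv> \<lambda>k. ((1/2 :: real) gchoose k) * (- 1) ^ k"
  shows "summable (\<lambda>k. a k *\<^sub>R x ^ k)"
    and "suminf (\<lambda>k. a k *\<^sub>R x ^ k) * suminf (\<lambda>k. a k *\<^sub>R x ^ k) = 1 - x"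
proof -
  let ?f = "\<lambda>k. a k *\<^sub>R x ^ k"
  have "summable (\<lambda>k. norm (((1/2 :: real) gchoose k) * norm x ^ k))"
    by (rule abs_summable_in_conv_radius) (use x in \<open>simp add: conv_radius_gchoose\<close>)
  hence sn: "summable (\<lambda>k. norm (?f k))"
  proof (rule summable_comparison_test'[where N = 0])
    fix k
    have "norm (?f k) \<le> \<bar>(1/2) gchoose k\<bar> * norm x ^ k"
      by (simp add: a_def abs_mult mult_left_mono norm_power_ineq)
    thus "norm (norm (?f k)) \<le> norm (((1/2 :: real) gchoose k) * norm x ^ k)"
      by (simp add: abs_mult)
  qed
  thus "summable ?f" by (rule summable_norm_cancel)
  have coef: "(\<Sum>i\<le>n. ?f i * ?f (n - i)) = (if n = 0 then 1 else if n = 1 then - x else 0)" for n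
  proof -
    have "(\<Sum>i\<le>n. ?f i * ?f (n - i)) = (\<Sum>i\<le>n. (a i * a (n - i)) *\<^sub>R x ^ n)"
      by (rule sum.cong) (simp_all flip: power_add)
    also have "\<dots> = (\<Sum>i\<le>n. a i * a (n - i)) *\<^sub>R x ^ n"
      by (simp add: scaleR_sum_left)
    also have "(\<Sum>i\<le>n. a i * a (n - i)) = (\<Sum>i\<le>n. (- 1) ^ n * (((1/2) gchoose i) * ((1/2) gchoose (n - i))))"
      by (rule sum.cong) (simp_all add: a_def mult.commute mult.left_commute flip: power_add)
    also have "\<dots> = (- 1) ^ n * ((1/2 + 1/2 :: real) gchoose n)"
      by (simp add: gbinomial_Vandermonde flip: sum_distrib_left atLeast0AtMost)
    also have "(1/2 + 1/2 :: real) gchoose n = of_nat (1 choose n)"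
      by (simp add: binomial_gbinomial)
    finally show ?thesis by (cases n; cases "n - 1") (auto simp: binomial_eq_0)
  qed
  have "suminf ?f * suminf ?f = suminf (\<lambda>n. \<Sum>i\<le>n. ?f i * ?f (n - i))"
    by (rule Cauchy_product[OF sn sn])
  also have "\<dots> = suminf (\<lambda>n. if n = 0 then 1 else if n = 1 then - x else 0)"
    by (simp only: coef)
  also have "suminf (\<lambda>n. if n = 0 then 1 else if n = 1 then - x else 0) = (\<Sum>n\<in>{0,1::nat}. if n = 0 then 1 else if n = 1 then - x else 0)"
    by (rule suminf_finite) auto
  finally show "suminf ?f * suminf ?f = 1 - x" by simp
qed

lemma star_power: "star (x ^ n) = star x ^ n"
proof (induction n)
  case 0
  show ?case by simp (transfer, auto simp: op_adj_def fun_eq_iff)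
qed (simp add: star_mult power_commutes)

text \<open>The algebra need not contain the identity operator, so the constant term of the series is replaced
  by the unit \<open>u\<close> of the algebra. The last property allows the square root of \<open>1 - b\<^sup>2\<close> to be combined
  with \<open>b\<close> into a unitary.\<close>
lemma cstar_algebra_sqrt:
  assumes W: "cstar_algebra W u" and x: "x \<in> W" "star x = x" "norm x < 1"
  obtains c where "c \<in> W" "star c = c" "c * c = u - x" "\<And>y. y * x = x * y \<Longrightarrow> u * y = y * u \<Longrightarrow> y * c = c * y"
proof -
  note D = cstar_algebraD[OF W] note S = csubspaceD[OF D(2)]
  define a :: "nat \<Rightarrow> real" where "a = (\<lambda>k. ((1/2) gchoose k) * (- 1) ^ k)"
  let ?f = "\<lambda>k. a k *\<^sub>R x ^ k"
  have sf: "summable ?f" and sq: "suminf ?f * suminf ?f = 1 - x"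
    using sqrt_series[OF x(3)] by (simp_all add: a_def)
  define c where "c = suminf (\<lambda>k. ?f (Suc k))"
  have sf': "summable (\<lambda>k. ?f (Suc k))" using sf by (rule summable_Suc_iff[THEN iffD2])
  have split: "suminf ?f = 1 + c"
    using suminf_split_head[OF sf] by (simp add: c_def a_def algebra_simps)
  have pow: "x ^ Suc k \<in> W" for k
    by (induction k) (use x star_algebraD(2)[OF D(1)] in auto)
  have cW: "c \<in> W"
  proof -
    have "(\<lambda>n. \<Sum>k<n. ?f (Suc k)) \<longlonglongrightarrow> c"
      using sf' unfolding c_def by (rule summable_LIMSEQ)
    thus ?thesis
      by (rule closed_sequentially[OF D(3) _, rotated]) (intro allI csubspace_sum[OF D(2)] S pow)
  qed
  have cs: "star c = c"
    unfolding c_def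
    by (subst bounded_linear.suminf[OF bounded_linear_star sf'])
       (simp only: linear_scale[OF bounded_linear.linear[OF bounded_linear_star]] star_power x)
  have "(1 + c) * (1 + c) = 1 - x" using sq by (simp only: split)
  hence "1 + (c + c + c * c) = 1 + - x" by (simp add: distrib_left distrib_right add.assoc)
  hence c2: "c + c + c * c = - x" by (rule add_left_imp_eq)
  show ?thesis
  proof (rule that[of "u + c"])
    show "u + c \<in> W" using D S cW by blast
    show "star (u + c) = u + c" by (simp add: star_add cs cstar_algebra_unit_selfadjoint[OF W])
    have "(u + c) * (u + c) = u + (c + c + c * c)"
      using D(4-6) cW by (simp add: distrib_left distrib_right add.assoc)
    thus "(u + c) * (u + c) = u - x" by (simp only: c2 add_uminus_conv_diff)
    fix y assume y: "y * x = x * y" "u * y = y * u"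
    have "y * x ^ k = x ^ k * y" for k
      by (rule power_commuting_commutes[symmetric]) (simp add: y)
    hence "y * c = c * y"
      unfolding c_def by (simp only: suminf_mult[OF sf', symmetric] suminf_mult2[OF sf'] mult_scaleR_right mult_scaleR_left)
    thus "y * (u + c) = (u + c) * y" using y by (simp add: distrib_left distrib_right)
  qed
qed

text \<open>For \<open>c = sqrt (u - b\<^sup>2)\<close> the element \<open>v = b + i c\<close> satisfies \<open>v* v = u\<close>. Its image therefore has norm at
  most 1, because the image of \<open>u\<close> is a projection, and \<open>b\<close> is the real part of \<open>v\<close>.\<close>
lemma star_hom_contractive_selfadjoint:
  assumes W: "cstar_algebra W u" and f: "star_hom_on W f"
    and b: "b \<in> W" "star b = b" "norm b < 1"
  shows "norm (f b) \<le> 1"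
proof -
  note D = cstar_algebraD[OF W] note S = csubspaceD[OF D(2)] note A = star_algebraD[OF D(1)]
  have f_add: "f (x + y) = f x + f y" and f_mult: "f (x * y) = f x * f y" if "x \<in> W" "y \<in> W" for x y
    using f that by (auto simp: star_hom_on_def)
  have f_star: "f (star x) = star (f x)" and f_scale: "f (cscale c x) = cscale c (f x)" if "x \<in> W" for x c
    using f that by (auto simp: star_hom_on_def)
  have "norm (b * b) < 1"
    using norm_mult_ineq[of b b] mult_strict_mono[OF b(3) b(3)] by simp
  from cstar_algebra_sqrt[OF W A(2)[OF b(1) b(1)] _ this] b(2)
  obtain c where c: "c \<in> W" "star c = c" "c * c = u - b * b"
    and comm: "\<And>y. y * (b * b) = b * b * y \<Longrightarrow> u * y = y * u \<Longrightarrow> y * c = c * y"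
    by (auto simp: star_mult)
  have bc: "b * c = c * b"
    by (rule comm) (use b(1) D in \<open>simp_all add: mult.assoc\<close>)
  define v where "v = b + cscale \<i> c"
  have vW: "v \<in> W" using b c S by (simp add: v_def)
  have sv: "star v = b + cscale (- \<i>) c" by (simp add: v_def star_add star_cscale b c)
  have "star v * v = (b + cscale (- \<i>) c) * v" by (simp only: sv)
  also have "\<dots> = b * b + c * c"
    unfolding v_def
    by (simp add: distrib_left distrib_right cscale_mult_left cscale_mult_right cscale_cscale bc cscale_uminus left_diff_distrib cscale_add cscale_diff)
  finally have vv: "star v * v = u" by (simp add: c)
  have fv: "star (f v) * f v = f u"
    by (simp flip: vv f_star[OF vW] f_mult[OF A(3)[OF vW] vW])
  have "star (f u) * f u = f u"
    using f_star[OF D(4)] f_mult[OF D(4) D(4)] D by (simp add: cstar_algebra_unit_selfadjoint[OF W])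
  hence "(norm (f u))\<^sup>2 = norm (f u)" using norm_star_mult_self[of "f u"] by simp
  hence "norm (f u) * (norm (f u) - 1) = 0" by (simp add: power2_eq_square algebra_simps)
  hence "norm (f u) \<le> 1" by auto
  hence "(norm (f v))\<^sup>2 \<le> 1" using norm_star_mult_self[of "f v"] by (simp add: fv)
  hence nv: "norm (f v) \<le> 1" by (simp add: power2_le_imp_le power_le_one_iff abs_square_le_1)
  have "cscale 2 b = v + star v"
    unfolding sv by (simp add: v_def cscale_uminus cscale_two)
  hence "cscale 2 (f b) = f v + star (f v)"
    using f_scale[OF b(1), of 2] f_add[OF vW A(3)[OF vW]] by (simp add: f_star[OF vW])
  hence "norm (cscale 2 (f b)) \<le> norm (f v) + norm (star (f v))"
    by (simp only: norm_triangle_ineq)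
  thus ?thesis using nv by simp
qed

text \<open>Scaling extends the estimate to all selfadjoint elements, and the C*-identity to all elements.\<close>
theorem star_hom_contractive:
  assumes W: "cstar_algebra W u" and f: "star_hom_on W f" and x: "x \<in> W"
  shows "norm (f x) \<le> norm x"
proof -
  note D = cstar_algebraD[OF W] note S = csubspaceD[OF D(2)] note A = star_algebraD[OF D(1)]
  have sa: "norm (f b) \<le> norm b" if b: "b \<in> W" "star b = b" for b
  proof (rule field_le_epsilon)
    fix e :: real assume e: "0 < e"
    define r where "r = norm b + e"
    have r: "0 < r" "norm b < r" using e by (simp_all add: r_def add_nonneg_pos)
    define b' where "b' = cscale (complex_of_real (1 / r)) b"
    have cr: "cmod (complex_of_real (1 / r)) = 1 / r" using r by (simp only: norm_of_real) simp
    have "norm b' < 1" using r by (simp only: b'_def norm_cscale cr) simp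
    moreover have "b' \<in> W" "star b' = b'" using b S by (simp_all add: b'_def star_cscale)
    ultimately have "norm (f b') \<le> 1"
      using star_hom_contractive_selfadjoint[OF W f] by blast
    moreover have "f b' = cscale (complex_of_real (1 / r)) (f b)"
      using f b by (simp add: b'_def star_hom_on_def)
    ultimately have "1 / r * norm (f b) \<le> 1" by (simp only: norm_cscale cr)
    hence "norm (f b) \<le> r" using r by (simp add: divide_le_eq)
    thus "norm (f b) \<le> norm b + e" by (simp only: r_def)
  qed
  have "star x * x \<in> W" by (rule A(2)[OF A(3)[OF x] x])
  hence "norm (f (star x * x)) \<le> norm (star x * x)" by (rule sa) (simp add: star_mult)
  moreover have "f (star x * x) = star (f x) * f x"
    using f x A(3)[OF x] by (simp add: star_hom_on_def)
  ultimately have "(norm (f x))\<^sup>2 \<le> (norm x)\<^sup>2" by (simp add: norm_star_mult_self)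
  thus ?thesis by (rule power2_le_imp_le) simp
qed

section \<open>Unital C*-algebras, their subalgebras and tensor products\<close>

lemma mat_of_image_iff [simp]: "mat_of x \<in> mat_of ` W \<longleftrightarrow> x \<in> W"
  by auto

lemma cscale_0_left [simp]: "cscale 0 x = 0"
  by transfer (simp add: op_scale_def op_zero_def)

lemma is_unit_of_mat_of: "is_unit_of (mat_of ` W) (mat_of u) \<longleftrightarrow> u \<in> W \<and> (\<forall>x\<in>W. u * x = x \<and> x * u = x)"
  by (auto simp: is_unit_of_def mat_of_simps)

text \<open>With its converse below, this lets statements about C*-algebras of matrices be proved in the type
  of bounded operators.\<close>
lemma unital_cstar_algebraI:
  assumes "cstar_algebra W u"
  shows "unital_cstar_algebra (mat_of ` W)" "unit_of (mat_of ` W) = mat_of u"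
proof -
  note D = cstar_algebraD[OF assms] note S = csubspaceD[OF D(2)] note A = star_algebraD[OF D(1)]
  have u: "is_unit_of (mat_of ` W) (mat_of u)" using D by (simp add: is_unit_of_mat_of)
  show "unital_cstar_algebra (mat_of ` W)"
    unfolding unital_cstar_algebra_def
  proof (intro conjI)
    show "op_closure (mat_of ` W) \<subseteq> mat_of ` W"
      using D(3) by (simp add: op_closure_eq_closure)
    show "\<exists>u. is_unit_of (mat_of ` W) u" using u by blast
  qed (use S A in \<open>auto simp: mat_of_simps\<close>)
  show "unit_of (mat_of ` W) = mat_of u"
    unfolding unit_of_def
  proof (rule the_equality)
    fix v assume v: "is_unit_of (mat_of ` W) v"
    then obtain w where "w \<in> W" "v = mat_of w" by (auto simp: is_unit_of_def)
    with u v show "v = mat_of u" using is_unit_of_mat_of[of W] by metis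
  qed (rule u)
qed

lemma unital_cstar_algebraE:
  assumes "unital_cstar_algebra A"
  obtains W u where "A = mat_of ` W" "unit_of A = mat_of u" "cstar_algebra W u"
proof -
  have A: "\<And>a. a \<in> A \<Longrightarrow> bounded_op a" using assms by (simp add: unital_cstar_algebra_def)
  define W where "W = lift_set A"
  have AW: "A = mat_of ` W" unfolding W_def by (rule image_lift_set[OF A, symmetric])
  have U: "\<forall>a\<in>mat_of ` W. \<forall>b\<in>mat_of ` W. op_add a b \<in> mat_of ` W"
    "\<forall>c. \<forall>a\<in>mat_of ` W. op_scale c a \<in> mat_of ` W"
    "\<forall>a\<in>mat_of ` W. \<forall>b\<in>mat_of ` W. op_mult a b \<in> mat_of ` W"
    "\<forall>a\<in>mat_of ` W. op_adj a \<in> mat_of ` W"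
    "op_closure (mat_of ` W) \<subseteq> mat_of ` W" "\<exists>u. is_unit_of (mat_of ` W) u"
    using assms unfolding AW unital_cstar_algebra_def by simp_all
  obtain v where v: "is_unit_of (mat_of ` W) v" using U(6) by (rule exE)
  then obtain u where "v = mat_of u" by (auto simp: is_unit_of_def)
  with v have u: "is_unit_of (mat_of ` W) (mat_of u)" by simp
  have closed: "closed W"
  proof -
    have "closure W \<subseteq> W"
    proof
      fix x assume "x \<in> closure W"
      hence "mat_of x \<in> op_closure (mat_of ` W)" by (simp add: op_closure_eq_closure)
      hence "mat_of x \<in> mat_of ` W" using U(5) by (rule set_mp[rotated])
      thus "x \<in> W" by simp
    qed
    thus ?thesis by (simp add: closure_subset_eq)
  qed
  have scale: "cscale c x \<in> W" if "x \<in> W" for c x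
    using U(2)[rule_format, OF imageI[OF that], of c] by (simp only: mat_of_simps mat_of_image_iff)
  have add: "x + y \<in> W" and mult: "x * y \<in> W" if "x \<in> W" "y \<in> W" for x y
    using U(1,3)[rule_format, OF imageI imageI, OF that]
    by (simp_all only: mat_of_simps mat_of_image_iff)
  have adj: "star x \<in> W" if "x \<in> W" for x
    using U(4)[rule_format, OF imageI[OF that]] by (simp only: mat_of_simps mat_of_image_iff)
  have zero: "0 \<in> W" using scale[of u 0] u by (simp add: is_unit_of_mat_of)
  have W: "cstar_algebra W u"
    using closed scale add mult adj zero u
    by (simp add: cstar_algebra_def star_algebra_def csubspace_def is_unit_of_mat_of)
  show ?thesis by (rule that[OF AW _ W]) (simp add: AW unital_cstar_algebraI(2)[OF W])
qed

definition tens :: "'i bop set \<Rightarrow> 'j bop set \<Rightarrow> ('i \<times> 'j) bop set" where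
  "tens W V = closure (cspan {tensor x y | x y. x \<in> W \<and> y \<in> V})"

lemma spatial_tensor_eq: "spatial_tensor (mat_of ` W) (mat_of ` V) = mat_of ` tens W V"
proof -
  have "{op_tensor a b | a b. a \<in> mat_of ` W \<and> b \<in> mat_of ` V} = mat_of ` {tensor x y | x y. x \<in> W \<and> y \<in> V}"
    by (force simp: mat_of_simps)
  thus ?thesis by (simp add: spatial_tensor_def tens_def op_closure_op_span_eq)
qed

lemma cstar_algebra_tens:
  assumes W: "cstar_algebra W u" and V: "cstar_algebra V v"
  shows "cstar_algebra (tens W V) (tensor u v)"
  unfolding tens_def
proof (rule cstar_algebra_closure_cspan)
  note DW = cstar_algebraD[OF W] star_algebraD[OF cstar_algebraD(1)[OF W]]
  note DV = cstar_algebraD[OF V] star_algebraD[OF cstar_algebraD(1)[OF V]]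
  let ?P = "{tensor x y | x y. x \<in> W \<and> y \<in> V}"
  have P: "tensor x y \<in> ?P" if "x \<in> W" "y \<in> V" for x y using that by blast
  show "x * y \<in> ?P" if h: "x \<in> ?P" "y \<in> ?P" for x y
  proof -
    obtain a b c d where *: "x = tensor a b" "y = tensor c d" "a \<in> W" "c \<in> W" "b \<in> V" "d \<in> V"
      using h by blast
    show ?thesis unfolding *(1,2) tensor_mult by (intro P DW(8) DV(8) *)
  qed
  show "star x \<in> ?P" if h: "x \<in> ?P" for x
  proof -
    obtain a b where *: "x = tensor a b" "a \<in> W" "b \<in> V" using h by blast
    show ?thesis unfolding *(1) star_tensor by (intro P DW(9) DV(9) *)
  qed
  show "tensor u v \<in> ?P" using DW(4) DV(4) by blast
  show "tensor u v * x = x" "x * tensor u v = x" if "x \<in> ?P" for x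
    using that DW(5,6) DV(5,6) by (auto simp: tensor_mult)
qed

lemma tensor_in_tens:
  assumes "x \<in> W" "y \<in> V" shows "tensor x y \<in> tens W V"
proof -
  have "tensor x y \<in> {tensor x y | x y. x \<in> W \<and> y \<in> V}" using assms by blast
  thus ?thesis unfolding tens_def by (intro subsetD[OF closure_subset] subsetD[OF cspan_superset])
qed

lemma tens_minimal:
  assumes "csubspace T" "closed T" "\<And>x y. x \<in> W \<Longrightarrow> y \<in> V \<Longrightarrow> tensor x y \<in> T"
  shows "tens W V \<subseteq> T"
  unfolding tens_def by (rule closure_cspan_minimal) (use assms in auto)

lemma spatial_tensor_unital_cstar_algebra:
  assumes "unital_cstar_algebra A" "unital_cstar_algebra B"
  shows "unital_cstar_algebra (spatial_tensor A B)"
    and "unit_of (spatial_tensor A B) = op_tensor (unit_of A) (unit_of B)"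
proof -
  obtain W u where W: "A = mat_of ` W" "unit_of A = mat_of u" "cstar_algebra W u"
    using assms(1) by (rule unital_cstar_algebraE)
  obtain V v where V: "B = mat_of ` V" "unit_of B = mat_of v" "cstar_algebra V v"
    using assms(2) by (rule unital_cstar_algebraE)
  show "unital_cstar_algebra (spatial_tensor A B)"
    "unit_of (spatial_tensor A B) = op_tensor (unit_of A) (unit_of B)"
    unfolding W(2) V(2) unfolding W(1) V(1) spatial_tensor_eq mat_of_simps
    by (rule unital_cstar_algebraI[OF cstar_algebra_tens[OF W(3) V(3)]])+
qed

definition unital_cstar_subalgebra :: "'i op set \<Rightarrow> 'i op set \<Rightarrow> bool" where
  "unital_cstar_subalgebra C A \<longleftrightarrow> unital_cstar_algebra C \<and> C \<subseteq> A \<and> unit_of C = unit_of A"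

lemma unital_cstar_subalgebraD:
  assumes "unital_cstar_subalgebra C A"
  shows "unital_cstar_algebra C" "C \<subseteq> A" "unit_of C = unit_of A"
  using assms by (auto simp: unital_cstar_subalgebra_def)

lemma unital_cstar_subalgebra_refl: "unital_cstar_algebra A \<Longrightarrow> unital_cstar_subalgebra A A"
  by (simp add: unital_cstar_subalgebra_def)

lemma unital_cstar_subalgebraI:
  assumes "cstar_algebra W u" "cstar_algebra V u" "V \<subseteq> W"
  shows "unital_cstar_subalgebra (mat_of ` V) (mat_of ` W)"
  using unital_cstar_algebraI[OF assms(1)] unital_cstar_algebraI[OF assms(2)] assms(3)
  by (auto simp: unital_cstar_subalgebra_def)

lemma unital_cstar_subalgebraE:
  assumes "unital_cstar_subalgebra C (mat_of ` W)" "cstar_algebra W u"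
  obtains V where "C = mat_of ` V" "V \<subseteq> W" "cstar_algebra V u"
proof -
  note D = unital_cstar_subalgebraD[OF assms(1)]
  obtain V v where V: "C = mat_of ` V" "unit_of C = mat_of v" "cstar_algebra V v"
    using D(1) by (rule unital_cstar_algebraE)
  have "v = u" using D(3) V(2) unital_cstar_algebraI(2)[OF assms(2)] by simp
  moreover have "V \<subseteq> W" using D(2) V(1) by auto
  ultimately show ?thesis using V that by blast
qed

lemma spatial_tensor_subset:
  assumes "unital_cstar_algebra A" "unital_cstar_algebra B" "unital_cstar_algebra T"
    and "\<And>a b. a \<in> A \<Longrightarrow> b \<in> B \<Longrightarrow> op_tensor a b \<in> T"
  shows "spatial_tensor A B \<subseteq> T"
proof -
  obtain W u where W: "A = mat_of ` W" "unit_of A = mat_of u" "cstar_algebra W u"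
    using assms(1) by (rule unital_cstar_algebraE)
  obtain V v where V: "B = mat_of ` V" "unit_of B = mat_of v" "cstar_algebra V v"
    using assms(2) by (rule unital_cstar_algebraE)
  obtain Z x where Z: "T = mat_of ` Z" "unit_of T = mat_of x" "cstar_algebra Z x"
    using assms(3) by (rule unital_cstar_algebraE)
  have "tensor x y \<in> Z" if "x \<in> W" "y \<in> V" for x y
    using assms(4)[of "mat_of x" "mat_of y"] that by (simp add: W(1) V(1) Z(1) mat_of_simps)
  hence "tens W V \<subseteq> Z"
    by (intro tens_minimal cstar_algebraD[OF Z(3)])
  thus ?thesis unfolding W(1) V(1) Z(1) spatial_tensor_eq by blast
qed

lemma op_tensor_in_spatial_tensor:
  assumes "unital_cstar_algebra A" "unital_cstar_algebra B" "a \<in> A" "b \<in> B"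
  shows "op_tensor a b \<in> spatial_tensor A B"
proof -
  obtain W u where W: "A = mat_of ` W" "unit_of A = mat_of u" "cstar_algebra W u"
    using assms(1) by (rule unital_cstar_algebraE)
  obtain V v where V: "B = mat_of ` V" "unit_of B = mat_of v" "cstar_algebra V v"
    using assms(2) by (rule unital_cstar_algebraE)
  show ?thesis using assms(3,4) unfolding W(1) V(1) spatial_tensor_eq
    by (auto simp: mat_of_simps intro: tensor_in_tens)
qed

lemma spatial_tensor_subalgebra:
  assumes "unital_cstar_algebra A" "unital_cstar_algebra B"
    and "unital_cstar_subalgebra A' A" "unital_cstar_subalgebra B' B"
  shows "unital_cstar_subalgebra (spatial_tensor A' B') (spatial_tensor A B)"
proof -
  note D = unital_cstar_subalgebraD[OF assms(3)] unital_cstar_subalgebraD[OF assms(4)]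
  have "spatial_tensor A' B' \<subseteq> spatial_tensor A B"
    using D(2,5) by (intro spatial_tensor_subset D spatial_tensor_unital_cstar_algebra assms op_tensor_in_spatial_tensor) auto
  thus ?thesis
    using spatial_tensor_unital_cstar_algebra[OF assms(1,2)] spatial_tensor_unital_cstar_algebra[OF D(1,4)] D
    by (simp add: unital_cstar_subalgebra_def)
qed

text \<open>The map of bounded operators underlying a map of matrices.\<close>
definition lower :: "('i op \<Rightarrow> 'j op) \<Rightarrow> 'i bop \<Rightarrow> 'j bop" where
  "lower \<phi> x = Bop (\<phi> (mat_of x))"

lemma unital_star_homE:
  assumes \<phi>: "unital_star_hom (mat_of ` W) (mat_of ` V) \<phi>"
    and W: "cstar_algebra W u" and V: "cstar_algebra V v"
  shows "x \<in> W \<Longrightarrow> \<phi> (mat_of x) = mat_of (lower \<phi> x)" "x \<in> W \<Longrightarrow> lower \<phi> x \<in> V"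
    "star_hom_on W (lower \<phi>)" "lower \<phi> u = v"
proof -
  note D = cstar_algebraD[OF W] star_algebraD[OF cstar_algebraD(1)[OF W]]
  note S = csubspaceD[OF D(2)]
  have *: "\<phi> (mat_of x) = mat_of (lower \<phi> x) \<and> lower \<phi> x \<in> V" if x: "x \<in> W" for x
  proof -
    obtain y where "y \<in> V" "\<phi> (mat_of x) = mat_of y"
      using \<phi> x by (auto simp: unital_star_hom_def)
    thus ?thesis by (simp add: lower_def mat_of_inverse)
  qed
  show 1: "x \<in> W \<Longrightarrow> \<phi> (mat_of x) = mat_of (lower \<phi> x)" and "x \<in> W \<Longrightarrow> lower \<phi> x \<in> V" for x
    using * by auto
  show "star_hom_on W (lower \<phi>)"
    unfolding star_hom_on_def
  proof (intro conjI ballI allI)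
    fix x y assume xy: "x \<in> W" "y \<in> W"
    have "mat_of (lower \<phi> (x + y)) = mat_of (lower \<phi> x + lower \<phi> y)"
      using \<phi> xy S(2)[OF xy] by (simp add: unital_star_hom_def flip: 1 mat_of_simps)
    thus "lower \<phi> (x + y) = lower \<phi> x + lower \<phi> y" by simp
    have "mat_of (lower \<phi> (x * y)) = mat_of (lower \<phi> x * lower \<phi> y)"
      using \<phi> xy D(8)[OF xy] by (simp add: unital_star_hom_def flip: 1 mat_of_simps)
    thus "lower \<phi> (x * y) = lower \<phi> x * lower \<phi> y" by simp
  next
    fix x assume x: "x \<in> W"
    have "mat_of (lower \<phi> (star x)) = mat_of (star (lower \<phi> x))"
      using \<phi> x D(9)[OF x] by (simp add: unital_star_hom_def flip: 1 mat_of_simps)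
    thus "lower \<phi> (star x) = star (lower \<phi> x)" by simp
  next
    fix c x assume x: "x \<in> W"
    have "mat_of (lower \<phi> (cscale c x)) = mat_of (cscale c (lower \<phi> x))"
      using \<phi> x S(3)[OF x] by (simp add: unital_star_hom_def flip: 1 mat_of_simps)
    thus "lower \<phi> (cscale c x) = cscale c (lower \<phi> x)" by simp
  qed
  have "mat_of (lower \<phi> u) = mat_of v"
    using \<phi> unital_cstar_algebraI(2)[OF W] unital_cstar_algebraI(2)[OF V]
    by (simp add: unital_star_hom_def 1[OF D(4)])
  thus "lower \<phi> u = v" by simp
qed

lemma star_hom_on_continuous:
  assumes W: "cstar_algebra W u" and f: "star_hom_on W f"
  shows "continuous_on W f"
proof (rule continuous_onI)
  note S = csubspaceD[OF cstar_algebraD(2)[OF W]]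
  fix x e assume x: "x \<in> W" and e: "(0::real) < e"
  have "dist (f y) (f x) \<le> dist y x" if y: "y \<in> W" for y
  proof -
    have "f (y - x) = f y - f x"
    proof -
      have "f (cscale (- 1) x) = cscale (- 1) (f x)" "f (y + cscale (- 1) x) = f y + f (cscale (- 1) x)"
        using f x y S(3)[OF x, of "- 1"] by (auto simp: star_hom_on_def)
      thus ?thesis by (simp add: cscale_uminus)
    qed
    thus ?thesis using star_hom_contractive[OF W f S(6)[OF y x]] by (simp add: dist_norm)
  qed
  hence "\<forall>y\<in>W. dist y x < e \<longrightarrow> dist (f y) (f x) \<le> e" by force
  thus "\<exists>d>0. \<forall>y\<in>W. dist y x < d \<longrightarrow> dist (f y) (f x) \<le> e" using e by blast
qed

text \<open>Contractivity makes the preimage of a C*-subalgebra under a homomorphism closed. Hence a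
  homomorphism that maps generators of a C*-algebra into a C*-subalgebra maps all of it there.\<close>

lemma unital_cstar_subalgebra_preimage:
  assumes A: "unital_cstar_algebra A" and B: "unital_cstar_algebra B"
    and \<phi>: "unital_star_hom A B \<phi>" and C: "unital_cstar_subalgebra C B"
  shows "unital_cstar_subalgebra {a \<in> A. \<phi> a \<in> C} A"
proof -
  obtain W u where W: "A = mat_of ` W" "unit_of A = mat_of u" "cstar_algebra W u"
    using A by (rule unital_cstar_algebraE)
  obtain V v where V: "B = mat_of ` V" "unit_of B = mat_of v" "cstar_algebra V v"
    using B by (rule unital_cstar_algebraE)
  obtain Z where Z: "C = mat_of ` Z" "Z \<subseteq> V" "cstar_algebra Z v"
    using C[unfolded V(1)] V(3) by (rule unital_cstar_subalgebraE)
  define f where "f = lower \<phi>"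
  note f = unital_star_homE[OF \<phi>[unfolded W(1) V(1)] W(3) V(3), folded f_def]
  define Y where "Y = {x \<in> W. f x \<in> Z}"
  have eq: "{a \<in> A. \<phi> a \<in> C} = mat_of ` Y"
    unfolding W(1) Z(1) Y_def using f(1) by auto
  note DW = cstar_algebraD[OF W(3)] star_algebraD[OF cstar_algebraD(1)[OF W(3)]]
  note SW = csubspaceD[OF DW(2)]
  note DX = cstar_algebraD[OF Z(3)] star_algebraD[OF cstar_algebraD(1)[OF Z(3)]]
  note SX = csubspaceD[OF DX(2)]
  have clo: "closed Y"
  proof -
    have "closedin (top_of_set W) (W \<inter> f -` Z)"
      by (rule continuous_closedin_preimage[OF star_hom_on_continuous[OF W(3) f(3)] DX(3)])
    thus ?thesis using closedin_closed_trans[OF _ DW(3)] by (simp add: Y_def vimage_def Int_def)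
  qed
  have f0: "f 0 = 0"
  proof -
    have "f (cscale 0 u) = cscale 0 (f u)" using f(3) DW(4) unfolding star_hom_on_def by blast
    thus ?thesis by simp
  qed
  have "cstar_algebra Y u"
    unfolding cstar_algebra_def star_algebra_def csubspace_def
    using clo f(3,4) f0 DW(4-9) SW(1-3) DX(4,8,9) SX(1-3)
    by (auto simp: Y_def star_hom_on_def)
  thus ?thesis unfolding eq unfolding W(1) using W(3) by (intro unital_cstar_subalgebraI) (auto simp: Y_def)
qed

lemma unital_star_hom_restrict:
  assumes "unital_star_hom A B \<phi>" "unital_cstar_subalgebra A' A" "unital_cstar_subalgebra B' B" "\<phi> ` A' \<subseteq> B'"
  shows "unital_star_hom A' B' \<phi>"
  using assms(1,4) unital_cstar_subalgebraD[OF assms(2)] unital_cstar_subalgebraD[OF assms(3)]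
  unfolding unital_star_hom_def by (simp add: subset_iff image_subset_iff)

lemma unital_star_hom_enlarge:
  assumes "unital_star_hom A B' \<phi>" "unital_cstar_subalgebra B' B"
  shows "unital_star_hom A B \<phi>"
  using assms(1) unital_cstar_subalgebraD[OF assms(2)]
  unfolding unital_star_hom_def by (simp add: subset_iff)

text \<open>The elements that the tensor product map sends into the smaller target form a C*-algebra, and
  elementary tensors over the subalgebras belong to it.\<close>
lemma is_hom_tensor_restrict:
  assumes cstar: "unital_cstar_algebra A" "unital_cstar_algebra B" "unital_cstar_algebra C" "unital_cstar_algebra D"
    and \<Phi>: "is_hom_tensor A B C D \<phi> \<psi> \<Phi>"
    and A': "unital_cstar_subalgebra A' A" and B': "unital_cstar_subalgebra B' B"
    and C': "unital_cstar_subalgebra C' C" and D': "unital_cstar_subalgebra D' D"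
    and maps: "\<phi> ` A' \<subseteq> C'" "\<psi> ` B' \<subseteq> D'"
  shows "is_hom_tensor A' B' C' D' \<phi> \<psi> \<Phi>"
proof -
  note sA = unital_cstar_subalgebraD[OF A'] and sB = unital_cstar_subalgebraD[OF B']
    and sC = unital_cstar_subalgebraD[OF C'] and sD = unital_cstar_subalgebraD[OF D']
  have hom: "unital_star_hom (spatial_tensor A B) (spatial_tensor C D) \<Phi>"
    and el: "\<And>a b. a \<in> A \<Longrightarrow> b \<in> B \<Longrightarrow> \<Phi> (op_tensor a b) = op_tensor (\<phi> a) (\<psi> b)"
    using \<Phi> by (auto simp: is_hom_tensor_def)
  have AB: "unital_cstar_subalgebra (spatial_tensor A' B') (spatial_tensor A B)"
    and CD: "unital_cstar_subalgebra (spatial_tensor C' D') (spatial_tensor C D)"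
    by (intro spatial_tensor_subalgebra cstar A' B' C' D')+
  have "unital_cstar_subalgebra {t \<in> spatial_tensor A B. \<Phi> t \<in> spatial_tensor C' D'} (spatial_tensor A B)"
    by (intro unital_cstar_subalgebra_preimage[OF _ _ hom CD] spatial_tensor_unital_cstar_algebra cstar)
  hence "spatial_tensor A' B' \<subseteq> {t \<in> spatial_tensor A B. \<Phi> t \<in> spatial_tensor C' D'}"
    using sA sB sC sD maps
    by (intro spatial_tensor_subset)
       (auto simp: el subset_iff unital_cstar_subalgebra_def
         intro!: op_tensor_in_spatial_tensor cstar)
  hence "\<Phi> ` spatial_tensor A' B' \<subseteq> spatial_tensor C' D'" by blast
  hence "unital_star_hom (spatial_tensor A' B') (spatial_tensor C' D') \<Phi>"
    by (rule unital_star_hom_restrict[OF hom AB CD])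
  thus ?thesis using el sA(2) sB(2) by (simp add: is_hom_tensor_def subset_iff)
qed

lemma is_hom_tensor_enlarge:
  assumes "is_hom_tensor A B C' D' \<phi> \<psi> \<Phi>" "unital_cstar_algebra C" "unital_cstar_algebra D"
    "unital_cstar_subalgebra C' C" "unital_cstar_subalgebra D' D"
  shows "is_hom_tensor A B C D \<phi> \<psi> \<Phi>"
  using assms(1) unital_star_hom_enlarge[OF _ spatial_tensor_subalgebra[OF assms(2-5)]]
  unfolding is_hom_tensor_def by blast

definition generated_subalgebra :: "'i op set \<Rightarrow> 'i op set \<Rightarrow> 'i op set" where
  "generated_subalgebra A S = \<Inter>{C. unital_cstar_subalgebra C A \<and> S \<subseteq> C}"

lemma generated_subalgebra_superset: "S \<subseteq> generated_subalgebra A S"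
  by (auto simp: generated_subalgebra_def)

lemma generated_subalgebra_minimal:
  "unital_cstar_subalgebra C A \<Longrightarrow> S \<subseteq> C \<Longrightarrow> generated_subalgebra A S \<subseteq> C"
  by (auto simp: generated_subalgebra_def)

lemma unital_cstar_subalgebra_generated:
  assumes A: "unital_cstar_algebra A" and S: "S \<subseteq> A"
  shows "unital_cstar_subalgebra (generated_subalgebra A S) A"
proof -
  obtain W u where W: "A = mat_of ` W" "unit_of A = mat_of u" "cstar_algebra W u"
    using A by (rule unital_cstar_algebraE)
  define V where "V = \<Inter>{V. cstar_algebra V u \<and> V \<subseteq> W \<and> S \<subseteq> mat_of ` V}"
  have WV: "W \<in> {V. cstar_algebra V u \<and> V \<subseteq> W \<and> S \<subseteq> mat_of ` V}" using W S by auto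
  have "generated_subalgebra A S = mat_of ` V"
  proof (intro equalityI subsetI)
    fix a assume a: "a \<in> generated_subalgebra A S"
    hence "a \<in> A" using unital_cstar_subalgebra_refl[OF A] S by (auto simp: generated_subalgebra_def)
    then obtain x where x: "a = mat_of x" using W(1) by auto
    have "x \<in> V'" if V': "cstar_algebra V' u" "V' \<subseteq> W" "S \<subseteq> mat_of ` V'" for V'
    proof -
      have "mat_of x \<in> mat_of ` V'"
        using a V'(3) unital_cstar_subalgebraI[OF W(3) V'(1,2)]
        unfolding generated_subalgebra_def x W(1) by blast
      thus ?thesis by simp
    qed
    thus "a \<in> mat_of ` V" by (simp add: x V_def)
  next
    fix a assume "a \<in> mat_of ` V"
    then obtain x where x: "a = mat_of x" "x \<in> V" by auto
    show "a \<in> generated_subalgebra A S"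
      unfolding generated_subalgebra_def
    proof (intro InterI, clarify)
      fix C assume C: "unital_cstar_subalgebra C A" "S \<subseteq> C"
      obtain V' where "C = mat_of ` V'" "V' \<subseteq> W" "cstar_algebra V' u"
        using C(1)[unfolded W(1)] W(3) by (rule unital_cstar_subalgebraE)
      thus "a \<in> C" using x C(2) by (auto simp: V_def)
    qed
  qed
  moreover have "cstar_algebra V u"
  proof -
    have *: "0 \<in> V'" "u \<in> V'" "closed V'" "x \<in> V' \<Longrightarrow> y \<in> V' \<Longrightarrow> x + y \<in> V'" "x \<in> V' \<Longrightarrow> y \<in> V' \<Longrightarrow> x * y \<in> V'"
      "x \<in> V' \<Longrightarrow> cscale c x \<in> V'" "x \<in> V' \<Longrightarrow> star x \<in> V'" if "cstar_algebra V' u" for V' x y c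
      using that by (auto simp: cstar_algebra_def star_algebra_def csubspace_def)
    have "V \<subseteq> W" using WV by (auto simp: V_def)
    hence "u * x = x \<and> x * u = x" if "x \<in> V" for x using cstar_algebraD(5,6)[OF W(3)] that by blast
    moreover have "closed V" unfolding V_def by (rule closed_Inter) (use * in blast)
    ultimately show ?thesis
      unfolding cstar_algebra_def star_algebra_def csubspace_def by (auto simp: V_def *)
  qed
  moreover have "V \<subseteq> W" using WV by (auto simp: V_def)
  ultimately show ?thesis using unital_cstar_subalgebraI[OF W(3)] W(1) by simp
qed

text \<open>Closure under adjoints needs the set \<open>T\<close> to be selfadjoint.\<close>
lemma unital_cstar_subalgebra_commutant:
  assumes A: "unital_cstar_algebra A" and T: "T \<subseteq> A" and adj: "\<And>t. t \<in> T \<Longrightarrow> op_adj t \<in> T"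
  shows "unital_cstar_subalgebra {a \<in> A. \<forall>t\<in>T. op_mult a t = op_mult t a} A"
proof -
  obtain W u where W: "A = mat_of ` W" "unit_of A = mat_of u" "cstar_algebra W u"
    using A by (rule unital_cstar_algebraE)
  define P where "P = {x \<in> W. mat_of x \<in> T}"
  have TP: "T = mat_of ` P" using T W(1) by (auto simp: P_def)
  have P: "P \<subseteq> W" "\<And>t. t \<in> P \<Longrightarrow> star t \<in> P"
    using adj star_algebraD(3)[OF cstar_algebraD(1)[OF W(3)]] by (auto simp: P_def simp flip: mat_of_simps)
  define V where "V = {x \<in> W. \<forall>t\<in>P. x * t = t * x}"
  have eq: "{a \<in> A. \<forall>t\<in>T. op_mult a t = op_mult t a} = mat_of ` V"
    unfolding W(1) TP V_def by (auto simp: mat_of_simps)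
  note D = cstar_algebraD[OF W(3)] star_algebraD[OF cstar_algebraD(1)[OF W(3)]]
  note S = csubspaceD[OF D(2)]
  have "closed V"
  proof -
    have "V = W \<inter> (\<Inter>t\<in>P. {x. x * t = t * x})" by (auto simp: V_def)
    moreover have "closed {x. x * t = t * x}" for t :: "'a bop"
      by (intro closed_Collect_eq continuous_intros)
    ultimately show ?thesis using D(3) by auto
  qed
  moreover have "x * y * t = t * (x * y)" if "x * t = t * x" "y * t = t * y" for x y t :: "'a bop"
  proof -
    have "x * y * t = x * (t * y)" by (simp only: mult.assoc that(2))
    also have "\<dots> = t * (x * y)" by (simp only: mult.assoc[symmetric] that(1))
    finally show ?thesis .
  qed
  moreover have "star x * t = t * star x" if x: "x \<in> V" and t: "t \<in> P" for x t
  proof -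
    have "star (x * star t) = star (star t * x)" using P(2)[OF t] x by (simp add: V_def)
    thus ?thesis by (simp add: star_mult)
  qed
  ultimately have "cstar_algebra V u"
    unfolding cstar_algebra_def star_algebra_def csubspace_def
    using D(4-9) S(1-3) P(1)
    by (auto simp: V_def distrib_left distrib_right cscale_mult_left cscale_mult_right subset_iff)
  thus ?thesis unfolding eq unfolding W(1) by (intro unital_cstar_subalgebraI[OF W(3)]) (auto simp: V_def)
qed

text \<open>Pass to the commutant twice: that of the generators contains the generated algebra, so the commutant
  of the generated algebra contains the generators.\<close>
lemma commutative_generated_subalgebra:
  assumes A: "unital_cstar_algebra A" and S: "S \<subseteq> A" and adj: "\<And>s. s \<in> S \<Longrightarrow> op_adj s \<in> S"
    and comm: "\<And>s t. s \<in> S \<Longrightarrow> t \<in> S \<Longrightarrow> op_mult s t = op_mult t s"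
    and ab: "a \<in> generated_subalgebra A S" "b \<in> generated_subalgebra A S"
  shows "op_mult a b = op_mult b a"
proof -
  let ?G = "generated_subalgebra A S"
  note G = unital_cstar_subalgebraD[OF unital_cstar_subalgebra_generated[OF A S]]
  have "?G \<subseteq> {a \<in> A. \<forall>t\<in>S. op_mult a t = op_mult t a}"
    by (rule generated_subalgebra_minimal[OF unital_cstar_subalgebra_commutant[OF A S adj]])
       (use S comm in auto)
  moreover have "op_adj t \<in> ?G" if "t \<in> ?G" for t
    using G(1) that by (simp add: unital_cstar_algebra_def)
  ultimately have "?G \<subseteq> {a \<in> A. \<forall>t\<in>?G. op_mult a t = op_mult t a}"
    using S by (intro generated_subalgebra_minimal unital_cstar_subalgebra_commutant[OF A G(2)])
      (auto simp: subset_iff)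
  thus ?thesis using ab by blast
qed

lemma unital_cstar_subalgebra_closed_span:
  assumes A: "unital_cstar_algebra A" and P: "P \<subseteq> A" "unit_of A \<in> P"
    and mult: "\<And>x y. x \<in> P \<Longrightarrow> y \<in> P \<Longrightarrow> op_mult x y \<in> P" and adj: "\<And>x. x \<in> P \<Longrightarrow> op_adj x \<in> P"
  shows "unital_cstar_subalgebra (op_closure (op_span P)) A"
proof -
  obtain W u where W: "A = mat_of ` W" "unit_of A = mat_of u" "cstar_algebra W u"
    using A by (rule unital_cstar_algebraE)
  note D = cstar_algebraD[OF W(3)]
  define V where "V = {x \<in> W. mat_of x \<in> P}"
  have PV: "P = mat_of ` V" using P(1) W(1) by (auto simp: V_def)
  have "cstar_algebra (closure (cspan V)) u"
  proof (rule cstar_algebra_closure_cspan)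
    show "x * y \<in> V" if "x \<in> V" "y \<in> V" for x y
      using mult[of "mat_of x" "mat_of y"] that by (simp add: PV mat_of_simps)
    show "star x \<in> V" if "x \<in> V" for x
      using adj[of "mat_of x"] that by (simp add: PV mat_of_simps)
    show "u \<in> V" using P(2) by (simp add: W(2) PV)
  qed (use D in \<open>auto simp: V_def\<close>)
  moreover have "closure (cspan V) \<subseteq> W"
    by (rule closure_cspan_minimal[OF _ D(2,3)]) (auto simp: V_def)
  ultimately show ?thesis
    unfolding PV op_closure_op_span_eq W(1) by (intro unital_cstar_subalgebraI[OF W(3)])
qed

section \<open>Product spans in commutative C*-algebras\<close>

lemma unital_cstar_algebraD:
  assumes "unital_cstar_algebra A"
  shows "a \<in> A \<Longrightarrow> b \<in> A \<Longrightarrow> op_mult a b \<in> A" "a \<in> A \<Longrightarrow> op_adj a \<in> A" "unit_of A \<in> A"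
    "a \<in> A \<Longrightarrow> op_mult (unit_of A) a = a" "a \<in> A \<Longrightarrow> op_mult a (unit_of A) = a"
    "a \<in> A \<Longrightarrow> bounded_op a" "op_adj (unit_of A) = unit_of A"
proof -
  obtain W u where W: "A = mat_of ` W" "unit_of A = mat_of u" "cstar_algebra W u"
    using assms by (rule unital_cstar_algebraE)
  note D = cstar_algebraD[OF W(3)]
  show "unit_of A \<in> A" "a \<in> A \<Longrightarrow> op_mult (unit_of A) a = a" "a \<in> A \<Longrightarrow> op_mult a (unit_of A) = a"
    "op_adj (unit_of A) = unit_of A"
    using D cstar_algebra_unit_selfadjoint[OF W(3)] unfolding W(2) unfolding W(1) by (auto simp: mat_of_simps)
qed (use assms in \<open>auto simp: unital_cstar_algebra_def\<close>)

lemma op_mult_assoc_in: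
  assumes "unital_cstar_algebra A" "a \<in> A" "b \<in> A" "c \<in> A"
  shows "op_mult (op_mult a b) c = op_mult a (op_mult b c)"
  using assms by (intro op_mult_assoc unital_cstar_algebraD(6)[OF assms(1)])

lemma unital_cstar_subalgebra_trans:
  "unital_cstar_subalgebra C B \<Longrightarrow> unital_cstar_subalgebra B A \<Longrightarrow> unital_cstar_subalgebra C A"
  by (auto simp: unital_cstar_subalgebra_def)

definition commutative_on :: "'i op set \<Rightarrow> bool" where
  "commutative_on A \<longleftrightarrow> (\<forall>a\<in>A. \<forall>b\<in>A. op_mult a b = op_mult b a)"

lemma commutative_onD: "commutative_on A \<Longrightarrow> a \<in> A \<Longrightarrow> b \<in> A \<Longrightarrow> op_mult a b = op_mult b a"
  by (simp add: commutative_on_def)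

lemma commutative_on_closed_span:
  assumes P: "\<And>x y. x \<in> P \<Longrightarrow> y \<in> P \<Longrightarrow> x * y = y * x" and x: "x \<in> closure (cspan P)" "y \<in> closure (cspan P)"
  shows "x * y = y * x"
proof -
  have sub: "csubspace {x. x * z = z * x}" for z :: "'a bop"
    by (simp add: csubspace_def distrib_left distrib_right cscale_mult_left cscale_mult_right)
  have clo: "closed {x. x * z = z * x}" for z :: "'a bop"
    by (intro closed_Collect_eq continuous_intros)
  have 1: "x * z = z * x" if "x \<in> closure (cspan P)" "z \<in> P" for x z
    using closure_cspan_minimal[OF _ sub clo, of P z] P that by blast
  show ?thesis using closure_cspan_minimal[OF _ sub clo, of P y] 1[OF x(2)] x(1) by force
qed

lemma commutative_spatial_tensor:
  assumes A: "unital_cstar_algebra A" "commutative_on A" and B: "unital_cstar_algebra B" "commutative_on B"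
  shows "commutative_on (spatial_tensor A B)"
proof -
  obtain W u where W: "A = mat_of ` W" "unit_of A = mat_of u" "cstar_algebra W u"
    using A(1) by (rule unital_cstar_algebraE)
  obtain V v where V: "B = mat_of ` V" "unit_of B = mat_of v" "cstar_algebra V v"
    using B(1) by (rule unital_cstar_algebraE)
  have "x * y = y * x" if "x \<in> W" "y \<in> W" for x y
    using A(2) that by (simp add: commutative_on_def W(1) mat_of_simps)
  moreover have "x * y = y * x" if "x \<in> V" "y \<in> V" for x y
    using B(2) that by (simp add: commutative_on_def V(1) mat_of_simps)
  ultimately have P: "x * y = y * x" if "x \<in> {tensor x y | x y. x \<in> W \<and> y \<in> V}"
      "y \<in> {tensor x y | x y. x \<in> W \<and> y \<in> V}" for x y
    using that by (auto simp: tensor_mult)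
  have "x * y = y * x" if "x \<in> tens W V" "y \<in> tens W V" for x y
    using that unfolding tens_def by (rule commutative_on_closed_span[rotated]) (rule P)
  thus ?thesis unfolding W(1) V(1) spatial_tensor_eq by (auto simp: commutative_on_def mat_of_simps)
qed

lemma unital_star_homD:
  assumes "unital_star_hom A B \<phi>"
  shows "a \<in> A \<Longrightarrow> \<phi> a \<in> B" "a \<in> A \<Longrightarrow> b \<in> A \<Longrightarrow> \<phi> (op_mult a b) = op_mult (\<phi> a) (\<phi> b)"
    "a \<in> A \<Longrightarrow> \<phi> (op_adj a) = op_adj (\<phi> a)" "\<phi> (unit_of A) = unit_of B"
    "a \<in> A \<Longrightarrow> b \<in> A \<Longrightarrow> \<phi> (op_add a b) = op_add (\<phi> a) (\<phi> b)"
    "a \<in> A \<Longrightarrow> \<phi> (op_scale c a) = op_scale c (\<phi> a)"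
  using assms by (auto simp: unital_star_hom_def)

text \<open>In a commutative algebra the products \<open>\<phi> a \<psi> b\<close> are closed under multiplication and adjoints, hence
  the closure of their span is a C*-algebra. This is why density, a statement about a linear span,
  can be checked on algebra generators.\<close>
lemma product_span_of_commuting_homs:
  assumes A: "unital_cstar_algebra A" and B: "unital_cstar_algebra B"
    and T: "unital_cstar_algebra T" "commutative_on T"
    and \<phi>: "unital_star_hom A T \<phi>" and \<psi>: "unital_star_hom B T \<psi>"
  defines "P \<equiv> {op_mult (\<phi> a) (\<psi> b) | a b. a \<in> A \<and> b \<in> B}"
  shows "unital_cstar_subalgebra (op_closure (op_span P)) T"
    and "a \<in> A \<Longrightarrow> \<phi> a \<in> P" and "b \<in> B \<Longrightarrow> \<psi> b \<in> P"
proof -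
  note DA = unital_cstar_algebraD[OF A] and DB = unital_cstar_algebraD[OF B] and DT = unital_cstar_algebraD[OF T(1)]
  note f = unital_star_homD[OF \<phi>] and g = unital_star_homD[OF \<psi>]
  note assoc = op_mult_assoc_in[OF T(1)] and comm = commutative_onD[OF T(2)]
  have PI: "op_mult (\<phi> a) (\<psi> b) \<in> P" if "a \<in> A" "b \<in> B" for a b
    using that unfolding P_def by blast
  have PE: "\<exists>a b. x = op_mult (\<phi> a) (\<psi> b) \<and> a \<in> A \<and> b \<in> B" if "x \<in> P" for x
    using that unfolding P_def by blast
  show "\<phi> a \<in> P" if "a \<in> A" for a
    using PI[OF that DB(3)] that by (simp add: f(1) g(4) DT(5))
  show "\<psi> b \<in> P" if "b \<in> B" for b
    using PI[OF DA(3) that] that by (simp add: g(1) f(4) DT(4))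
  show "unital_cstar_subalgebra (op_closure (op_span P)) T"
  proof (rule unital_cstar_subalgebra_closed_span[OF T(1)])
    show "P \<subseteq> T" unfolding P_def using f(1) g(1) DT(1) by blast
    show "unit_of T \<in> P" using PI[OF DA(3) DB(3)] by (simp add: f(4) g(4) DT(3,4))
    fix x assume "x \<in> P"
    then obtain a b where x: "x = op_mult (\<phi> a) (\<psi> b)" "a \<in> A" "b \<in> B" using PE by blast
    have "op_adj x = op_mult (\<psi> (op_adj b)) (\<phi> (op_adj a))"
      by (simp only: x(1) op_adj_mult f(3)[OF x(2)] g(3)[OF x(3)])
    also have "\<dots> = op_mult (\<phi> (op_adj a)) (\<psi> (op_adj b))"
      by (rule comm) (intro f(1) g(1) DA(2) DB(2) x)+
    finally show "op_adj x \<in> P" using PI[OF DA(2)[OF x(2)] DB(2)[OF x(3)]] by simp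
    fix y assume "y \<in> P"
    then obtain c d where y: "y = op_mult (\<phi> c) (\<psi> d)" "c \<in> A" "d \<in> B" using PE by blast
    have in_T: "\<phi> a \<in> T" "\<psi> b \<in> T" "\<phi> c \<in> T" "\<psi> d \<in> T" using x y by (simp_all add: f(1) g(1))
    have "op_mult x y = op_mult (\<phi> a) (op_mult (op_mult (\<psi> b) (\<phi> c)) (\<psi> d))"
      using x y in_T DT(1) by (simp add: assoc)
    also have "op_mult (\<psi> b) (\<phi> c) = op_mult (\<phi> c) (\<psi> b)" by (rule comm) (use in_T in auto)
    finally have "op_mult x y = op_mult (op_mult (\<phi> a) (\<phi> c)) (op_mult (\<psi> b) (\<psi> d))"
      using in_T DT(1) by (simp add: assoc)
    also have "\<dots> = op_mult (\<phi> (op_mult a c)) (\<psi> (op_mult b d))" using x y by (simp only: f(2) g(2))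
    finally show "op_mult x y \<in> P" using PI[OF DA(1)[OF x(2) y(2)] DB(1)[OF x(3) y(3)]] by simp
  qed
qed

lemma op_tensor_mult:
  assumes "bounded_op a" "bounded_op b" "bounded_op c" "bounded_op d"
  shows "op_mult (op_tensor a b) (op_tensor c d) = op_tensor (op_mult a c) (op_mult b d)"
proof -
  have "op_mult (op_tensor (mat_of w) (mat_of x)) (op_tensor (mat_of y) (mat_of z))
    = op_tensor (op_mult (mat_of w) (mat_of y)) (op_mult (mat_of x) (mat_of z))"
    for w y :: "'a bop" and x z :: "'b bop"
    by (simp only: mat_of_simps tensor_mult)
  from this[of "Bop a" "Bop b" "Bop c" "Bop d"] show ?thesis by (simp add: assms mat_of_Bop)
qed

lemma tensor_legs_hom:
  assumes A: "unital_cstar_algebra A" and B: "unital_cstar_algebra B"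
  shows "unital_star_hom A (spatial_tensor A B) (\<lambda>a. op_tensor a (unit_of B))"
    and "unital_star_hom B (spatial_tensor A B) (op_tensor (unit_of A))"
proof -
  note DA = unital_cstar_algebraD[OF A] and DB = unital_cstar_algebraD[OF B]
  have add: "op_tensor (op_add a b) c = op_add (op_tensor a c) (op_tensor b c)"
    "op_tensor c' (op_add a' b') = op_add (op_tensor c' a') (op_tensor c' b')" for a b c' :: "'a op" and a' b' c :: "'b op"
    by (auto simp: op_tensor_def op_add_def fun_eq_iff distrib_left distrib_right)
  have scale: "op_tensor (op_scale z a) c = op_scale z (op_tensor a c)"
    "op_tensor a (op_scale z c) = op_scale z (op_tensor a c)" for z and a :: "'a op" and c :: "'b op"
    by (auto simp: op_tensor_def op_scale_def fun_eq_iff)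
  have adj: "op_adj (op_tensor a c) = op_tensor (op_adj a) (op_adj c)" for a :: "'a op" and c :: "'b op"
    by (auto simp: op_tensor_def op_adj_def fun_eq_iff)
  show "unital_star_hom A (spatial_tensor A B) (\<lambda>a. op_tensor a (unit_of B))"
    unfolding unital_star_hom_def
    by (intro conjI ballI allI)
       (simp_all add: op_tensor_in_spatial_tensor[OF A B] add scale adj DA DB op_tensor_mult
         spatial_tensor_unital_cstar_algebra[OF A B])
  show "unital_star_hom B (spatial_tensor A B) (op_tensor (unit_of A))"
    unfolding unital_star_hom_def
    by (intro conjI ballI allI)
       (simp_all add: op_tensor_in_spatial_tensor[OF A B] add scale adj DA DB op_tensor_mult
         spatial_tensor_unital_cstar_algebra[OF A B])
qed

lemma spatial_tensor_subset_of_legs: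
  assumes A: "unital_cstar_algebra A" and B: "unital_cstar_algebra B" and E: "unital_cstar_algebra E"
    and "\<And>a. a \<in> A \<Longrightarrow> op_tensor a (unit_of B) \<in> E" "\<And>b. b \<in> B \<Longrightarrow> op_tensor (unit_of A) b \<in> E"
  shows "spatial_tensor A B \<subseteq> E"
proof (rule spatial_tensor_subset[OF A B E])
  note DA = unital_cstar_algebraD[OF A] and DB = unital_cstar_algebraD[OF B]
  fix a b assume ab: "a \<in> A" "b \<in> B"
  have "op_mult (op_tensor a (unit_of B)) (op_tensor (unit_of A) b) = op_tensor a b"
    using ab by (simp add: op_tensor_mult DA DB)
  thus "op_tensor a b \<in> E"
    using unital_cstar_algebraD(1)[OF E assms(4)[OF ab(1)] assms(5)[OF ab(2)]] by simp
qed

lemma op_closure_op_span_superset: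
  assumes "x \<in> P" "bounded_op x" shows "x \<in> op_closure (op_span P)"
proof -
  have "op_diff x x = op_zero" by (simp add: op_diff_def op_zero_def)
  moreover have "op_norm (op_zero :: 'a op) = 0"
    using norm_zero[where 'a = "'a bop"] by (simp only: norm_bop.rep_eq zero_bop.rep_eq)
  ultimately show ?thesis
    using assms op_span_superset[of P] by (auto simp: op_closure_def intro!: bexI[of _ x])
qed

lemma sum_in_unital_cstar_algebra:
  assumes E: "unital_cstar_algebra E" and x: "\<And>i. i \<in> I \<Longrightarrow> mat_of (x i) \<in> E"
  shows "mat_of (sum x I) \<in> E"
proof -
  obtain V v where V: "E = mat_of ` V" "unit_of E = mat_of v" "cstar_algebra V v"
    using E by (rule unital_cstar_algebraE)
  show ?thesis using x by (auto simp: V(1) intro!: csubspace_sum cstar_algebraD(2)[OF V(3)])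
qed

text \<open>The span of products of two commuting homomorphisms is a C*-algebra, so that it suffices to find
  the two legs of the tensor product in it, and for these their generators.\<close>

lemma spatial_tensor_subset_product_span:
  assumes A: "unital_cstar_algebra A" "commutative_on A" and B: "unital_cstar_algebra B" "commutative_on B"
    and C: "unital_cstar_algebra C" and \<phi>: "unital_star_hom C (spatial_tensor A B) \<phi>"
    and D: "unital_cstar_algebra D" and \<psi>: "unital_star_hom D (spatial_tensor A B) \<psi>"
    and legs: "\<And>E. unital_cstar_subalgebra E (spatial_tensor A B) \<Longrightarrow> \<phi> ` C \<subseteq> E \<Longrightarrow> \<psi> ` D \<subseteq> E \<Longrightarrow>
       (\<forall>a\<in>A. op_tensor a (unit_of B) \<in> E) \<and> (\<forall>b\<in>B. op_tensor (unit_of A) b \<in> E)"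
  shows "spatial_tensor A B \<subseteq> op_closure (op_span {op_mult (\<phi> c) (\<psi> d) | c d. c \<in> C \<and> d \<in> D})"
    (is "_ \<subseteq> op_closure (op_span ?P)")
proof -
  note T = spatial_tensor_unital_cstar_algebra(1)[OF A(1) B(1)]
  note span = product_span_of_commuting_homs[OF C D T commutative_spatial_tensor[OF A B] \<phi> \<psi>]
  let ?E = "op_closure (op_span ?P)"
  have bounded: "bounded_op (\<phi> c)" "bounded_op (\<psi> d)" if "c \<in> C" "d \<in> D" for c d
    using unital_cstar_algebraD(6)[OF T] unital_star_homD(1)[OF \<phi>] unital_star_homD(1)[OF \<psi>] that by blast+
  have "\<phi> ` C \<subseteq> ?E" "\<psi> ` D \<subseteq> ?E"
    using bounded unital_cstar_algebraD(3)[OF C] unital_cstar_algebraD(3)[OF D]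
    by (intro image_subsetI op_closure_op_span_superset span(2,3); blast)+
  from legs[OF span(1) this] show ?thesis
    by (intro spatial_tensor_subset_of_legs[OF A(1) B(1) unital_cstar_subalgebraD(1)[OF span(1)]]) auto
qed

section \<open>The reduced group C*-algebra\<close>

context group
begin

text \<open>Translation by \<open>g\<close> is a partial permutation of the coordinates.\<close>
lemma op_bound_regular_op:
  assumes g: "g \<in> carrier G" shows "op_bound 1 (regular_op G g)"
proof (rule op_bound_by_vectors)
  fix F :: "'a set" and y :: "'a \<Rightarrow> complex" assume F: "finite F"
  let ?m = "\<lambda>i. inv g \<otimes> i"
  define H where "H = {i \<in> F \<inter> carrier G. ?m i \<in> F}"
  have H: "finite H" using F by (simp add: H_def)
  have val: "(\<Sum>j\<in>F. regular_op G g i j * y j) = (if i \<in> H then y (?m i) else 0)" if i: "i \<in> F" for i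
  proof (cases "i \<in> carrier G")
    case True
    have "(\<Sum>j\<in>F. regular_op G g i j * y j) = (\<Sum>j\<in>F. if j = ?m i then y j else 0)"
      by (rule sum.cong) (use True g in \<open>auto simp: regular_op_def m_assoc[symmetric] inv_solve_left\<close>)
    thus ?thesis using F i True by (simp add: H_def)
  qed (simp add: regular_op_def H_def)
  have "(\<Sum>i\<in>F. (cmod (\<Sum>j\<in>F. regular_op G g i j * y j))\<^sup>2) = (\<Sum>i\<in>F. (cmod (if i \<in> H then y (?m i) else 0))\<^sup>2)"
    by (rule sum.cong) (simp_all add: val)
  also have "\<dots> = (\<Sum>i\<in>H. (cmod (y (?m i)))\<^sup>2)"
    by (rule sum.mono_neutral_cong_right) (use F in \<open>auto simp: H_def\<close>)
  also have "\<dots> = (\<Sum>j\<in>?m ` H. (cmod (y j))\<^sup>2)"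
    by (rule sum.reindex_cong[symmetric, where l = ?m])
       (use g in \<open>auto simp: inj_on_def H_def\<close>)
  also have "\<dots> \<le> (\<Sum>j\<in>F. (cmod (y j))\<^sup>2)"
    by (rule sum_mono2) (use F in \<open>auto simp: H_def\<close>)
  finally show "L2_set (\<lambda>i. cmod (\<Sum>j\<in>F. regular_op G g i j * y j)) F \<le> 1 * L2_set (\<lambda>j. cmod (y j)) F"
    by (simp add: L2_set_def)
qed simp

definition lam :: "'a \<Rightarrow> 'a bop" where "lam g = Bop (regular_op G g)"

lemma mat_of_lam: "g \<in> carrier G \<Longrightarrow> mat_of (lam g) = regular_op G g"
  unfolding lam_def by (rule mat_of_Bop) (rule bounded_opI[OF op_bound_regular_op])

lemma lam_mult:
  assumes g: "g \<in> carrier G" and h: "h \<in> carrier G" shows "lam g * lam h = lam (g \<otimes> h)"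
proof -
  have "op_mult (regular_op G g) (regular_op G h) i j = regular_op G (g \<otimes> h) i j" for i j
  proof (cases "j \<in> carrier G")
    case True
    have "op_mult (regular_op G g) (regular_op G h) i j = (\<Sum>\<^sub>\<infinity>k\<in>{h \<otimes> j}. regular_op G g i k)"
      unfolding op_mult_def by (rule infsum_cong_neutral) (use True h in \<open>auto simp: regular_op_def\<close>)
    thus ?thesis using True g h by (simp add: regular_op_def m_assoc)
  qed (simp add: op_mult_def regular_op_def)
  hence "mat_of (lam g * lam h) = mat_of (lam (g \<otimes> h))"
    using g h by (simp add: mat_of_lam fun_eq_iff flip: mat_of_simps)
  thus ?thesis by simp
qed

lemma star_lam:
  assumes g: "g \<in> carrier G" shows "star (lam g) = lam (inv g)"
proof -
  have "op_adj (regular_op G g) i j = regular_op G (inv g) i j" for i j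
  proof (cases "i \<in> carrier G \<and> j \<in> carrier G")
    case True
    hence "j = g \<otimes> i \<longleftrightarrow> i = inv g \<otimes> j" using g inv_solve_left by metis
    thus ?thesis using True by (simp add: op_adj_def regular_op_def)
  qed (auto simp: op_adj_def regular_op_def)
  hence "mat_of (star (lam g)) = mat_of (lam (inv g))"
    using g by (simp add: mat_of_lam fun_eq_iff flip: mat_of_simps)
  thus ?thesis by simp
qed

lemma lam_entry: "g \<in> carrier G \<Longrightarrow> mat_of (lam g) h \<one> = (if h = g then 1 else 0)"
  by (auto simp: mat_of_lam regular_op_def)

definition group_algebra :: "'a bop set" where
  "group_algebra = closure (cspan (lam ` carrier G))"

lemma regular_op_image: "H \<subseteq> carrier G \<Longrightarrow> regular_op G ` H = mat_of ` lam ` H"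
  unfolding image_image by (rule image_cong) (auto simp: mat_of_lam)

lemma reduced_group_algebra_eq: "reduced_group_algebra G = mat_of ` group_algebra"
  by (simp add: reduced_group_algebra_def group_algebra_def regular_op_image op_closure_op_span_eq)

lemma cstar_algebra_group_algebra: "cstar_algebra group_algebra (lam \<one>)"
  unfolding group_algebra_def
  by (rule cstar_algebra_closure_cspan) (auto simp: lam_mult star_lam)

lemma lam_in_group_algebra: "g \<in> carrier G \<Longrightarrow> lam g \<in> group_algebra"
  unfolding group_algebra_def by (intro subsetD[OF closure_subset] subsetD[OF cspan_superset]) auto

end

section \<open>Coefficient matrices over a group with unique products\<close>

text \<open>The conditions under which single coefficients can be read off from a product of two generators:
  apart from the inverse pairs, which all have product 1, an unordered pair of generators is
  determined by its product. Generators of order 2 are excluded, because for them the square would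
  fall among the inverse pairs.\<close>
locale symmetric_unique_products = comm_group G for G (structure) +
  fixes S :: "'a set"
  assumes finite_S: "finite S"
    and S_carrier: "S \<subseteq> carrier G"
    and S_inv: "s \<in> S \<Longrightarrow> inv s \<in> S"
    and S_square: "s \<in> S \<Longrightarrow> s \<otimes> s \<noteq> \<one>"
    and S_products: "s \<in> S \<Longrightarrow> t \<in> S \<Longrightarrow> p \<in> S \<Longrightarrow> q \<in> S \<Longrightarrow> s \<otimes> t \<noteq> \<one> \<Longrightarrow>
      p \<otimes> q = s \<otimes> t \<Longrightarrow> p = s \<and> q = t \<or> p = t \<and> q = s"
begin

lemma S_mem [simp]: "s \<in> S \<Longrightarrow> s \<in> carrier G"
  using S_carrier by auto

lemma S_prod_one_iff:
  assumes "s \<in> S" "t \<in> S" shows "s \<otimes> t = \<one> \<longleftrightarrow> t = inv s"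
proof
  assume "s \<otimes> t = \<one>"
  hence "t \<otimes> s = \<one>" using assms m_comm[of s t] by simp
  thus "t = inv s" using assms inv_equality[of t s] by simp
qed (use assms in simp)

text \<open>The coefficient of \<open>\<lambda>_x\<close> in the product of the two columns \<open>g\<close> and \<open>h\<close>, that is in \<open>\<alpha> \<lambda>_g \<alpha> \<lambda>_h\<close> when \<open>u\<close> is
  the coefficient matrix of \<open>\<alpha>\<close>.\<close>
definition conv :: "('a \<Rightarrow> 'a \<Rightarrow> 'i bop) \<Rightarrow> 'a \<Rightarrow> 'a \<Rightarrow> 'a \<Rightarrow> 'i bop" where
  "conv u x g h = (\<Sum>(s, t)\<in>{(s, t). (s, t) \<in> S \<times> S \<and> s \<otimes> t = x}. u s g * u t h)"

lemma conv_square: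
  assumes s: "s \<in> S" shows "conv u (s \<otimes> s) g h = u s g * u s h"
proof -
  have "{(p, q). (p, q) \<in> S \<times> S \<and> p \<otimes> q = s \<otimes> s} = {(s, s)}"
    using S_products[OF s s _ _ S_square[OF s]] s by blast
  thus ?thesis by (simp add: conv_def)
qed

lemma conv_mixed:
  assumes S: "s \<in> S" "t \<in> S" and ne: "s \<noteq> t" "s \<otimes> t \<noteq> \<one>"
  shows "conv u (s \<otimes> t) g h = u s g * u t h + u t g * u s h"
proof -
  have "t \<otimes> s = s \<otimes> t" using S by (intro m_comm) auto
  hence "{(p, q). (p, q) \<in> S \<times> S \<and> p \<otimes> q = s \<otimes> t} = {(s, t), (t, s)}"
    using S_products[OF S _ _ ne(2)] S by blast
  thus ?thesis using ne(1) by (simp add: conv_def)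
qed

text \<open>The two consequences of \<open>\<alpha> \<lambda>_g \<alpha> \<lambda>_h = \<alpha> \<lambda>_{gh}\<close> that enter the computation: the product of two columns is
  symmetric, and that of two mutually inverse columns has no component away from 1. The property is
  formulated for an arbitrary matrix so that it applies to the transpose too.\<close>
definition multiplicative_columns :: "('a \<Rightarrow> 'a \<Rightarrow> 'i bop) \<Rightarrow> bool" where
  "multiplicative_columns u \<longleftrightarrow>
     (\<forall>s\<in>S. \<forall>t\<in>S. \<forall>g\<in>S. \<forall>h\<in>S. conv u (s \<otimes> t) g h = conv u (s \<otimes> t) h g) \<and>
     (\<forall>s\<in>S. \<forall>t\<in>S. \<forall>g\<in>S. s \<otimes> t \<noteq> \<one> \<longrightarrow> conv u (s \<otimes> t) g (inv g) = 0)"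

lemma multiplicative_columnsD:
  assumes m: "multiplicative_columns u" and S: "s \<in> S" "t \<in> S" "g \<in> S" "h \<in> S"
  shows "u s g * u s h = u s h * u s g"
    and "s \<noteq> t \<Longrightarrow> t \<noteq> inv s \<Longrightarrow> u s g * u t h + u t g * u s h = u s h * u t g + u t h * u s g"
    and "u s g * u s (inv g) = 0"
    and "s \<noteq> t \<Longrightarrow> t \<noteq> inv s \<Longrightarrow> u s g * u t (inv g) + u t g * u s (inv g) = 0"
proof -
  have c: "conv u (s \<otimes> t) g h = conv u (s \<otimes> t) h g"
    and z: "s \<otimes> t \<noteq> \<one> \<Longrightarrow> conv u (s \<otimes> t) g (inv g) = 0" if "s \<in> S" "t \<in> S" for s t
    using m S(3,4) that unfolding multiplicative_columns_def by auto
  show "u s g * u s h = u s h * u s g"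
    using c[OF S(1) S(1)] by (simp only: conv_square[OF S(1)])
  show "u s g * u s (inv g) = 0"
    using z[OF S(1) S(1) S_square[OF S(1)]] by (simp only: conv_square[OF S(1)])
  assume st: "s \<noteq> t" "t \<noteq> inv s"
  have ne: "s \<otimes> t \<noteq> \<one>" using st S_prod_one_iff[OF S(1,2)] by simp
  show "u s g * u t h + u t g * u s h = u s h * u t g + u t h * u s g"
    using c[OF S(1,2)] by (simp only: conv_mixed[OF S(1,2) st(1) ne])
  show "u s g * u t (inv g) + u t g * u s (inv g) = 0"
    using z[OF S(1,2) ne] by (simp only: conv_mixed[OF S(1,2) st(1) ne])
qed

text \<open>Let \<open>X = u s g\<close> and \<open>Y = u t g\<close>. The relation for the inverse columns rewrites \<open>Y* X\<close> as a product
  ending in \<open>u (inv t) g\<close>, which annihilates \<open>Y\<close> by the row relations. So \<open>Y* X Y = 0\<close>, and as \<open>X\<close> and \<open>Y\<close>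
  commute, \<open>(Y X)* (Y X) = 0\<close>. For \<open>t = inv s\<close> the claim is itself a row relation.\<close>
lemma column_products_vanish:
  fixes u :: "'a \<Rightarrow> 'a \<Rightarrow> 'i bop"
  assumes col: "multiplicative_columns u" and row: "multiplicative_columns (\<lambda>s g. u g s)"
    and star_u: "\<And>s g. s \<in> S \<Longrightarrow> g \<in> S \<Longrightarrow> star (u s g) = u (inv s) (inv g)"
    and S: "s \<in> S" "t \<in> S" "g \<in> S" "s \<noteq> t"
  shows "u s g * u t g = 0"
proof (cases "t = inv s")
  case True
  thus ?thesis using multiplicative_columnsD(3)[OF row S(3) S(3) S(1) S(1)] by simp
next
  case False
  let ?X = "u s g" and ?Y = "u t g"
  note inv = S_inv[OF S(1)] S_inv[OF S(2)] S_inv[OF S(3)]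
  have "inv t \<noteq> s" using False S by auto
  moreover have "s \<noteq> inv (inv t)" using S by simp
  ultimately have "u (inv t) (inv g) * u s (inv (inv g)) + u s (inv g) * u (inv t) (inv (inv g)) = 0"
    using multiplicative_columnsD(4)[OF col inv(2) S(1) inv(3) inv(3)] by blast
  hence z2: "star ?Y * ?X = - (u s (inv g) * u (inv t) g)"
    using S by (simp add: star_u eq_neg_iff_add_eq_0)
  have z1: "u (inv t) g * ?Y = 0"
    using multiplicative_columnsD(3)[OF row S(3) S(3) inv(2) inv(2)] S by simp
  have comm: "?X * ?Y = ?Y * ?X"
    by (rule multiplicative_columnsD(1)[OF row S(3) S(3) S(1) S(2)])
  have "star (?Y * ?X) * (?Y * ?X) = star ?X * (star ?Y * ?X * ?Y)"
    by (simp add: star_mult mult.assoc comm)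
  also have "star ?Y * ?X * ?Y = - (u s (inv g) * (u (inv t) g * ?Y))"
    by (simp add: z2 mult.assoc)
  also have "\<dots> = 0" by (simp add: z1)
  finally have "star (?Y * ?X) * (?Y * ?X) = 0" by simp
  hence "?Y * ?X = 0" by (rule star_mult_self_eq_0)
  thus ?thesis by (simp add: comm)
qed

text \<open>Multiplying the isometry relation \<open>\<Sum>_s (u s g)* (u s g) = e\<close> by an entry \<open>x\<close> of the column leaves \<open>x* x x = x\<close>,
  and dually \<open>x x x* = x\<close>, so that \<open>x\<close> is normal. For normal entries \<open>x y = 0\<close> implies \<open>x y* = 0\<close>. Entries in
  the same row or column, or in mutually inverse ones, commute for these reasons. For entries in
  general position the column relation equates the commutator of \<open>u s g\<close> and \<open>u t h\<close> with that of \<open>u s h\<close>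
  and \<open>u t g\<close>, the row relation equates it with the negative, and both vanish.\<close>
theorem coefficients_commute:
  fixes u :: "'a \<Rightarrow> 'a \<Rightarrow> 'i bop"
  assumes col: "multiplicative_columns u" and row: "multiplicative_columns (\<lambda>s g. u g s)"
    and star_u: "\<And>s g. s \<in> S \<Longrightarrow> g \<in> S \<Longrightarrow> star (u s g) = u (inv s) (inv g)"
    and unit: "\<And>s g. s \<in> S \<Longrightarrow> g \<in> S \<Longrightarrow> e * u s g = u s g"
    and isometry: "\<And>g. g \<in> S \<Longrightarrow> (\<Sum>s\<in>S. star (u s g) * u s g) = e"
    and S: "s \<in> S" "t \<in> S" "g \<in> S" "h \<in> S"
  shows "u s g * u t h = u t h * u s g"
proof -
  have star_u': "star (u g s) = u (inv g) (inv s)" if "s \<in> S" "g \<in> S" for s g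
    by (rule star_u[OF that(2,1)])
  have row0: "u g s * u g t = 0" if "s \<in> S" "t \<in> S" "g \<in> S" "s \<noteq> t" for s t g
    using column_products_vanish[of "\<lambda>s g. u g s", OF row _ star_u'] col that by simp
  have col0: "u s g * u t g = 0" if "s \<in> S" "t \<in> S" "g \<in> S" "s \<noteq> t" for s t g
    by (rule column_products_vanish[OF col row star_u that])
  have left: "star (u s g) * u s g * u s g = u s g" if "s \<in> S" "g \<in> S" for s g
  proof -
    have "u s g = (\<Sum>t\<in>S. star (u t g) * u t g) * u s g" by (simp add: isometry unit that)
    also have "\<dots> = (\<Sum>t\<in>S. if t = s then star (u s g) * u s g * u s g else 0)"
      unfolding sum_distrib_right
      by (rule sum.cong) (use that col0 in \<open>auto simp: mult.assoc\<close>)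
    also have "\<dots> = star (u s g) * u s g * u s g" using that finite_S by simp
    finally show ?thesis by simp
  qed
  have right: "u s g * u s g * star (u s g) = u s g" if sg: "s \<in> S" "g \<in> S" for s g
  proof -
    have "star (star (u (inv s) (inv g)) * u (inv s) (inv g) * u (inv s) (inv g)) = star (u (inv s) (inv g))"
      using left[OF S_inv S_inv, OF sg] by simp
    thus ?thesis
      using sg by (simp add: star_mult star_u S_inv mult.assoc)
  qed
  have normal: "star (u s g) * u s g = u s g * star (u s g)" if "s \<in> S" "g \<in> S" for s g
  proof -
    let ?x = "u s g"
    have "star ?x * ?x = star ?x * (?x * ?x * star ?x)" by (simp only: right[OF that])
    also have "\<dots> = star ?x * ?x * ?x * star ?x" by (simp only: mult.assoc)
    also have "\<dots> = ?x * star ?x" by (simp only: left[OF that])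
    finally show ?thesis .
  qed
  have zero_star: "x * star y = 0" if n: "star x * x = x * star x" and z: "y * x = 0" for x y :: "'i bop"
  proof (rule star_mult_self_eq_0)
    have "star (x * star y) * (x * star y) = y * (star x * x) * star y" by (simp add: star_mult mult.assoc)
    also have "\<dots> = y * x * (star x * star y)" by (simp only: n mult.assoc)
    finally show "star (x * star y) * (x * star y) = 0" by (simp add: z)
  qed
  have col_star0: "u s g * u t (inv g) = 0" if h: "s \<in> S" "t \<in> S" "g \<in> S" "t \<noteq> inv s" for s t g
  proof -
    have "inv t \<noteq> s" using h by auto
    hence "u (inv t) g * u s g = 0" using col0[of "inv t" s g] h S_inv by simp
    from zero_star[OF normal this] show ?thesis using h by (simp add: star_u S_inv)
  qed
  have row_star0: "u g s * u (inv g) t = 0" if h: "s \<in> S" "t \<in> S" "g \<in> S" "t \<noteq> inv s" for s t g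
  proof -
    have "inv t \<noteq> s" using h by auto
    hence "u g (inv t) * u g s = 0" using row0[of "inv t" s g] h S_inv by simp
    from zero_star[OF normal this] show ?thesis using h by (simp add: star_u S_inv)
  qed
  have normal': "u s g * u (inv s) (inv g) = u (inv s) (inv g) * u s g" if "s \<in> S" "g \<in> S" for s g
    using normal[OF that] that by (simp add: star_u)
  \<comment> \<open>The first five cases are those in which the two entries share a row or a column up to inversion.\<close>
  consider "s = t" | "g = h" | "s \<noteq> t" "g \<noteq> h" "t = inv s" "h = inv g" | "t = inv s" "h \<noteq> inv g"
    | "h = inv g" "t \<noteq> inv s" | "s \<noteq> t" "g \<noteq> h" "t \<noteq> inv s" "h \<noteq> inv g" by blast
  thus ?thesis
  proof cases
    case 1
    thus ?thesis using multiplicative_columnsD(1)[OF col S(1) S(1) S(3,4)] by simp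
  next
    case 2
    thus ?thesis using multiplicative_columnsD(1)[OF row S(3) S(3) S(1,2)] by simp
  next
    case 3
    thus ?thesis using normal' S by simp
  next
    case 4
    have "g \<noteq> inv h" using 4 S by auto
    hence "u t h * u (inv t) g = 0" using row_star0[of h g t] S by simp
    moreover have "u s g * u (inv s) h = 0" using row_star0[of g h s] S 4 by simp
    ultimately show ?thesis using 4 S by simp
  next
    case 5
    have "s \<noteq> inv t" using 5 S by auto
    hence "u t h * u s (inv h) = 0" using col_star0[of t s h] S by simp
    moreover have "u s g * u t (inv g) = 0" using col_star0[of s t g] S 5 by simp
    ultimately show ?thesis using 5 S by simp
  next
    case 6
    have c: "u s g * u t h + u t g * u s h = u s h * u t g + u t h * u s g"
      by (rule multiplicative_columnsD(2)[OF col S 6(1,3)])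
    have r: "u s g * u t h + u s h * u t g = u t g * u s h + u t h * u s g"
      by (rule multiplicative_columnsD(2)[OF row S(3,4,1,2) 6(2,4)])
    have "(u s g * u t h + u s g * u t h) + (u t g * u s h + u s h * u t g)
        = (u s g * u t h + u t g * u s h) + (u s g * u t h + u s h * u t g)"
      by (simp only: add.assoc add.commute add.left_commute)
    also have "\<dots> = (u s h * u t g + u t h * u s g) + (u t g * u s h + u t h * u s g)"
      by (simp only: c r)
    also have "\<dots> = (u t h * u s g + u t h * u s g) + (u t g * u s h + u s h * u t g)"
      by (simp only: add.assoc add.commute add.left_commute)
    finally have "u s g * u t h + u s g * u t h = u t h * u s g + u t h * u s g"
      by (rule add_right_imp_eq)
    hence "2 *\<^sub>R (u s g * u t h) = 2 *\<^sub>R (u t h * u s g)" by (simp only: scaleR_2)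
    thus ?thesis by simp
  qed
qed

end

section \<open>Actions on the group algebra\<close>

lemma slice_zero [simp]: "slice e f 0 = 0"
  using slice_cscale[of e f 0 0] by simp

lemma slice_sum: "slice e f (sum x I) = (\<Sum>i\<in>I. slice e f (x i))"
  by (induction I rule: infinite_finite_induct) (simp_all add: slice_add)

lemma slice_in_second_leg:
  assumes "T \<in> tens W V" "csubspace V" "closed V" shows "slice e f T \<in> V"
proof -
  have "tens W V \<subseteq> {T. slice e f T \<in> V}"
    by (rule tens_minimal)
       (use assms(2,3) in \<open>auto intro!: csubspace_linear_preimage closed_linear_preimage bounded_linear_slice csubspaceD
         simp: slice_add slice_cscale slice_tensor\<close>)
  thus ?thesis using assms(1) by blast
qed

context group
begin

lemma tensor_regular_op_image:
  assumes H: "H \<subseteq> carrier G"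
  shows "{op_tensor (regular_op G h) q | h q. h \<in> H \<and> q \<in> mat_of ` W}
    = mat_of ` {tensor (lam h) q | h q. h \<in> H \<and> q \<in> W}"
proof -
  have *: "op_tensor (regular_op G h) (mat_of q) = mat_of (tensor (lam h) q)" if "h \<in> H" for h q
  proof -
    have "h \<in> carrier G" using that H by blast
    thus ?thesis by (simp add: mat_of_lam flip: mat_of_simps)
  qed
  show ?thesis
  proof (intro equalityI subsetI)
    fix t assume "t \<in> {op_tensor (regular_op G h) q | h q. h \<in> H \<and> q \<in> mat_of ` W}"
    then obtain h q where "t = op_tensor (regular_op G h) (mat_of q)" "h \<in> H" "q \<in> W"
      by blast
    thus "t \<in> mat_of ` {tensor (lam h) q | h q. h \<in> H \<and> q \<in> W}"
      using *[of h q] by blast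
  next
    fix t assume "t \<in> mat_of ` {tensor (lam h) q | h q. h \<in> H \<and> q \<in> W}"
    then obtain h q where "t = mat_of (tensor (lam h) q)" "h \<in> H" "q \<in> W" by blast
    thus "t \<in> {op_tensor (regular_op G h) q | h q. h \<in> H \<and> q \<in> mat_of ` W}"
      using *[of h q] by force
  qed
qed

text \<open>The slices recover the coefficients of a finite sum of elementary tensors \<open>\<lambda>_h \<otimes> q\<close>.\<close>
lemma tensor_lam_cspan_expansion:
  assumes T: "T \<in> cspan {tensor (lam h) q | h q. h \<in> H \<and> q \<in> W}"
    and H: "H \<subseteq> carrier G" and W: "csubspace W"
  obtains F where "finite F" "F \<subseteq> H" "T = (\<Sum>h\<in>F. tensor (lam h) (slice h \<one> T))"
    "\<forall>h. slice h \<one> T \<in> W" "\<forall>h. h \<notin> F \<longrightarrow> slice h \<one> T = 0"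
proof -
  note S = csubspaceD[OF W]
  let ?V = "{T. \<exists>F q. finite F \<and> F \<subseteq> H \<and> (\<forall>h. q h \<in> W) \<and> T = (\<Sum>h\<in>F. tensor (lam h) (q h))}"
  have bl: "tensor x 0 = 0" for x :: "'a bop" by (rule bounded_bilinear.zero_right[OF bounded_bilinear_tensor])
  have "cspan {tensor (lam h) q | h q. h \<in> H \<and> q \<in> W} \<subseteq> ?V"
  proof (rule cspan_minimal)
    show "{tensor (lam h) q | h q. h \<in> H \<and> q \<in> W} \<subseteq> ?V"
    proof
      fix T assume "T \<in> {tensor (lam h) q | h q. h \<in> H \<and> q \<in> W}"
      then obtain h q where "T = tensor (lam h) q" "h \<in> H" "q \<in> W" by blast
      thus "T \<in> ?V" by (intro CollectI exI[of _ "{h}"] exI[of _ "\<lambda>_. q"]) auto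
    qed
    show "csubspace ?V"
      unfolding csubspace_def
    proof (intro conjI ballI allI)
      show "0 \<in> ?V" by (intro CollectI exI[of _ "{}"] exI[of _ "\<lambda>_. 0"]) (auto simp: S)
      fix T assume "T \<in> ?V"
      then obtain F q where F: "finite F" "F \<subseteq> H" "\<And>h. q h \<in> W" "T = (\<Sum>h\<in>F. tensor (lam h) (q h))" by blast
      show "cscale c T \<in> ?V" for c
      proof -
        have "cscale c T = (\<Sum>h\<in>F. tensor (lam h) (cscale c (q h)))"
          unfolding F(4) tensor_cscale_right
          by (rule linear_sum[OF bounded_linear.linear[OF bounded_linear_cscale]])
        thus ?thesis using F by (intro CollectI exI[of _ F] exI[of _ "\<lambda>h. cscale c (q h)"]) (auto simp: S)
      qed
      fix T' assume "T' \<in> ?V"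
      then obtain F' q' where F': "finite F'" "F' \<subseteq> H" "\<And>h. q' h \<in> W" "T' = (\<Sum>h\<in>F'. tensor (lam h) (q' h))" by blast
      define r where "r h = (if h \<in> F then q h else 0) + (if h \<in> F' then q' h else 0)" for h
      have "T = (\<Sum>h\<in>F\<union>F'. tensor (lam h) (if h \<in> F then q h else 0))"
        unfolding F(4) by (rule sum.mono_neutral_cong_left) (use F F' in \<open>auto simp: bl\<close>)
      moreover have "T' = (\<Sum>h\<in>F\<union>F'. tensor (lam h) (if h \<in> F' then q' h else 0))"
        unfolding F'(4) by (rule sum.mono_neutral_cong_left) (use F F' in \<open>auto simp: bl\<close>)
      ultimately have "T + T' = (\<Sum>h\<in>F\<union>F'. tensor (lam h) (r h))"
        by (simp only: r_def tensor_add_right sum.distrib)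
      thus "T + T' \<in> ?V"
        using F F' by (intro CollectI exI[of _ "F \<union> F'"] exI[of _ r]) (auto simp: r_def S)
    qed
  qed
  with T obtain F q where F: "finite F" "F \<subseteq> H" "\<And>h. q h \<in> W" "T = (\<Sum>h\<in>F. tensor (lam h) (q h))" by blast
  have sl: "slice h \<one> T = (if h \<in> F then q h else 0)" for h
  proof -
    have "slice h \<one> T = (\<Sum>k\<in>F. if k = h then q k else 0)"
      unfolding F(4) slice_sum by (rule sum.cong) (use F(2) H in \<open>auto simp: slice_tensor lam_entry\<close>)
    thus ?thesis using F(1) by simp
  qed
  show ?thesis
  proof (rule that[OF F(1,2)])
    show "T = (\<Sum>h\<in>F. tensor (lam h) (slice h \<one> T))"
      unfolding sl by (subst F(4)) (rule sum.cong, auto)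
  qed (auto simp: sl F(3) S)
qed

end

text \<open>An object of the category. The parameters \<open>W\<close> and \<open>e\<close> present \<open>Q\<close> and its unit in the type of bounded
  operators.\<close>
locale qiso_action = symmetric_unique_products G S for G (structure) and S :: "'a set" +
  fixes Q :: "'i op set" and \<Delta> :: "'i op \<Rightarrow> ('i \<times> 'i) op" and \<alpha> :: "'a op \<Rightarrow> ('a \<times> 'i) op"
    and W :: "'i bop set" and e :: "'i bop"
  assumes generating: "g \<in> carrier G \<Longrightarrow> \<exists>ws. set ws \<subseteq> S \<and> foldr (\<otimes>) ws \<one> = g"
    and object: "qiso_object G S Q \<Delta> \<alpha>"
    and Q_eq: "Q = mat_of ` W" and W_cstar: "cstar_algebra W e"
begin

lemma one_notin_S: "\<one> \<notin> S"
  using S_square[of \<one>] by auto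

lemma word_length_attained:
  assumes "g \<in> carrier G"
  shows "\<exists>ws. set ws \<subseteq> S \<and> length ws = word_length G S g \<and> foldr (\<otimes>) ws \<one> = g"
proof -
  let ?P = "\<lambda>r. \<exists>ws. set ws \<subseteq> S \<and> length ws = r \<and> foldr (\<otimes>) ws \<one> = g"
  obtain ws where "set ws \<subseteq> S" "foldr (\<otimes>) ws \<one> = g" using generating[OF assms] by blast
  hence "?P (length ws)" by blast
  hence "?P (LEAST r. ?P r)" by (rule LeastI)
  thus ?thesis by (simp only: word_length_def)
qed

lemma sphere_one: "sphere G S 1 = S"
proof
  show "sphere G S 1 \<subseteq> S"
  proof
    fix g assume g: "g \<in> sphere G S 1"
    then obtain ws where "set ws \<subseteq> S" "length ws = 1" "foldr (\<otimes>) ws \<one> = g"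
      using word_length_attained[of g] by (auto simp: sphere_def)
    thus "g \<in> S" by (cases ws) auto
  qed
  show "S \<subseteq> sphere G S 1"
  proof
    fix g assume g: "g \<in> S"
    have "word_length G S g = 1"
      unfolding word_length_def
    proof (rule Least_equality)
      show "\<exists>ws. set ws \<subseteq> S \<and> length ws = 1 \<and> foldr (\<otimes>) ws \<one> = g"
        using g by (intro exI[of _ "[g]"]) auto
      fix r assume "\<exists>ws. set ws \<subseteq> S \<and> length ws = r \<and> foldr (\<otimes>) ws \<one> = g"
      then obtain ws where ws: "length ws = r" "foldr (\<otimes>) ws \<one> = g" by blast
      have "ws \<noteq> []" using ws(2) g one_notin_S by auto
      thus "1 \<le> r" using ws(1) by (cases ws) auto
    qed
    thus "g \<in> sphere G S 1" using g by (simp add: sphere_def)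
  qed
qed

lemma sphere_carrier: "sphere G S r \<subseteq> carrier G"
  by (auto simp: sphere_def)

lemma cqg: "compact_quantum_group Q \<Delta>" and action: "cqg_action (reduced_group_algebra G) Q \<Delta> \<alpha>"
  and trace_preserving: "b \<in> reduced_group_algebra G \<Longrightarrow>
     op_slice \<one> (\<alpha> b) = op_scale (canonical_trace G b) (unit_of Q)"
  and sphere_preserving: "\<alpha> ` op_span (regular_op G ` sphere G S r) \<subseteq>
     op_span {op_tensor (regular_op G h) q | h q. h \<in> sphere G S r \<and> q \<in> Q}"
  using object by (simp_all add: qiso_object_def)

lemma Q_cstar: "unital_cstar_algebra Q" and unit_Q: "unit_of Q = mat_of e"
  using unital_cstar_algebraI[OF W_cstar] by (simp_all add: Q_eq)

lemmas W = cstar_algebraD[OF W_cstar] star_algebraD(2,3)[OF cstar_algebraD(1)[OF W_cstar]]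

abbreviation B where "B \<equiv> group_algebra"

lemmas B = cstar_algebraD[OF cstar_algebra_group_algebra] star_algebraD(2,3)[OF cstar_algebraD(1)[OF cstar_algebra_group_algebra]]

definition a where "a = lower \<alpha>"

lemma action_hom:
  shows action_eq: "x \<in> B \<Longrightarrow> \<alpha> (mat_of x) = mat_of (a x)" and action_in: "x \<in> B \<Longrightarrow> a x \<in> tens B W"
    and action_star_hom: "star_hom_on B a" and action_one: "a (lam \<one>) = tensor (lam \<one>) e"
proof -
  have "unital_star_hom (mat_of ` B) (mat_of ` tens B W) \<alpha>"
    using action unfolding cqg_action_def reduced_group_algebra_eq Q_eq spatial_tensor_eq by blast
  from unital_star_homE[OF this cstar_algebra_group_algebra cstar_algebra_tens[OF cstar_algebra_group_algebra W_cstar]]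
  show "x \<in> B \<Longrightarrow> \<alpha> (mat_of x) = mat_of (a x)" "x \<in> B \<Longrightarrow> a x \<in> tens B W"
    "star_hom_on B a" "a (lam \<one>) = tensor (lam \<one>) e"
    by (simp_all add: a_def)
qed

lemma action_add: "x \<in> B \<Longrightarrow> y \<in> B \<Longrightarrow> a (x + y) = a x + a y"
  and action_mult: "x \<in> B \<Longrightarrow> y \<in> B \<Longrightarrow> a (x * y) = a x * a y"
  and action_star: "x \<in> B \<Longrightarrow> a (star x) = star (a x)"
  and action_cscale: "x \<in> B \<Longrightarrow> a (cscale c x) = cscale c (a x)"
  using action_star_hom by (auto simp: star_hom_on_def)

text \<open>The coefficient of \<open>\<lambda>_h\<close> in \<open>\<alpha> \<lambda>_g\<close>.\<close>
definition w :: "'a \<Rightarrow> 'a \<Rightarrow> 'i bop" where "w h g = slice h \<one> (a (lam g))"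

lemma w_in_W: "g \<in> carrier G \<Longrightarrow> w h g \<in> W"
  unfolding w_def by (rule slice_in_second_leg[OF action_in W(2,3)]) (rule lam_in_group_algebra)

lemma w_unit: "g \<in> carrier G \<Longrightarrow> e * w h g = w h g" "g \<in> carrier G \<Longrightarrow> w h g * e = w h g"
  using W(5,6)[OF w_in_W] by auto

lemma trace_action: "x \<in> B \<Longrightarrow> slice \<one> \<one> (a x) = cscale (mat_of x \<one> \<one>) e"
proof -
  assume x: "x \<in> B"
  have "mat_of (slice \<one> \<one> (a x)) = mat_of (cscale (mat_of x \<one> \<one>) e)"
    using trace_preserving[of "mat_of x"] x
    by (simp add: reduced_group_algebra_eq action_eq op_slice_def canonical_trace_def unit_Q slice.rep_eq mat_of_simps)
  thus ?thesis by simp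
qed

lemma action_span_sphere:
  assumes "x \<in> cspan (lam ` sphere G S r)"
  shows "a x \<in> cspan {tensor (lam h) q | h q. h \<in> sphere G S r \<and> q \<in> W}"
proof -
  have "cspan (lam ` sphere G S r) \<subseteq> B"
    using sphere_carrier by (intro cspan_minimal B(2)) (auto intro: lam_in_group_algebra)
  hence x: "x \<in> B" using assms by blast
  have eq: "{op_tensor (regular_op G h) q | h q. h \<in> sphere G S r \<and> q \<in> Q}
    = mat_of ` {tensor (lam h) q | h q. h \<in> sphere G S r \<and> q \<in> W}"
    unfolding Q_eq by (rule tensor_regular_op_image[OF sphere_carrier])
  have "\<alpha> (mat_of x) \<in> op_span {op_tensor (regular_op G h) q | h q. h \<in> sphere G S r \<and> q \<in> Q}"
    using sphere_preserving[of r] assms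
    unfolding regular_op_image[OF sphere_carrier] op_span_eq_cspan by blast
  thus ?thesis unfolding eq op_span_eq_cspan action_eq[OF x] by simp
qed

lemma w_support:
  assumes g: "g \<in> carrier G"
  obtains F where "finite F" "F \<subseteq> sphere G S (word_length G S g)"
    "a (lam g) = (\<Sum>h\<in>F. tensor (lam h) (w h g))" "\<forall>h. h \<notin> F \<longrightarrow> w h g = 0"
proof -
  have "lam g \<in> cspan (lam ` sphere G S (word_length G S g))"
    using g by (intro subsetD[OF cspan_superset]) (auto simp: sphere_def)
  from action_span_sphere[OF this] sphere_carrier W(2) obtain F where
    "finite F" "F \<subseteq> sphere G S (word_length G S g)"
    "a (lam g) = (\<Sum>h\<in>F. tensor (lam h) (slice h \<one> (a (lam g))))"
    "\<forall>h. slice h \<one> (a (lam g)) \<in> W" "\<forall>h. h \<notin> F \<longrightarrow> slice h \<one> (a (lam g)) = 0"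
    by (rule tensor_lam_cspan_expansion)
  thus ?thesis using that by (simp add: w_def)
qed

lemma action_lam_expansion:
  assumes g: "g \<in> carrier G" and Y: "finite Y" "\<And>h. h \<notin> Y \<Longrightarrow> w h g = 0"
  shows "a (lam g) = (\<Sum>h\<in>Y. tensor (lam h) (w h g))"
proof -
  have bl: "tensor x 0 = 0" for x :: "'a bop" by (rule bounded_bilinear.zero_right[OF bounded_bilinear_tensor])
  from g obtain F where F: "finite F" "F \<subseteq> sphere G S (word_length G S g)"
    "a (lam g) = (\<Sum>h\<in>F. tensor (lam h) (w h g))" "\<forall>h. h \<notin> F \<longrightarrow> w h g = 0"
    by (rule w_support)
  have "(\<Sum>h\<in>F. tensor (lam h) (w h g)) = (\<Sum>h\<in>F\<union>Y. tensor (lam h) (w h g))"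
    by (rule sum.mono_neutral_left) (use F Y in \<open>auto simp: bl\<close>)
  also have "\<dots> = (\<Sum>h\<in>Y. tensor (lam h) (w h g))"
    by (rule sum.mono_neutral_right) (use F Y in \<open>auto simp: bl\<close>)
  finally show ?thesis using F(3) by simp
qed

text \<open>Generators are exactly the elements of length 1, and the action preserves length.\<close>
lemma w_zero_outside:
  assumes "g \<in> carrier G" "h \<in> S \<longleftrightarrow> g \<notin> S" shows "w h g = 0"
proof -
  from assms(1) obtain F where F: "finite F" "F \<subseteq> sphere G S (word_length G S g)"
    "a (lam g) = (\<Sum>h\<in>F. tensor (lam h) (w h g))" "\<forall>h. h \<notin> F \<longrightarrow> w h g = 0"
    by (rule w_support)
  have "h \<notin> sphere G S (word_length G S g)"
  proof
    assume h: "h \<in> sphere G S (word_length G S g)"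
    have "g \<in> sphere G S 1 \<longleftrightarrow> h \<in> sphere G S 1" using h assms(1) by (auto simp: sphere_def)
    thus False using assms(2) unfolding sphere_one by blast
  qed
  thus ?thesis using F by blast
qed

lemma action_generator:
  assumes "g \<in> S" shows "a (lam g) = (\<Sum>h\<in>S. tensor (lam h) (w h g))"
  by (rule action_lam_expansion) (use assms finite_S w_zero_outside in auto)

text \<open>The trace of \<open>(\<alpha> \<lambda>_g)* \<alpha> \<lambda>_g'\<close> is computed twice: by invariance it is that of \<open>\<lambda>_g* \<lambda>_g'\<close>, and by expansion
  only the diagonal terms contribute.\<close>
lemma w_isometry:
  assumes g: "g \<in> carrier G" "g' \<in> carrier G" and Y: "finite Y" "Y \<subseteq> carrier G"
    "\<And>h. h \<notin> Y \<Longrightarrow> w h g = 0" "\<And>h. h \<notin> Y \<Longrightarrow> w h g' = 0"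
  shows "(\<Sum>h\<in>Y. star (w h g) * w h g') = (if g = g' then e else 0)"
proof -
  have eqone: "inv x \<otimes> y = \<one> \<longleftrightarrow> y = x" if "x \<in> carrier G" "y \<in> carrier G" for x y
    using inv_solve_left[of \<one> x y] that by (auto simp: eq_commute[of \<one>])
  have E: "a (lam g) = (\<Sum>h\<in>Y. tensor (lam h) (w h g))" "a (lam g') = (\<Sum>h\<in>Y. tensor (lam h) (w h g'))"
    using Y by (intro action_lam_expansion g; simp)+
  have "star (a (lam g)) * a (lam g') = a (lam (inv g \<otimes> g'))"
    using g by (simp add: lam_in_group_algebra star_lam flip: action_star action_mult lam_mult)
  moreover have "slice \<one> \<one> (a (lam (inv g \<otimes> g'))) = cscale (if \<one> = inv g \<otimes> g' then 1 else 0) e"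
    using g by (subst trace_action) (auto simp: lam_in_group_algebra lam_entry)
  ultimately have "slice \<one> \<one> (star (a (lam g)) * a (lam g')) = cscale (if \<one> = inv g \<otimes> g' then 1 else 0) e"
    by simp
  hence 1: "slice \<one> \<one> (star (a (lam g)) * a (lam g')) = (if g = g' then e else 0)"
    using eqone[OF g] by auto
  have star_sum: "star (sum f I) = (\<Sum>i\<in>I. star (f i))" for f :: "'a \<Rightarrow> ('a \<times> 'i) bop" and I
    by (rule linear_sum[OF bounded_linear.linear[OF bounded_linear_star]])
  have "star (a (lam g)) * a (lam g') = (\<Sum>x\<in>Y. \<Sum>y\<in>Y. tensor (lam (inv x \<otimes> y)) (star (w x g) * w y g'))"
  proof -
    have "star (a (lam g)) = (\<Sum>x\<in>Y. tensor (lam (inv x)) (star (w x g)))"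
      unfolding E(1) star_sum
      by (rule sum.cong) (use Y(2) in \<open>auto simp: star_tensor star_lam\<close>)
    thus ?thesis
      unfolding E(2)
      by (simp only: sum_product) (intro sum.cong refl, use subsetD[OF Y(2)] in \<open>simp add: tensor_mult lam_mult\<close>)
  qed
  hence "slice \<one> \<one> (star (a (lam g)) * a (lam g')) = (\<Sum>x\<in>Y. \<Sum>y\<in>Y. slice \<one> \<one> (tensor (lam (inv x \<otimes> y)) (star (w x g) * w y g')))"
    by (simp only: slice_sum)
  also have "\<dots> = (\<Sum>x\<in>Y. \<Sum>y\<in>Y. if y = x then star (w x g) * w y g' else 0)"
    by (intro sum.cong refl) (use subsetD[OF Y(2)] eqone in \<open>simp add: slice_sum slice_tensor lam_entry eq_commute[of \<one>]\<close>)
  also have "\<dots> = (\<Sum>x\<in>Y. star (w x g) * w x g')"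
    using Y(1) by simp
  finally show ?thesis by (simp add: 1)
qed

end

context symmetric_unique_products
begin

lemma conv_if: "conv u z g h = (\<Sum>s\<in>S. \<Sum>t\<in>S. if s \<otimes> t = z then u s g * u t h else 0)"
proof -
  have "{(s, t). (s, t) \<in> S \<times> S \<and> s \<otimes> t = z} = {p \<in> S \<times> S. fst p \<otimes> snd p = z}" by auto
  hence "conv u z g h = (\<Sum>p\<in>{p \<in> S \<times> S. fst p \<otimes> snd p = z}. u (fst p) g * u (snd p) h)"
    by (simp add: conv_def case_prod_beta)
  also have "\<dots> = (\<Sum>p\<in>S \<times> S. if fst p \<otimes> snd p = z then u (fst p) g * u (snd p) h else 0)"
    by (rule sum.inter_filter) (simp add: finite_S)
  finally show ?thesis by (simp add: sum.cartesian_product case_prod_beta)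
qed

end

lemma star_sum: "star (sum f I) = (\<Sum>i\<in>I. star (f i))"
  by (rule linear_sum[OF bounded_linear.linear[OF bounded_linear_star]])

context qiso_action
begin

lemma w_product:
  assumes g: "g \<in> S" "g' \<in> S" shows "w z (g \<otimes> g') = conv w z g g'"
proof -
  have "a (lam (g \<otimes> g')) = a (lam g) * a (lam g')"
    using g by (simp add: lam_in_group_algebra flip: action_mult lam_mult)
  also have "\<dots> = (\<Sum>x\<in>S. \<Sum>y\<in>S. tensor (lam (x \<otimes> y)) (w x g * w y g'))"
    unfolding action_generator[OF g(1)] action_generator[OF g(2)] sum_product
    by (intro sum.cong refl) (simp add: tensor_mult lam_mult)
  finally have "w z (g \<otimes> g') = (\<Sum>x\<in>S. \<Sum>y\<in>S. slice z \<one> (tensor (lam (x \<otimes> y)) (w x g * w y g')))"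
    by (simp only: w_def slice_sum)
  also have "\<dots> = (\<Sum>x\<in>S. \<Sum>y\<in>S. if x \<otimes> y = z then w x g * w y g' else 0)"
    by (intro sum.cong refl) (simp add: slice_tensor lam_entry eq_commute[of z])
  finally show ?thesis by (simp only: conv_if)
qed

lemma w_one: "w z \<one> = (if z = \<one> then e else 0)"
  by (simp add: w_def action_one slice_tensor lam_entry)

lemma w_trace: "g \<in> carrier G \<Longrightarrow> w \<one> g = (if g = \<one> then e else 0)"
  by (auto simp: w_def trace_action lam_in_group_algebra lam_entry)

text \<open>Because \<open>\<lambda>_g* = \<lambda>_{inv g}\<close>, adjoints of coefficients are again coefficients. In particular their set is
  selfadjoint.\<close>
lemma star_w:
  assumes x: "x \<in> S" and g: "g \<in> S" shows "star (w x g) = w (inv x) (inv g)"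
proof -
  have "a (lam (inv g)) = star (a (lam g))"
    using g by (simp add: lam_in_group_algebra flip: action_star star_lam)
  also have "\<dots> = (\<Sum>h\<in>S. tensor (lam (inv h)) (star (w h g)))"
    unfolding action_generator[OF g] star_sum by (intro sum.cong refl) (simp add: star_tensor star_lam)
  finally have "w (inv x) (inv g) = (\<Sum>h\<in>S. slice (inv x) \<one> (tensor (lam (inv h)) (star (w h g))))"
    by (simp only: w_def slice_sum)
  also have "\<dots> = (\<Sum>h\<in>S. if h = x then star (w h g) else 0)"
  proof (intro sum.cong refl)
    fix h assume h: "h \<in> S"
    have "inv x = inv h \<longleftrightarrow> h = x" using inj_on_eq_iff[OF inv_inj S_mem S_mem, OF x h] by auto
    thus "slice (inv x) \<one> (tensor (lam (inv h)) (star (w h g))) = (if h = x then star (w h g) else 0)"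
      using h by (simp add: slice_tensor lam_entry)
  qed
  also have "\<dots> = star (w x g)" using x finite_S by simp
  finally show ?thesis by simp
qed

text \<open>Both sides are continuous in \<open>x\<close> by contractivity of the action, and they agree on the \<open>\<lambda>_g\<close>, since
  \<open>w h g = 0\<close> unless \<open>g\<close> is a generator.\<close>
lemma slice_action:
  assumes x: "x \<in> B" and h: "h \<in> S"
  shows "slice h \<one> (a x) = (\<Sum>g\<in>S. cscale (mat_of x g \<one>) (w h g))"
proof -
  define f where "f x = slice h \<one> (a x) - (\<Sum>g\<in>S. cscale (mat_of x g \<one>) (w h g))" for x
  have mat_add: "mat_of (x + y) i j = mat_of x i j + mat_of y i j" for x y :: "'a bop" and i j
    by transfer (simp add: op_add_def)
  have mat_scale: "mat_of (cscale c x) i j = c * mat_of x i j" for c and x :: "'a bop" and i j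
    by transfer (simp add: op_scale_def)
  have cs_add: "cscale (c + d) y = cscale c y + cscale d y" for c d and y :: "'i bop"
    by transfer (simp add: op_scale_def op_add_def distrib_right)
  have cs_sum: "cscale c (sum y I) = (\<Sum>i\<in>I. cscale c (y i))" for c and y :: "'a \<Rightarrow> 'i bop" and I
    by (rule linear_sum[OF bounded_linear.linear[OF bounded_linear_cscale]])
  have a0: "a 0 = 0" using action_cscale[of 0 0] csubspaceD(1)[OF B(2)] by simp
  have mat_0: "mat_of 0 i j = 0" for i j :: 'a by transfer (simp add: op_zero_def)
  have "continuous_on B f"
  proof -
    have c: "continuous_on B (\<lambda>x. cscale (mat_of x g \<one>) q)" for g and q :: "'i bop"
    proof -
      have "bounded_linear (\<lambda>c. cscale c q)"
      proof (rule bounded_linear_intro[where K = "norm q"])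
        show "cscale (c + d) q = cscale c q + cscale d q" for c d by (rule cs_add)
        show "cscale (r *\<^sub>R c) q = r *\<^sub>R cscale c q" for r c
          unfolding scaleR_conv_of_real[of r c] by (simp only: cscale_cscale[symmetric] cscale_of_real)
      qed simp
      from bounded_linear_compose[OF this bounded_linear_entry] show ?thesis
        by (rule linear_continuous_on)
    qed
    show ?thesis unfolding f_def
      by (intro continuous_intros c continuous_on_compose2[OF linear_continuous_on[OF bounded_linear_slice]
            star_hom_on_continuous[OF cstar_algebra_group_algebra action_star_hom]]) auto
  qed
  hence "closed {x \<in> B. f x = 0}"
    by (rule continuous_closed_preimage_constant[OF _ B(3)])
  moreover have "csubspace {x \<in> B. f x = 0}"
    using csubspaceD[OF B(2)]
    by (auto simp: csubspace_def f_def a0 action_add action_cscale slice_add slice_cscale mat_add mat_scale mat_0 cs_add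
        sum.distrib cs_sum cscale_cscale)
  moreover have "lam ` carrier G \<subseteq> {x \<in> B. f x = 0}"
  proof clarify
    fix g assume g: "g \<in> carrier G"
    have "(\<Sum>k\<in>S. cscale (mat_of (lam g) k \<one>) (w h k)) = (\<Sum>k\<in>S. if k = g then w h g else 0)"
      by (intro sum.cong refl) (use g in \<open>auto simp: lam_entry\<close>)
    also have "\<dots> = (if g \<in> S then w h g else 0)" using finite_S by simp
    also have "\<dots> = w h g" using w_zero_outside[OF g, of h] h by auto
    finally show "lam g \<in> B \<and> f (lam g) = 0"
      using g by (simp add: f_def w_def lam_in_group_algebra)
  qed
  ultimately have "B \<subseteq> {x \<in> B. f x = 0}"
    unfolding group_algebra_def by (intro closure_cspan_minimal) (simp_all add: group_algebra_def)
  thus ?thesis using x by (auto simp: f_def)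
qed

text \<open>Let \<open>p = w w*\<close> on the generators. As \<open>w\<close> is isometric, \<open>p w = w\<close>, so \<open>p\<close> fixes the vector of slices of every
  \<open>\<alpha> x (1 \<otimes> q)\<close>. These elements span a dense subspace by the density condition, and slices are
  continuous; hence \<open>p\<close> fixes the slices of \<open>\<lambda>_h \<otimes> e\<close>, which form the \<open>h\<close>-th unit vector.\<close>

lemma w_coisometry:
  assumes h: "h \<in> S" "h' \<in> S"
  shows "(\<Sum>g\<in>S. w h' g * star (w h g)) = (if h' = h then e else 0)"
proof -
  define p where "p k = (\<Sum>g\<in>S. w h' g * star (w k g))" for k
  have pe: "p k * e = p k" if "k \<in> S" for k
    unfolding p_def sum_distrib_right
    by (intro sum.cong refl) (use that S_inv in \<open>simp add: star_w w_unit mult.assoc\<close>)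
  let ?V = "{T. (\<Sum>k\<in>S. p k * slice k \<one> T) = slice h' \<one> T}"
  have V: "csubspace ?V"
    by (simp add: csubspace_def slice_add slice_cscale distrib_left cscale_mult_right sum.distrib
        flip: linear_sum[OF bounded_linear.linear[OF bounded_linear_cscale]])
  have Vc: "closed ?V"
    by (intro closed_Collect_eq continuous_intros linear_continuous_on bounded_linear_slice)
  have slice_mult: "slice k \<one> (T * tensor (lam \<one>) q) = slice k \<one> T * q" if "T \<in> tens B W" for k T q
  proof -
    let ?U = "{T. slice k \<one> (T * tensor (lam \<one>) q) = slice k \<one> T * q}"
    have "tens B W \<subseteq> ?U"
    proof (rule tens_minimal)
      show "csubspace ?U"
        by (simp add: csubspace_def slice_add slice_cscale distrib_right cscale_mult_left)
      show "closed ?U"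
        by (intro closed_Collect_eq continuous_intros linear_continuous_on bounded_linear_slice
            continuous_on_compose2[OF linear_continuous_on[OF bounded_linear_slice]]) auto
      show "tensor x y \<in> ?U" if "x \<in> B" "y \<in> W" for x y
        using that by (simp add: tensor_mult slice_tensor B cscale_mult_left)
    qed
    thus ?thesis using that by blast
  qed
  have base: "a x * tensor (lam \<one>) q \<in> ?V" if x: "x \<in> B" and q: "q \<in> W" for x q
  proof -
    have sl: "slice k \<one> (a x * tensor (lam \<one>) q) = (\<Sum>g\<in>S. w k g * cscale (mat_of x g \<one>) q)" if "k \<in> S" for k
      by (simp add: slice_mult[OF action_in[OF x]] slice_action[OF x that] sum_distrib_right cscale_mult_left cscale_mult_right)
    have iso: "(\<Sum>k\<in>S. star (w k g) * w k g') = (if g = g' then e else 0)" if "g \<in> S" "g' \<in> S" for g g'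
      by (rule w_isometry) (use that finite_S S_carrier w_zero_outside in auto)
    have "(\<Sum>k\<in>S. p k * (\<Sum>g\<in>S. w k g * cscale (mat_of x g \<one>) q))
      = (\<Sum>k\<in>S. \<Sum>g\<in>S. \<Sum>g'\<in>S. w h' g * (star (w k g) * w k g') * cscale (mat_of x g' \<one>) q)"
      unfolding p_def sum_product by (simp only: mult.assoc)
    also have "\<dots> = (\<Sum>g\<in>S. \<Sum>g'\<in>S. \<Sum>k\<in>S. w h' g * (star (w k g) * w k g') * cscale (mat_of x g' \<one>) q)"
      by (subst sum.swap) (rule sum.cong[OF refl sum.swap])
    also have "\<dots> = (\<Sum>g\<in>S. \<Sum>g'\<in>S. w h' g * (\<Sum>k\<in>S. star (w k g) * w k g') * cscale (mat_of x g' \<one>) q)"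
      by (simp only: sum_distrib_left sum_distrib_right)
    also have "\<dots> = (\<Sum>g\<in>S. \<Sum>g'\<in>S. if g' = g then w h' g * cscale (mat_of x g' \<one>) q else 0)"
      by (intro sum.cong refl) (auto simp: iso w_unit)
    also have "\<dots> = (\<Sum>g\<in>S. w h' g * cscale (mat_of x g \<one>) q)"
      using finite_S by simp
    finally show ?thesis using sl h by simp
  qed
  have "spatial_tensor (mat_of ` B) Q \<subseteq> op_closure (op_span
       {op_mult (\<alpha> b) (op_tensor (unit_of (mat_of ` B)) q) | b q. b \<in> mat_of ` B \<and> q \<in> Q})"
    using action unfolding cqg_action_def reduced_group_algebra_eq by blast
  moreover have "{op_mult (\<alpha> b) (op_tensor (unit_of (mat_of ` B)) q) | b q. b \<in> mat_of ` B \<and> q \<in> Q}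
     = mat_of ` {a x * tensor (lam \<one>) q | x q. x \<in> B \<and> q \<in> W}"
  proof -
    have *: "op_mult (\<alpha> (mat_of x)) (op_tensor (unit_of (mat_of ` B)) (mat_of q)) = mat_of (a x * tensor (lam \<one>) q)"
      if "x \<in> B" for x q
      using that by (simp add: action_eq unital_cstar_algebraI(2)[OF cstar_algebra_group_algebra] mat_of_simps)
    show ?thesis
    proof (intro equalityI subsetI)
      fix t assume "t \<in> {op_mult (\<alpha> b) (op_tensor (unit_of (mat_of ` B)) q) | b q. b \<in> mat_of ` B \<and> q \<in> Q}"
      then obtain x q where "t = op_mult (\<alpha> (mat_of x)) (op_tensor (unit_of (mat_of ` B)) (mat_of q))" "x \<in> B" "q \<in> W"
        unfolding Q_eq by blast
      thus "t \<in> mat_of ` {a x * tensor (lam \<one>) q | x q. x \<in> B \<and> q \<in> W}" using *[of x q] by blast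
    next
      fix t assume "t \<in> mat_of ` {a x * tensor (lam \<one>) q | x q. x \<in> B \<and> q \<in> W}"
      then obtain x q where "t = mat_of (a x * tensor (lam \<one>) q)" "x \<in> B" "q \<in> W" by blast
      thus "t \<in> {op_mult (\<alpha> b) (op_tensor (unit_of (mat_of ` B)) q) | b q. b \<in> mat_of ` B \<and> q \<in> Q}"
        using *[of x q] unfolding Q_eq by force
    qed
  qed
  ultimately have "tens B W \<subseteq> closure (cspan {a x * tensor (lam \<one>) q | x q. x \<in> B \<and> q \<in> W})"
    unfolding Q_eq spatial_tensor_eq by (simp add: op_closure_op_span_eq inj_image_subset_iff inj_on_def)
  also have "\<dots> \<subseteq> ?V"
    by (rule closure_cspan_minimal[OF _ V Vc]) (use base in blast)
  finally have "tensor (lam h) e \<in> ?V"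
    using tensor_in_tens[OF lam_in_group_algebra W(4), of h] h by auto
  moreover have sl: "slice k \<one> (tensor (lam h) e) = (if k = h then e else 0)" for k
    using h by (simp add: slice_tensor lam_entry)
  moreover have "(\<Sum>k\<in>S. p k * (if k = h then e else 0)) = p h"
  proof -
    have "(\<Sum>k\<in>S. p k * (if k = h then e else 0)) = (\<Sum>k\<in>S. if k = h then p h else 0)"
      by (intro sum.cong refl) (use h pe in auto)
    thus ?thesis using h finite_S by simp
  qed
  ultimately show ?thesis by (simp add: p_def)
qed

end

context qiso_action
begin

text \<open>The sum over the second coordinate collapses first, then the one over the first coordinate.\<close>
lemma tensor_square_coisometry:
  assumes "q \<in> S" "q' \<in> S" "p \<in> S" "p' \<in> S"
  shows "(\<Sum>r\<in>S \<times> S. w q (fst r) * w q' (snd r) * star (w p (fst r) * w p' (snd r)))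
    = (if q = p \<and> q' = p' then e else 0)"
proof -
  have "(\<Sum>r\<in>S \<times> S. w q (fst r) * w q' (snd r) * star (w p (fst r) * w p' (snd r)))
    = (\<Sum>s\<in>S. \<Sum>t\<in>S. w q s * (w q' t * star (w p' t)) * star (w p s))"
    by (simp add: sum.cartesian_product case_prod_beta star_mult mult.assoc)
  also have "\<dots> = (\<Sum>s\<in>S. w q s * (\<Sum>t\<in>S. w q' t * star (w p' t)) * star (w p s))"
    by (simp only: sum_distrib_left sum_distrib_right)
  also have "\<dots> = (\<Sum>s\<in>S. if q' = p' then w q s * star (w p s) else 0)"
    by (intro sum.cong refl) (simp add: w_coisometry assms w_unit)
  also have "\<dots> = (if q = p \<and> q' = p' then e else 0)"
    using w_coisometry[OF assms(3,1)] by (cases "q' = p'") auto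
  finally show ?thesis .
qed

text \<open>The coefficient matrix intertwines the multiplication of group elements. Since it is unitary,
  it also intertwines the adjoint of that map, which gives the relations for the transpose. In terms
  of coefficients: insert the isometry relation for the indices \<open>y\<close> and \<open>s t\<close> in place of the condition
  \<open>s t = y\<close>, expand \<open>w x (s t)\<close> as a product of two columns, and sum over \<open>s\<close> and \<open>t\<close> by coisometry.\<close>

lemma transposed_product:
  assumes p: "p \<in> S" "p' \<in> S" and y: "y = s' \<otimes> t'" "s' \<in> S" "t' \<in> S"
  shows "conv (\<lambda>s g. w g s) y p p' = w (p \<otimes> p') y"
proof -
  define Y where "Y = (\<lambda>r. fst r \<otimes> snd r) ` (S \<times> S)"
  have Y: "finite Y" "Y \<subseteq> carrier G" by (auto simp: Y_def finite_S)
  have outside: "w x (s \<otimes> t) = 0" if "x \<notin> Y" "s \<in> S" "t \<in> S" for x s t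
  proof -
    have "{(s, t). (s, t) \<in> S \<times> S \<and> s \<otimes> t = x} = {}" using that(1) by (force simp: Y_def)
    thus ?thesis by (simp only: w_product[OF that(2,3)] conv_def sum.empty)
  qed
  let ?Z = "\<lambda>x. {r \<in> S \<times> S. fst r \<otimes> snd r = x}"
  have conv_eq: "conv u x g h = (\<Sum>r\<in>?Z x. u (fst r) g * u (snd r) h)" for u :: "'a \<Rightarrow> 'a \<Rightarrow> 'i bop" and x g h
    unfolding conv_def by (rule sum.cong) auto
  let ?V = "\<lambda>r. star (w p (fst r) * w p' (snd r))"
  have eV: "e * ?V r = ?V r" if "r \<in> S \<times> S" for r
  proof -
    have "star (?V r) * e = star (?V r)"
      using that by (auto simp: mult.assoc w_unit)
    from arg_cong[OF this, of star] show ?thesis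
      by (simp add: star_mult cstar_algebra_unit_selfadjoint[OF W_cstar] mult.assoc)
  qed
  have yG: "y \<in> carrier G" using y by simp
  have iso: "(\<Sum>x\<in>Y. star (w x y) * w x (s \<otimes> t)) = (if y = s \<otimes> t then e else 0)" if "s \<in> S" "t \<in> S" for s t
    by (rule w_isometry) (use that y Y outside in auto)
  have inner: "(\<Sum>r\<in>S \<times> S. w x (fst r \<otimes> snd r) * ?V r)
      = (\<Sum>k\<in>?Z x. \<Sum>r\<in>S \<times> S. w (fst k) (fst r) * w (snd k) (snd r) * ?V r)" for x
  proof -
    have "(\<Sum>r\<in>S \<times> S. w x (fst r \<otimes> snd r) * ?V r)
      = (\<Sum>r\<in>S \<times> S. (\<Sum>k\<in>?Z x. w (fst k) (fst r) * w (snd k) (snd r)) * ?V r)"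
      by (intro sum.cong refl) (auto simp: w_product conv_eq)
    also have "\<dots> = (\<Sum>k\<in>?Z x. \<Sum>r\<in>S \<times> S. w (fst k) (fst r) * w (snd k) (snd r) * ?V r)"
      by (subst sum.swap) (simp only: sum_distrib_right)
    finally show ?thesis .
  qed
  have "star (conv (\<lambda>s g. w g s) y p p') = (\<Sum>r\<in>?Z y. ?V r)"
    by (simp only: conv_eq star_sum)
  also have "\<dots> = (\<Sum>r\<in>S \<times> S. if fst r \<otimes> snd r = y then ?V r else 0)"
    by (rule sum.inter_filter) (simp add: finite_S)
  also have "\<dots> = (\<Sum>r\<in>S \<times> S. (\<Sum>x\<in>Y. star (w x y) * w x (fst r \<otimes> snd r)) * ?V r)"
    by (intro sum.cong refl) (use iso eV in auto)
  also have "\<dots> = (\<Sum>r\<in>S \<times> S. \<Sum>x\<in>Y. star (w x y) * (w x (fst r \<otimes> snd r) * ?V r))"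
    by (simp only: sum_distrib_right mult.assoc)
  also have "\<dots> = (\<Sum>x\<in>Y. star (w x y) * (\<Sum>r\<in>S \<times> S. w x (fst r \<otimes> snd r) * ?V r))"
    by (subst sum.swap) (simp only: sum_distrib_left)
  also have "\<dots> = (\<Sum>x\<in>Y. star (w x y) * (\<Sum>k\<in>?Z x. \<Sum>r\<in>S \<times> S. w (fst k) (fst r) * w (snd k) (snd r) * ?V r))"
    by (simp only: inner)
  also have "\<dots> = (\<Sum>x\<in>Y. star (w x y) * (\<Sum>k\<in>?Z x. if k = (p, p') then e else 0))"
    by (intro sum.cong refl arg_cong2[where f = "(*)"])
       (use p in \<open>auto simp: tensor_square_coisometry prod_eq_iff\<close>)
  also have "\<dots> = (\<Sum>x\<in>Y. if x = p \<otimes> p' then star (w x y) else 0)"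
  proof (intro sum.cong refl)
    fix x
    have "finite (?Z x)" using finite_S by simp
    hence "(\<Sum>k\<in>?Z x. if k = (p, p') then e else 0) = (if x = p \<otimes> p' then e else 0)"
      using p by auto
    moreover have "star (w x y) * e = star (w x y)"
    proof -
      have "star (star (w x y) * e) = w x y"
        by (simp add: star_mult cstar_algebra_unit_selfadjoint[OF W_cstar] w_unit yG)
      thus ?thesis by (metis star_star)
    qed
    ultimately show "star (w x y) * (\<Sum>k\<in>?Z x. if k = (p, p') then e else 0)
       = (if x = p \<otimes> p' then star (w x y) else 0)" by (cases "x = p \<otimes> p'") auto
  qed
  also have "\<dots> = star (w (p \<otimes> p') y)"
  proof -
    have "p \<otimes> p' \<in> Y" unfolding Y_def using p by force
    thus ?thesis using Y(1) by simp
  qed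
  finally have "star (star (conv (\<lambda>s g. w g s) y p p')) = star (star (w (p \<otimes> p') y))" by (rule arg_cong)
  thus ?thesis by simp
qed

text \<open>Multiplicativity of the columns is that of \<open>\<alpha>\<close>, for the transpose it is the preceding lemma; the
  vanishing for inverse pairs is invariance of the unit and of the trace.\<close>
theorem w_commute:
  assumes "s \<in> S" "t \<in> S" "g \<in> S" "h \<in> S"
  shows "w s g * w t h = w t h * w s g"
proof (rule coefficients_commute[where u = w and e = e, OF _ _ star_w])
  show "multiplicative_columns w"
    unfolding multiplicative_columns_def
  proof (intro conjI ballI impI)
    fix s t g h assume S: "s \<in> S" "t \<in> S" "g \<in> S" "h \<in> S"
    show "conv w (s \<otimes> t) g h = conv w (s \<otimes> t) h g"
      using S m_comm[OF S_mem S_mem, OF S(3,4)] by (simp flip: w_product)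
  next
    fix s t g assume S: "s \<in> S" "t \<in> S" "g \<in> S" "s \<otimes> t \<noteq> \<one>"
    show "conv w (s \<otimes> t) g (inv g) = 0"
      using S by (simp add: S_inv w_one flip: w_product)
  qed
  show "multiplicative_columns (\<lambda>s g. w g s)"
    unfolding multiplicative_columns_def
  proof (intro conjI ballI impI)
    fix s t g h assume S: "s \<in> S" "t \<in> S" "g \<in> S" "h \<in> S"
    show "conv (\<lambda>s g. w g s) (s \<otimes> t) g h = conv (\<lambda>s g. w g s) (s \<otimes> t) h g"
      using m_comm[OF S_mem S_mem, OF S(3,4)]
      by (simp add: transposed_product[OF S(3,4) refl S(1,2)] transposed_product[OF S(4,3) refl S(1,2)])
  next
    fix s t g assume S: "s \<in> S" "t \<in> S" "g \<in> S" "s \<otimes> t \<noteq> \<one>"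
    show "conv (\<lambda>s g. w g s) (s \<otimes> t) g (inv g) = 0"
      using S by (simp add: transposed_product[OF S(3) S_inv[OF S(3)] refl S(1,2)] w_trace)
  qed
  show "e * w s g = w s g" if "s \<in> S" "g \<in> S" for s g
    using that by (simp add: w_unit)
  show "(\<Sum>s\<in>S. star (w s g) * w s g) = e" if "g \<in> S" for g
  proof -
    have "(\<Sum>s\<in>S. star (w s g) * w s g) = (if g = g then e else 0)"
      by (rule w_isometry) (use that finite_S S_carrier w_zero_outside in auto)
    thus ?thesis by simp
  qed
qed (use assms in auto)

end

section \<open>The quantum group generated by the coefficients\<close>

lemma star_hom_on_sum:
  assumes W: "cstar_algebra W u" and f: "star_hom_on W f" and x: "\<And>i. i \<in> I \<Longrightarrow> x i \<in> W"
  shows "f (sum x I) = (\<Sum>i\<in>I. f (x i))"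
  using x
proof (induction I rule: infinite_finite_induct)
  case (insert i I)
  have "sum x I \<in> W" using insert.prems by (intro csubspace_sum cstar_algebraD(2)[OF W]) auto
  thus ?case using insert f by (simp add: star_hom_on_def)
next
  case empty
  have "f (cscale 0 u) = cscale 0 (f u)" using f cstar_algebraD(4)[OF W] unfolding star_hom_on_def by blast
  thus ?case by simp
next
  case (infinite I)
  have "f (cscale 0 u) = cscale 0 (f u)" using f cstar_algebraD(4)[OF W] unfolding star_hom_on_def by blast
  thus ?case using infinite by simp
qed

lemma mat_of_sum: "mat_of (sum x I) i j = (\<Sum>k\<in>I. mat_of (x k) i j)"
  by (rule linear_sum[OF bounded_linear.linear[OF bounded_linear_entry]])

lemma mat_of_tensor: "mat_of (tensor x y) (i, k) (j, l) = mat_of x i j * mat_of y k l"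
  by (simp add: tensor.rep_eq op_tensor_def)

context qiso_action
begin

lemma group_algebra_cstar: "unital_cstar_algebra (reduced_group_algebra G)"
  and unit_group_algebra: "unit_of (reduced_group_algebra G) = mat_of (lam \<one>)"
  using unital_cstar_algebraI[OF cstar_algebra_group_algebra] by (simp_all add: reduced_group_algebra_eq)

lemma lam_in: "g \<in> carrier G \<Longrightarrow> mat_of (lam g) \<in> reduced_group_algebra G"
  by (simp add: reduced_group_algebra_eq lam_in_group_algebra)

lemma group_algebra_commutative: "commutative_on (reduced_group_algebra G)"
proof -
  have P: "x * y = y * x" if "x \<in> lam ` carrier G" "y \<in> lam ` carrier G" for x y
    using that m_comm by (auto simp: lam_mult)
  have "x * y = y * x" if "x \<in> B" "y \<in> B" for x y
    using that unfolding group_algebra_def by (rule commutative_on_closed_span[rotated]) (rule P)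
  thus ?thesis by (auto simp: commutative_on_def reduced_group_algebra_eq mat_of_simps)
qed

text \<open>Words in the generators exhaust the group, and the C*-algebra is the closed span of the group.\<close>
lemma group_algebra_generated:
  assumes C: "unital_cstar_subalgebra C (reduced_group_algebra G)" and s: "\<And>s. s \<in> S \<Longrightarrow> mat_of (lam s) \<in> C"
  shows "reduced_group_algebra G \<subseteq> C"
proof -
  obtain V where V: "C = mat_of ` V" "V \<subseteq> B" "cstar_algebra V (lam \<one>)"
    using C[unfolded reduced_group_algebra_eq] cstar_algebra_group_algebra by (rule unital_cstar_subalgebraE)
  note DV = cstar_algebraD[OF V(3)] star_algebraD(2)[OF cstar_algebraD(1)[OF V(3)]]
  have word: "foldr (\<otimes>) ws \<one> \<in> carrier G \<and> lam (foldr (\<otimes>) ws \<one>) \<in> V" if "set ws \<subseteq> S" for ws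
    using that
  proof (induction ws)
    case Nil
    show ?case using DV(4) by simp
  next
    case (Cons s' ws)
    have "lam s' \<in> V" using s[of s'] Cons.prems by (simp add: V(1))
    hence "lam s' * lam (foldr (\<otimes>) ws \<one>) \<in> V" using Cons by (intro DV(7)) auto
    thus ?case using Cons by (simp add: lam_mult)
  qed
  have "lam ` carrier G \<subseteq> V" using generating word by blast
  hence "B \<subseteq> V" unfolding group_algebra_def by (rule closure_cspan_minimal[OF _ DV(2,3)])
  thus ?thesis by (auto simp: reduced_group_algebra_eq V(1))
qed

text \<open>The coefficients of the generators. Those of longer words are polynomials in them.\<close>
definition K where "K = mat_of ` {w h g | h g. h \<in> S \<and> g \<in> S}"

definition Q0 where "Q0 = generated_subalgebra Q K"

lemma K_subset: "K \<subseteq> Q"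
  by (auto simp: K_def Q_eq intro!: w_in_W)

lemma Q0_subalgebra: "unital_cstar_subalgebra Q0 Q"
  unfolding Q0_def by (rule unital_cstar_subalgebra_generated[OF Q_cstar K_subset])

lemmas Q0_cstar = unital_cstar_subalgebraD(1)[OF Q0_subalgebra]
  and Q0_subset = unital_cstar_subalgebraD(2)[OF Q0_subalgebra]
  and unit_Q0 = unital_cstar_subalgebraD(3)[OF Q0_subalgebra]

lemma w_in_Q0: "h \<in> S \<Longrightarrow> g \<in> S \<Longrightarrow> mat_of (w h g) \<in> Q0"
  unfolding Q0_def by (rule subsetD[OF generated_subalgebra_superset]) (auto simp: K_def)

lemma star_w_in_Q0: "h \<in> S \<Longrightarrow> g \<in> S \<Longrightarrow> mat_of (star (w h g)) \<in> Q0"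
  by (simp add: star_w w_in_Q0 S_inv)

lemma Q0_least:
  assumes C: "unital_cstar_subalgebra C Q" and w: "\<And>h g. h \<in> S \<Longrightarrow> g \<in> S \<Longrightarrow> mat_of (w h g) \<in> C"
  shows "Q0 \<subseteq> C"
  unfolding Q0_def by (rule generated_subalgebra_minimal[OF C]) (use w in \<open>auto simp: K_def\<close>)

lemma Q0_minimal:
  assumes C: "unital_cstar_subalgebra C Q0" and w: "\<And>h g. h \<in> S \<Longrightarrow> g \<in> S \<Longrightarrow> mat_of (w h g) \<in> C"
  shows "Q0 \<subseteq> C"
  by (rule Q0_least[OF unital_cstar_subalgebra_trans[OF C Q0_subalgebra] w])

lemma Q0_commutative: "commutative_on Q0"
  unfolding commutative_on_def
proof (intro ballI)
  fix x y assume xy: "x \<in> Q0" "y \<in> Q0"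
  show "op_mult x y = op_mult y x"
  proof (rule commutative_generated_subalgebra[OF Q_cstar K_subset _ _ xy[unfolded Q0_def]])
    show "op_adj s \<in> K" if s: "s \<in> K" for s
    proof -
      obtain h g where "s = mat_of (w h g)" "h \<in> S" "g \<in> S" using s by (auto simp: K_def)
      thus ?thesis using S_inv by (auto simp: K_def mat_of_simps star_w)
    qed
    show "op_mult s t = op_mult t s" if "s \<in> K" "t \<in> K" for s t
      using that by (auto simp: K_def mat_of_simps w_commute)
  qed
qed

text \<open>Compare the coefficients of \<open>\<lambda>_h\<close> on both sides of the coassociativity of the action at \<open>\<lambda>_g\<close>.\<close>
lemma coproduct_w:
  assumes h: "h \<in> S" and g: "g \<in> S"
  shows "\<Delta> (mat_of (w h g)) = mat_of (\<Sum>k\<in>S. tensor (w h k) (w k g))"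
proof -
  note cB = cstar_algebra_group_algebra
  note cBW = cstar_algebra_tens[OF cB W_cstar] and cWW = cstar_algebra_tens[OF W_cstar W_cstar]
  obtain \<Phi> \<Psi> where hom: "is_hom_tensor (mat_of ` B) Q (spatial_tensor (mat_of ` B) Q) Q \<alpha> id \<Phi>"
      "is_hom_tensor (mat_of ` B) Q (mat_of ` B) (spatial_tensor Q Q) id \<Delta> \<Psi>"
    and coassoc: "\<And>b. b \<in> mat_of ` B \<Longrightarrow> op_assoc (\<Phi> (\<alpha> b)) = \<Psi> (\<alpha> b)"
    using action unfolding cqg_action_def reduced_group_algebra_eq by blast
  have \<Phi>: "unital_star_hom (mat_of ` tens B W) (mat_of ` tens (tens B W) W) \<Phi>"
    and \<Phi>_el: "\<And>x q. x \<in> B \<Longrightarrow> q \<in> W \<Longrightarrow> \<Phi> (mat_of (tensor x q)) = mat_of (tensor (a x) q)"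
    using hom(1) unfolding is_hom_tensor_def Q_eq spatial_tensor_eq by (auto simp: mat_of_simps[symmetric] action_eq)
  have \<Delta>: "unital_star_hom (mat_of ` W) (mat_of ` tens W W) \<Delta>"
    using cqg unfolding compact_quantum_group_def Q_eq spatial_tensor_eq by blast
  define d where "d = lower \<Delta>"
  note dh = unital_star_homE[OF \<Delta> W_cstar cWW, folded d_def]
  have \<Psi>: "unital_star_hom (mat_of ` tens B W) (mat_of ` tens B (tens W W)) \<Psi>"
    and \<Psi>_el: "\<And>x q. x \<in> B \<Longrightarrow> q \<in> W \<Longrightarrow> \<Psi> (mat_of (tensor x q)) = mat_of (tensor x (d q))"
    using hom(2) unfolding is_hom_tensor_def Q_eq spatial_tensor_eq by (auto simp: mat_of_simps[symmetric] dh(1))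
  define F where "F = lower \<Phi>"
  note Fh = unital_star_homE[OF \<Phi> cBW cstar_algebra_tens[OF cBW W_cstar], folded F_def]
  define P where "P = lower \<Psi>"
  note Ph = unital_star_homE[OF \<Psi> cBW cstar_algebra_tens[OF cB cWW], folded P_def]
  have F_el: "F (tensor x q) = tensor (a x) q" and P_el: "P (tensor x q) = tensor x (d q)" if "x \<in> B" "q \<in> W" for x q
    using \<Phi>_el[OF that] Fh(1)[OF tensor_in_tens[OF that]] \<Psi>_el[OF that] Ph(1)[OF tensor_in_tens[OF that]]
    by simp_all
  have lw: "lam k \<in> B" "w k g \<in> W" if "k \<in> S" for k
    using that g by (auto intro: lam_in_group_algebra w_in_W)
  have Fg: "F (a (lam g)) = (\<Sum>k\<in>S. tensor (a (lam k)) (w k g))"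
    unfolding action_generator[OF g]
    by (subst star_hom_on_sum[OF cBW Fh(3)]) (auto intro!: tensor_in_tens lw sum.cong simp: F_el lw)
  have Pg: "P (a (lam g)) = (\<Sum>k\<in>S. tensor (lam k) (d (w k g)))"
    unfolding action_generator[OF g]
    by (subst star_hom_on_sum[OF cBW Ph(3)]) (auto intro!: tensor_in_tens lw sum.cong simp: P_el lw)
  have lg: "lam g \<in> B" by (rule lw(1)[OF g])
  have eq: "op_assoc (mat_of (F (a (lam g)))) = mat_of (P (a (lam g)))"
    using coassoc[of "mat_of (lam g)"] lg action_in[OF lg] by (simp add: action_eq Fh(1) Ph(1))
  have "mat_of (d (w h g)) p q = mat_of (\<Sum>k\<in>S. tensor (w h k) (w k g)) p q" for p q
  proof -
    obtain i k j l where pq: "p = (i, k)" "q = (j, l)" by (cases p, cases q)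
    have "slice h \<one> (P (a (lam g))) = (\<Sum>k\<in>S. if k = h then d (w h g) else 0)"
      unfolding Pg slice_sum by (intro sum.cong refl) (auto simp: slice_tensor lam_entry)
    also have "\<dots> = d (w h g)" using h finite_S by simp
    finally have "mat_of (slice h \<one> (P (a (lam g)))) p q = mat_of (d (w h g)) p q" by simp
    hence "mat_of (d (w h g)) p q = mat_of (P (a (lam g))) (h, p) (\<one>, q)"
      by (simp add: slice.rep_eq)
    also have "\<dots> = mat_of (F (a (lam g))) ((h, i), k) ((\<one>, j), l)"
      unfolding eq[symmetric] by (simp add: op_assoc_def pq)
    also have "\<dots> = (\<Sum>m\<in>S. mat_of (w h m) i j * mat_of (w m g) k l)"
      by (simp add: Fg mat_of_sum mat_of_tensor w_def slice.rep_eq)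
    also have "\<dots> = mat_of (\<Sum>k\<in>S. tensor (w h k) (w k g)) p q"
      by (simp add: mat_of_sum mat_of_tensor pq)
    finally show ?thesis .
  qed
  hence "mat_of (d (w h g)) = mat_of (\<Sum>k\<in>S. tensor (w h k) (w k g))"
    by (intro ext)
  thus ?thesis using dh(1)[OF lw(2)[OF h]] by (simp only:)
qed

lemma tensor_sum_in_spatial_tensor:
  assumes "unital_cstar_algebra A" "unital_cstar_algebra C"
    and "\<And>k. k \<in> I \<Longrightarrow> mat_of (x k) \<in> A" "\<And>k. k \<in> I \<Longrightarrow> mat_of (y k) \<in> C"
  shows "mat_of (\<Sum>k\<in>I. tensor (x k) (y k)) \<in> spatial_tensor A C"
proof -
  obtain V u where V: "A = mat_of ` V" "unit_of A = mat_of u" "cstar_algebra V u"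
    using assms(1) by (rule unital_cstar_algebraE)
  obtain X' v where Z: "C = mat_of ` X'" "unit_of C = mat_of v" "cstar_algebra X' v"
    using assms(2) by (rule unital_cstar_algebraE)
  show ?thesis
    using assms(3,4) unfolding V(1) Z(1) spatial_tensor_eq
    by (auto intro!: csubspace_sum tensor_in_tens cstar_algebraD(2)[OF cstar_algebra_tens[OF V(3) Z(3)]])
qed

lemma Q0_tensor_subalgebra: "unital_cstar_subalgebra (spatial_tensor Q0 Q0) (spatial_tensor Q Q)"
  by (rule spatial_tensor_subalgebra[OF Q_cstar Q_cstar Q0_subalgebra Q0_subalgebra])

lemma coproduct_hom: "unital_star_hom Q (spatial_tensor Q Q) \<Delta>"
  using cqg by (simp add: compact_quantum_group_def)

text \<open>The elements with coproduct in \<open>Q0 \<otimes> Q0\<close> form a C*-algebra that contains the coefficients.\<close>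
lemma coproduct_Q0: "\<Delta> ` Q0 \<subseteq> spatial_tensor Q0 Q0"
proof -
  have "unital_cstar_subalgebra {x \<in> Q. \<Delta> x \<in> spatial_tensor Q0 Q0} Q"
    by (intro unital_cstar_subalgebra_preimage[OF Q_cstar _ coproduct_hom Q0_tensor_subalgebra]
        spatial_tensor_unital_cstar_algebra Q_cstar)
  hence "Q0 \<subseteq> {x \<in> Q. \<Delta> x \<in> spatial_tensor Q0 Q0}"
  proof (rule Q0_least)
    fix h g assume hg: "h \<in> S" "g \<in> S"
    have "mat_of (\<Sum>k\<in>S. tensor (w h k) (w k g)) \<in> spatial_tensor Q0 Q0"
      by (rule tensor_sum_in_spatial_tensor[OF Q0_cstar Q0_cstar]) (use hg w_in_Q0 in auto)
    thus "mat_of (w h g) \<in> {x \<in> Q. \<Delta> x \<in> spatial_tensor Q0 Q0}"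
      using w_in_Q0[OF hg] Q0_subset by (auto simp: coproduct_w[OF hg])
  qed
  thus ?thesis by blast
qed

lemma action_hom_op: "unital_star_hom (reduced_group_algebra G) (spatial_tensor (reduced_group_algebra G) Q) \<alpha>"
  using action by (simp add: cqg_action_def)

lemma group_algebra_Q0_subalgebra:
  "unital_cstar_subalgebra (spatial_tensor (reduced_group_algebra G) Q0) (spatial_tensor (reduced_group_algebra G) Q)"
  by (rule spatial_tensor_subalgebra[OF group_algebra_cstar Q_cstar unital_cstar_subalgebra_refl[OF group_algebra_cstar] Q0_subalgebra])

lemma action_Q0: "\<alpha> ` reduced_group_algebra G \<subseteq> spatial_tensor (reduced_group_algebra G) Q0"
proof -
  have "unital_cstar_subalgebra {x \<in> reduced_group_algebra G. \<alpha> x \<in> spatial_tensor (reduced_group_algebra G) Q0}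
     (reduced_group_algebra G)"
    by (intro unital_cstar_subalgebra_preimage[OF group_algebra_cstar _ action_hom_op group_algebra_Q0_subalgebra]
        spatial_tensor_unital_cstar_algebra Q_cstar group_algebra_cstar)
  hence "reduced_group_algebra G \<subseteq> {x \<in> reduced_group_algebra G. \<alpha> x \<in> spatial_tensor (reduced_group_algebra G) Q0}"
  proof (rule group_algebra_generated)
    fix s assume s: "s \<in> S"
    have "mat_of (\<Sum>h\<in>S. tensor (lam h) (w h s)) \<in> spatial_tensor (reduced_group_algebra G) Q0"
      by (rule tensor_sum_in_spatial_tensor[OF group_algebra_cstar Q0_cstar]) (use s in \<open>auto intro: lam_in w_in_Q0\<close>)
    thus "mat_of (lam s) \<in> {x \<in> reduced_group_algebra G. \<alpha> x \<in> spatial_tensor (reduced_group_algebra G) Q0}"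
      using s by (simp add: lam_in action_eq lam_in_group_algebra action_generator)
  qed
  thus ?thesis by blast
qed

end

context qiso_action
begin

lemma unit_Q0_eq: "unit_of Q0 = mat_of e"
  using unit_Q0 unit_Q by simp

lemma Q0_hom: "unital_star_hom Q0 (spatial_tensor Q0 Q0) \<Delta>"
  by (rule unital_star_hom_restrict[OF coproduct_hom Q0_subalgebra Q0_tensor_subalgebra coproduct_Q0])

lemma Q0_action_hom: "unital_star_hom (reduced_group_algebra G) (spatial_tensor (reduced_group_algebra G) Q0) \<alpha>"
  by (rule unital_star_hom_restrict[OF action_hom_op unital_cstar_subalgebra_refl[OF group_algebra_cstar]
        group_algebra_Q0_subalgebra action_Q0])

lemma e_w: "h \<in> S \<Longrightarrow> g \<in> S \<Longrightarrow> e * w h g = w h g" "h \<in> S \<Longrightarrow> g \<in> S \<Longrightarrow> w h g * e = w h g"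
  "h \<in> S \<Longrightarrow> g \<in> S \<Longrightarrow> e * star (w h g) = star (w h g)" "h \<in> S \<Longrightarrow> g \<in> S \<Longrightarrow> star (w h g) * e = star (w h g)"
  by (simp_all add: star_w S_inv w_unit)

lemma tensor_zero_right: "tensor x 0 = 0" and tensor_zero_left: "tensor 0 y = 0"
  by (rule bounded_bilinear.zero_right[OF bounded_bilinear_tensor] bounded_bilinear.zero_left[OF bounded_bilinear_tensor])+

text \<open>The coisometry relation recovers \<open>w h g' \<otimes> 1\<close> from coproducts; with the two analogous identities that
  follow, it supplies the density conditions.\<close>
lemma coproduct_first_leg:
  assumes "h \<in> S" "g' \<in> S"
  shows "(\<Sum>g\<in>S. (\<Sum>k\<in>S. tensor (w h k) (w k g)) * tensor e (star (w g' g))) = tensor (w h g') e"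
proof -
  have "(\<Sum>g\<in>S. (\<Sum>k\<in>S. tensor (w h k) (w k g)) * tensor e (star (w g' g)))
     = (\<Sum>k\<in>S. \<Sum>g\<in>S. tensor (w h k) (w k g * star (w g' g)))"
    unfolding sum_distrib_right
    by (subst sum.swap) (intro sum.cong refl, simp add: tensor_mult e_w assms)
  also have "\<dots> = (\<Sum>k\<in>S. tensor (w h k) (\<Sum>g\<in>S. w k g * star (w g' g)))"
    by (simp only: bounded_bilinear.sum_right[OF bounded_bilinear_tensor])
  also have "\<dots> = (\<Sum>k\<in>S. if k = g' then tensor (w h g') e else 0)"
    by (intro sum.cong refl) (simp add: w_coisometry assms tensor_zero_right)
  also have "\<dots> = tensor (w h g') e" using finite_S assms by simp
  finally show ?thesis .
qed

lemma coproduct_second_leg: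
  assumes "h' \<in> S" "g \<in> S"
  shows "(\<Sum>h\<in>S. (\<Sum>k\<in>S. tensor (w h k) (w k g)) * tensor (star (w h h')) e) = tensor e (w h' g)"
proof -
  have iso: "(\<Sum>h\<in>S. w h k * star (w h h')) = (if k = h' then e else 0)" if "k \<in> S" for k
  proof -
    have "(\<Sum>h\<in>S. w h k * star (w h h')) = (\<Sum>h\<in>S. star (w h h') * w h k)"
      by (intro sum.cong refl) (use that assms in \<open>simp add: star_w w_commute S_inv\<close>)
    also have "\<dots> = (if h' = k then e else 0)"
      by (rule w_isometry) (use that assms finite_S S_carrier w_zero_outside in auto)
    finally show ?thesis by auto
  qed
  have "(\<Sum>h\<in>S. (\<Sum>k\<in>S. tensor (w h k) (w k g)) * tensor (star (w h h')) e)
     = (\<Sum>k\<in>S. \<Sum>h\<in>S. tensor (w h k * star (w h h')) (w k g))"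
    unfolding sum_distrib_right
    by (subst sum.swap) (intro sum.cong refl, simp add: tensor_mult e_w assms)
  also have "\<dots> = (\<Sum>k\<in>S. tensor (\<Sum>h\<in>S. w h k * star (w h h')) (w k g))"
    by (simp only: bounded_bilinear.sum_left[OF bounded_bilinear_tensor])
  also have "\<dots> = (\<Sum>k\<in>S. if k = h' then tensor e (w h' g) else 0)"
    by (intro sum.cong refl) (simp add: iso tensor_zero_left)
  also have "\<dots> = tensor e (w h' g)" using finite_S assms by simp
  finally show ?thesis .
qed

lemma action_first_leg:
  assumes "h \<in> S"
  shows "(\<Sum>g\<in>S. a (lam g) * tensor (lam \<one>) (star (w h g))) = tensor (lam h) e"
proof -
  have "(\<Sum>g\<in>S. a (lam g) * tensor (lam \<one>) (star (w h g)))
     = (\<Sum>g\<in>S. \<Sum>k\<in>S. tensor (lam k) (w k g * star (w h g)))"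
    by (intro sum.cong refl) (simp add: action_generator sum_distrib_right tensor_mult lam_mult)
  also have "\<dots> = (\<Sum>k\<in>S. tensor (lam k) (\<Sum>g\<in>S. w k g * star (w h g)))"
    by (subst sum.swap) (simp only: bounded_bilinear.sum_right[OF bounded_bilinear_tensor])
  also have "\<dots> = (\<Sum>k\<in>S. if k = h then tensor (lam h) e else 0)"
    by (intro sum.cong refl) (simp add: w_coisometry assms tensor_zero_right)
  also have "\<dots> = tensor (lam h) e" using finite_S assms by simp
  finally show ?thesis .
qed

lemma compact_quantum_group_Q0: "compact_quantum_group Q0 \<Delta>"
  unfolding compact_quantum_group_def
proof (intro conjI)
  note QQ = spatial_tensor_unital_cstar_algebra(1)[OF Q_cstar Q_cstar]
  show "unital_cstar_algebra Q0" by (rule Q0_cstar)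
  show "unital_star_hom Q0 (spatial_tensor Q0 Q0) \<Delta>" by (rule Q0_hom)
  obtain \<Phi> \<Psi> where hom: "is_hom_tensor Q Q (spatial_tensor Q Q) Q \<Delta> id \<Phi>"
      "is_hom_tensor Q Q Q (spatial_tensor Q Q) id \<Delta> \<Psi>"
    and coassoc: "\<forall>a\<in>Q. op_assoc (\<Phi> (\<Delta> a)) = \<Psi> (\<Delta> a)"
    using cqg unfolding compact_quantum_group_def by blast
  have "is_hom_tensor Q0 Q0 (spatial_tensor Q0 Q0) Q0 \<Delta> id \<Phi>"
    by (rule is_hom_tensor_restrict[OF Q_cstar Q_cstar QQ Q_cstar hom(1) Q0_subalgebra Q0_subalgebra
          Q0_tensor_subalgebra Q0_subalgebra coproduct_Q0]) simp
  moreover have "is_hom_tensor Q0 Q0 Q0 (spatial_tensor Q0 Q0) id \<Delta> \<Psi>"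
    by (rule is_hom_tensor_restrict[OF Q_cstar Q_cstar Q_cstar QQ hom(2) Q0_subalgebra Q0_subalgebra
          Q0_subalgebra Q0_tensor_subalgebra _ coproduct_Q0]) simp
  ultimately show "\<exists>\<Phi> \<Psi>. is_hom_tensor Q0 Q0 (spatial_tensor Q0 Q0) Q0 \<Delta> id \<Phi> \<and>
      is_hom_tensor Q0 Q0 Q0 (spatial_tensor Q0 Q0) id \<Delta> \<Psi> \<and>
      (\<forall>a\<in>Q0. op_assoc (\<Phi> (\<Delta> a)) = \<Psi> (\<Delta> a))"
    using coassoc Q0_subset by blast
  show "spatial_tensor Q0 Q0 \<subseteq> op_closure (op_span
       {op_mult (\<Delta> a) (op_tensor (unit_of Q0) b) | a b. a \<in> Q0 \<and> b \<in> Q0})"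
  proof (rule spatial_tensor_subset_product_span[OF Q0_cstar Q0_commutative Q0_cstar Q0_commutative Q0_cstar Q0_hom
        Q0_cstar tensor_legs_hom(2)[OF Q0_cstar Q0_cstar]])
    fix E assume E: "unital_cstar_subalgebra E (spatial_tensor Q0 Q0)" "\<Delta> ` Q0 \<subseteq> E" "op_tensor (unit_of Q0) ` Q0 \<subseteq> E"
    note E_cstar = unital_cstar_subalgebraD(1)[OF E(1)]
    have "Q0 \<subseteq> {a \<in> Q0. op_tensor a (unit_of Q0) \<in> E}"
    proof (rule Q0_minimal)
      show "unital_cstar_subalgebra {a \<in> Q0. op_tensor a (unit_of Q0) \<in> E} Q0"
        by (rule unital_cstar_subalgebra_preimage[OF Q0_cstar _ tensor_legs_hom(1)[OF Q0_cstar Q0_cstar] E(1)])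
           (rule spatial_tensor_unital_cstar_algebra(1)[OF Q0_cstar Q0_cstar])
      fix h g' assume h: "h \<in> S" "g' \<in> S"
      have "mat_of (\<Sum>g\<in>S. (\<Sum>k\<in>S. tensor (w h k) (w k g)) * tensor e (star (w g' g))) \<in> E"
      proof (rule sum_in_unital_cstar_algebra[OF E_cstar])
        fix g assume g: "g \<in> S"
        have "\<Delta> (mat_of (w h g)) \<in> E" "op_tensor (unit_of Q0) (mat_of (star (w g' g))) \<in> E"
          using E(2,3) w_in_Q0[OF h(1) g] star_w_in_Q0[OF h(2) g] by blast+
        from unital_cstar_algebraD(1)[OF E_cstar this]
        show "mat_of ((\<Sum>k\<in>S. tensor (w h k) (w k g)) * tensor e (star (w g' g))) \<in> E"
          by (simp only: coproduct_w[OF h(1) g] unit_Q0_eq mat_of_simps)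
      qed
      thus "mat_of (w h g') \<in> {a \<in> Q0. op_tensor a (unit_of Q0) \<in> E}"
        by (simp add: coproduct_first_leg h w_in_Q0 unit_Q0_eq mat_of_simps)
    qed
    thus "(\<forall>a\<in>Q0. op_tensor a (unit_of Q0) \<in> E) \<and> (\<forall>b\<in>Q0. op_tensor (unit_of Q0) b \<in> E)"
      using E(3) by blast
  qed
  show "spatial_tensor Q0 Q0 \<subseteq> op_closure (op_span
       {op_mult (\<Delta> a) (op_tensor b (unit_of Q0)) | a b. a \<in> Q0 \<and> b \<in> Q0})"
  proof (rule spatial_tensor_subset_product_span[OF Q0_cstar Q0_commutative Q0_cstar Q0_commutative Q0_cstar Q0_hom
        Q0_cstar tensor_legs_hom(1)[OF Q0_cstar Q0_cstar]])
    fix E assume E: "unital_cstar_subalgebra E (spatial_tensor Q0 Q0)" "\<Delta> ` Q0 \<subseteq> E" "(\<lambda>a. op_tensor a (unit_of Q0)) ` Q0 \<subseteq> E"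
    note E_cstar = unital_cstar_subalgebraD(1)[OF E(1)]
    have "Q0 \<subseteq> {a \<in> Q0. op_tensor (unit_of Q0) a \<in> E}"
    proof (rule Q0_minimal)
      show "unital_cstar_subalgebra {a \<in> Q0. op_tensor (unit_of Q0) a \<in> E} Q0"
        by (rule unital_cstar_subalgebra_preimage[OF Q0_cstar _ tensor_legs_hom(2)[OF Q0_cstar Q0_cstar] E(1)])
           (rule spatial_tensor_unital_cstar_algebra(1)[OF Q0_cstar Q0_cstar])
      fix h' g assume h: "h' \<in> S" "g \<in> S"
      have "mat_of (\<Sum>h\<in>S. (\<Sum>k\<in>S. tensor (w h k) (w k g)) * tensor (star (w h h')) e) \<in> E"
      proof (rule sum_in_unital_cstar_algebra[OF E_cstar])
        fix h assume h'': "h \<in> S"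
        have "\<Delta> (mat_of (w h g)) \<in> E" "op_tensor (mat_of (star (w h h'))) (unit_of Q0) \<in> E"
          using E(2,3) w_in_Q0[OF h'' h(2)] star_w_in_Q0[OF h'' h(1)] by blast+
        from unital_cstar_algebraD(1)[OF E_cstar this]
        show "mat_of ((\<Sum>k\<in>S. tensor (w h k) (w k g)) * tensor (star (w h h')) e) \<in> E"
          by (simp only: coproduct_w[OF h'' h(2)] unit_Q0_eq mat_of_simps)
      qed
      thus "mat_of (w h' g) \<in> {a \<in> Q0. op_tensor (unit_of Q0) a \<in> E}"
        by (simp add: coproduct_second_leg h w_in_Q0 unit_Q0_eq mat_of_simps)
    qed
    thus "(\<forall>a\<in>Q0. op_tensor a (unit_of Q0) \<in> E) \<and> (\<forall>b\<in>Q0. op_tensor (unit_of Q0) b \<in> E)"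
      using E(3) by blast
  qed
qed

lemma cqg_action_Q0: "cqg_action (reduced_group_algebra G) Q0 \<Delta> \<alpha>"
  unfolding cqg_action_def
proof (intro conjI)
  let ?B = "reduced_group_algebra G"
  note B_refl = unital_cstar_subalgebra_refl[OF group_algebra_cstar]
  note QQ = spatial_tensor_unital_cstar_algebra(1)[OF Q_cstar Q_cstar]
    and BQ = spatial_tensor_unital_cstar_algebra(1)[OF group_algebra_cstar Q_cstar]
  show "unital_star_hom ?B (spatial_tensor ?B Q0) \<alpha>" by (rule Q0_action_hom)
  obtain \<Phi> \<Psi> where hom: "is_hom_tensor ?B Q (spatial_tensor ?B Q) Q \<alpha> id \<Phi>"
      "is_hom_tensor ?B Q ?B (spatial_tensor Q Q) id \<Delta> \<Psi>"
    and coassoc: "\<forall>b\<in>?B. op_assoc (\<Phi> (\<alpha> b)) = \<Psi> (\<alpha> b)"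
    using action unfolding cqg_action_def by blast
  have "is_hom_tensor ?B Q0 (spatial_tensor ?B Q0) Q0 \<alpha> id \<Phi>"
    by (rule is_hom_tensor_restrict[OF group_algebra_cstar Q_cstar BQ Q_cstar hom(1) B_refl Q0_subalgebra
          group_algebra_Q0_subalgebra Q0_subalgebra action_Q0]) simp
  moreover have "is_hom_tensor ?B Q0 ?B (spatial_tensor Q0 Q0) id \<Delta> \<Psi>"
    by (rule is_hom_tensor_restrict[OF group_algebra_cstar Q_cstar group_algebra_cstar QQ hom(2) B_refl Q0_subalgebra
          B_refl Q0_tensor_subalgebra _ coproduct_Q0]) simp
  ultimately show "\<exists>\<Phi> \<Psi>. is_hom_tensor ?B Q0 (spatial_tensor ?B Q0) Q0 \<alpha> id \<Phi> \<and>
      is_hom_tensor ?B Q0 ?B (spatial_tensor Q0 Q0) id \<Delta> \<Psi> \<and>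
      (\<forall>b\<in>?B. op_assoc (\<Phi> (\<alpha> b)) = \<Psi> (\<alpha> b))"
    using coassoc by blast
  show "spatial_tensor ?B Q0 \<subseteq> op_closure (op_span
       {op_mult (\<alpha> b) (op_tensor (unit_of ?B) q) | b q. b \<in> ?B \<and> q \<in> Q0})"
  proof (rule spatial_tensor_subset_product_span[OF group_algebra_cstar group_algebra_commutative
        Q0_cstar Q0_commutative group_algebra_cstar Q0_action_hom Q0_cstar tensor_legs_hom(2)[OF group_algebra_cstar Q0_cstar]])
    fix E assume E: "unital_cstar_subalgebra E (spatial_tensor ?B Q0)" "\<alpha> ` ?B \<subseteq> E" "op_tensor (unit_of ?B) ` Q0 \<subseteq> E"
    note E_cstar = unital_cstar_subalgebraD(1)[OF E(1)]
    have "?B \<subseteq> {b \<in> ?B. op_tensor b (unit_of Q0) \<in> E}"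
    proof (rule group_algebra_generated)
      show "unital_cstar_subalgebra {b \<in> ?B. op_tensor b (unit_of Q0) \<in> E} ?B"
        by (rule unital_cstar_subalgebra_preimage[OF group_algebra_cstar _ tensor_legs_hom(1)[OF group_algebra_cstar Q0_cstar] E(1)])
           (rule spatial_tensor_unital_cstar_algebra(1)[OF group_algebra_cstar Q0_cstar])
      fix h assume h: "h \<in> S"
      have "mat_of (\<Sum>g\<in>S. a (lam g) * tensor (lam \<one>) (star (w h g))) \<in> E"
      proof (rule sum_in_unital_cstar_algebra[OF E_cstar])
        fix g assume g: "g \<in> S"
        have "\<alpha> (mat_of (lam g)) \<in> E" "op_tensor (unit_of ?B) (mat_of (star (w h g))) \<in> E"
          using E(2,3) lam_in[OF S_mem[OF g]] star_w_in_Q0[OF h g] by blast+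
        from unital_cstar_algebraD(1)[OF E_cstar this]
        show "mat_of (a (lam g) * tensor (lam \<one>) (star (w h g))) \<in> E"
          by (simp only: action_eq[OF lam_in_group_algebra[OF S_mem[OF g]]] unit_group_algebra mat_of_simps)
      qed
      thus "mat_of (lam h) \<in> {b \<in> ?B. op_tensor b (unit_of Q0) \<in> E}"
        using h by (simp add: action_first_leg lam_in unit_Q0_eq mat_of_simps)
    qed
    thus "(\<forall>a\<in>?B. op_tensor a (unit_of Q0) \<in> E) \<and> (\<forall>b\<in>Q0. op_tensor (unit_of ?B) b \<in> E)"
      using E(3) by blast
  qed
qed

text \<open>Only the invariance of the spheres is left. The coefficients of an element of the group algebra
  tensor \<open>Q0\<close> lie in \<open>Q0\<close>, because they are slices.\<close>
theorem qiso_object_Q0: "qiso_object G S Q0 \<Delta> \<alpha>"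
  unfolding qiso_object_def
proof (intro conjI allI ballI)
  show "compact_quantum_group Q0 \<Delta>" by (rule compact_quantum_group_Q0)
  show "cqg_action (reduced_group_algebra G) Q0 \<Delta> \<alpha>" by (rule cqg_action_Q0)
  show "op_slice \<one> (\<alpha> b) = op_scale (canonical_trace G b) (unit_of Q0)" if "b \<in> reduced_group_algebra G" for b
    using trace_preserving[OF that] by (simp only: unit_Q0)
  fix r
  have "unital_cstar_subalgebra Q0 (mat_of ` W)"
    by (simp only: Q_eq[symmetric] Q0_subalgebra)
  then obtain V where V: "Q0 = mat_of ` V" "V \<subseteq> W" "cstar_algebra V e"
    using W_cstar by (rule unital_cstar_subalgebraE)
  note DV = cstar_algebraD[OF V(3)]
  have "a x \<in> cspan {tensor (lam h) q | h q. h \<in> sphere G S r \<and> q \<in> V}" if x: "x \<in> cspan (lam ` sphere G S r)" for x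
  proof -
    have "cspan (lam ` sphere G S r) \<subseteq> B"
      using sphere_carrier by (intro cspan_minimal B(2)) (auto intro: lam_in_group_algebra)
    hence xB: "x \<in> B" using x by blast
    have "\<alpha> (mat_of x) \<in> spatial_tensor (reduced_group_algebra G) Q0"
      using action_Q0 xB by (auto simp: reduced_group_algebra_eq)
    hence "a x \<in> tens B V"
      unfolding reduced_group_algebra_eq V(1) spatial_tensor_eq action_eq[OF xB] by simp
    hence sl: "slice h \<one> (a x) \<in> V" for h by (rule slice_in_second_leg[OF _ DV(2,3)])
    from action_span_sphere[OF x] sphere_carrier W(2) obtain F where F: "finite F" "F \<subseteq> sphere G S r"
      "a x = (\<Sum>h\<in>F. tensor (lam h) (slice h \<one> (a x)))"
      "\<forall>h. slice h \<one> (a x) \<in> W" "\<forall>h. h \<notin> F \<longrightarrow> slice h \<one> (a x) = 0"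
      by (rule tensor_lam_cspan_expansion)
    have "(\<Sum>h\<in>F. tensor (lam h) (slice h \<one> (a x))) \<in> cspan {tensor (lam h) q | h q. h \<in> sphere G S r \<and> q \<in> V}"
      by (intro csubspace_sum csubspace_cspan subsetD[OF cspan_superset]) (use F(2) sl in blast)
    thus ?thesis using F(3) by simp
  qed
  hence "\<alpha> ` mat_of ` cspan (lam ` sphere G S r) \<subseteq> mat_of ` cspan {tensor (lam h) q | h q. h \<in> sphere G S r \<and> q \<in> V}"
  proof -
    assume *: "\<And>x. x \<in> cspan (lam ` sphere G S r) \<Longrightarrow> a x \<in> cspan {tensor (lam h) q | h q. h \<in> sphere G S r \<and> q \<in> V}"
    have "cspan (lam ` sphere G S r) \<subseteq> B"
      using sphere_carrier by (intro cspan_minimal B(2)) (auto intro: lam_in_group_algebra)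
    thus ?thesis using * by (auto simp: action_eq subset_iff)
  qed
  thus "\<alpha> ` op_span (regular_op G ` sphere G S r) \<subseteq>
     op_span {op_tensor (regular_op G h) q | h q. h \<in> sphere G S r \<and> q \<in> Q0}"
    unfolding V(1) regular_op_image[OF sphere_carrier] tensor_regular_op_image[OF sphere_carrier] op_span_eq_cspan .
qed

text \<open>Universality gives a morphism from Q to the subalgebra generated by the coefficients; followed
  by the inclusion it is an endomorphism of Q, which the uniqueness clause identifies with the
  identity.\<close>

theorem Q_generated_by_coefficients:
  assumes univ: "is_quantum_isometry_group G S Q \<Delta> \<alpha>"
  shows "Q = Q0"
proof -
  let ?B = "reduced_group_algebra G"
  have ex: "\<exists>\<phi>. qiso_morphism G Q \<Delta> \<alpha> Q' \<Delta>' \<alpha>' \<phi> \<and>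
      (\<forall>\<psi>. qiso_morphism G Q \<Delta> \<alpha> Q' \<Delta>' \<alpha>' \<psi> \<longrightarrow> (\<forall>a\<in>Q. \<psi> a = \<phi> a))"
    if "qiso_object G S Q' \<Delta>' \<alpha>'" for Q' :: "'i op set" and \<Delta>' \<alpha>'
    using univ that unfolding is_quantum_isometry_group_def by blast
  obtain \<phi> where \<phi>: "qiso_morphism G Q \<Delta> \<alpha> Q0 \<Delta> \<alpha> \<phi>" using ex[OF qiso_object_Q0] by blast
  obtain \<phi>\<^sub>1 where unique: "\<And>\<psi> a. qiso_morphism G Q \<Delta> \<alpha> Q \<Delta> \<alpha> \<psi> \<Longrightarrow> a \<in> Q \<Longrightarrow> \<psi> a = \<phi>\<^sub>1 a"
    using ex[OF object] by blast
  have "qiso_morphism G Q \<Delta> \<alpha> Q \<Delta> \<alpha> \<phi>"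
  proof -
    obtain \<Phi> \<Psi> where h: "unital_star_hom Q Q0 \<phi>" "is_hom_tensor Q Q Q0 Q0 \<phi> \<phi> \<Phi>" "\<forall>a\<in>Q. \<Phi> (\<Delta> a) = \<Delta> (\<phi> a)"
      "is_hom_tensor ?B Q ?B Q0 id \<phi> \<Psi>" "\<forall>b\<in>?B. \<Psi> (\<alpha> b) = \<alpha> b"
      using \<phi> unfolding qiso_morphism_def cqg_morphism_def by blast
    have "unital_star_hom Q Q \<phi>" by (rule unital_star_hom_enlarge[OF h(1) Q0_subalgebra])
    moreover have "is_hom_tensor Q Q Q Q \<phi> \<phi> \<Phi>"
      by (rule is_hom_tensor_enlarge[OF h(2) Q_cstar Q_cstar Q0_subalgebra Q0_subalgebra])
    moreover have "is_hom_tensor ?B Q ?B Q id \<phi> \<Psi>"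
      by (rule is_hom_tensor_enlarge[OF h(4) group_algebra_cstar Q_cstar
            unital_cstar_subalgebra_refl[OF group_algebra_cstar] Q0_subalgebra])
    ultimately show ?thesis
      using h(3,5) unfolding qiso_morphism_def cqg_morphism_def by blast
  qed
  moreover have "qiso_morphism G Q \<Delta> \<alpha> Q \<Delta> \<alpha> id"
  proof -
    have "is_hom_tensor Q Q Q Q id id id" "is_hom_tensor ?B Q ?B Q id id id" "unital_star_hom Q Q id"
      by (simp_all add: is_hom_tensor_def unital_star_hom_def)
    thus ?thesis unfolding qiso_morphism_def cqg_morphism_def by (metis id_apply)
  qed
  ultimately have "\<phi> x = x" if "x \<in> Q" for x using unique that by (metis id_apply)
  moreover have "\<phi> x \<in> Q0" if "x \<in> Q" for x
    using \<phi> that by (auto simp: qiso_morphism_def cqg_morphism_def unital_star_hom_def)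
  ultimately show ?thesis using Q0_subset by force
qed

end

section \<open>Commutativity and the abelianization\<close>

text \<open>The coefficients commute, and they generate the algebra by universality.\<close>

theorem (in symmetric_unique_products) quantum_isometry_group_commutative:
  assumes generating: "\<And>g. g \<in> carrier G \<Longrightarrow> \<exists>ws. set ws \<subseteq> S \<and> foldr (\<otimes>) ws \<one> = g"
    and Q: "is_quantum_isometry_group G S Q \<Delta> \<alpha>"
  shows "commutative_on Q"
proof -
  have obj: "qiso_object G S Q \<Delta> \<alpha>" using Q by (simp add: is_quantum_isometry_group_def)
  hence "unital_cstar_algebra Q" by (simp add: qiso_object_def compact_quantum_group_def)
  then obtain W e where W: "Q = mat_of ` W" "unit_of Q = mat_of e" "cstar_algebra W e"
    by (rule unital_cstar_algebraE)
  interpret qiso_action G S Q \<Delta> \<alpha> W e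
    by unfold_locales (use generating obj W in auto)
  show ?thesis using Q0_commutative Q_generated_by_coefficients[OF Q] by simp
qed

text \<open>In a commutative algebra the zero ideal contains all commutators, so the kernel of \<open>\<pi>\<close> is zero.\<close>
lemma abelianization_of_commutative:
  assumes Q: "unital_cstar_algebra Q" "commutative_on Q" and R: "is_abelianization Q \<Delta> R \<Delta>' \<pi>"
  shows "cqg_isomorphic Q \<Delta> R \<Delta>'"
proof -
  obtain W u where W: "Q = mat_of ` W" "unit_of Q = mat_of u" "cstar_algebra W u"
    using Q(1) by (rule unital_cstar_algebraE)
  have \<pi>: "cqg_morphism Q \<Delta> R \<Delta>' \<pi>" "\<pi> ` Q = R" "{a \<in> Q. \<pi> a = op_zero} = commutator_ideal Q"
    using R by (auto simp: is_abelianization_def)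
  have zero: "op_zero = mat_of 0" by (simp only: mat_of_simps)
  have zeroQ: "op_zero \<in> Q" using csubspaceD(1)[OF cstar_algebraD(2)[OF W(3)]] by (simp add: W(1) zero)
  have "commutator_ideal Q \<subseteq> {op_zero}"
    unfolding commutator_ideal_def
  proof (rule Inter_lower, intro CollectI conjI ballI)
    show "closed_ideal Q {op_zero}"
      unfolding closed_ideal_def
    proof (intro conjI)
      have "op_closure (mat_of ` {0}) = mat_of ` closure {0 :: 'a bop}" by (rule op_closure_eq_closure)
      thus "op_closure {op_zero} \<subseteq> {op_zero :: 'a op}" by (simp add: zero)
    qed (use zeroQ in \<open>auto simp: W(1) zero mat_of_simps\<close>)
    show "op_diff (op_mult a b) (op_mult b a) \<in> {op_zero}" if "a \<in> Q" "b \<in> Q" for a b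
      using commutative_onD[OF Q(2) that] by (simp add: op_diff_def op_zero_def)
  qed
  hence ker: "a = op_zero" if "a \<in> Q" "\<pi> a = op_zero" for a using that \<pi>(3) by blast
  have hom: "unital_star_hom Q R \<pi>" using \<pi>(1) by (simp add: cqg_morphism_def)
  have "inj_on \<pi> Q"
  proof (rule inj_onI)
    fix x y assume xy: "x \<in> Q" "y \<in> Q" "\<pi> x = \<pi> y"
    let ?z = "op_add x (op_scale (- 1) y)"
    have yQ: "op_scale (- 1) y \<in> Q" using Q(1) xy by (simp add: unital_cstar_algebra_def)
    have zQ: "?z \<in> Q" using Q(1) xy yQ by (simp add: unital_cstar_algebra_def)
    have "\<pi> ?z = op_add (\<pi> x) (op_scale (- 1) (\<pi> y))"
      using unital_star_homD(5)[OF hom xy(1) yQ] unital_star_homD(6)[OF hom xy(2)] by simp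
    hence "\<pi> ?z = op_zero" by (simp add: xy(3) op_add_def op_scale_def op_zero_def)
    from ker[OF zQ this] show "x = y" by (simp add: op_add_def op_scale_def op_zero_def fun_eq_iff)
  qed
  thus ?thesis unfolding cqg_isomorphic_def using \<pi>(1,2) by (auto simp: bij_betw_def)
qed

section \<open>Powers of a cyclic group\<close>

text \<open>The modulus 0 stands for the infinite cyclic group, because reduction modulo 0 is the identity.\<close>

lemma cyclic_group_eq_integer_mod_group:
  assumes "n \<ge> 3" "n \<noteq> 4"
  obtains m where "cyclic_group n = integer_mod_group m" "m = 0 \<or> m = 3 \<or> m \<ge> 5"
proof (cases n)
  case (enat m)
  have "m \<ge> 3" "m \<noteq> 4" using assms by (auto simp: enat numeral_eq_enat)
  thus ?thesis using that[of m] by (force simp: Defs.cyclic_group_def enat)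
next
  case infinity
  thus ?thesis using that[of 0] by (simp add: Defs.cyclic_group_def integer_mod_group_def)
qed

locale cyclic_power_generators =
  fixes k m :: nat and n :: enat
  assumes cyclic: "cyclic_group n = integer_mod_group m" and modulus: "m = 0 \<or> m = 3 \<or> m \<ge> 5"
begin

abbreviation "\<Gamma> \<equiv> cyclic_power k n"

text \<open>Elements of the group are represented by integer vectors, to be reduced modulo \<open>m\<close>.\<close>
definition residues_of :: "(nat \<Rightarrow> int) \<Rightarrow> nat \<Rightarrow> int" where
  "residues_of f = (\<lambda>i\<in>{..<k}. f i mod int m)"

text \<open>The \<open>i\<close>-th standard generator for \<open>\<epsilon> = 1\<close>, and its inverse for \<open>\<epsilon> = - 1\<close>.\<close>
definition gen :: "int \<Rightarrow> nat \<Rightarrow> nat \<Rightarrow> int" where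
  "gen \<epsilon> i = residues_of (\<lambda>j. if j = i then \<epsilon> else 0)"

lemma comm_group_\<Gamma>: "comm_group \<Gamma>"
proof (rule group.group_comm_groupI)
  show "group \<Gamma>" by (simp add: cyclic_power_def cyclic)
qed (simp add: cyclic_power_def cyclic add.commute)

lemma residues_in_carrier: "residues_of f \<in> carrier \<Gamma>"
  using modulus by (auto simp: cyclic_power_def cyclic residues_of_def carrier_integer_mod_group)

lemma residues_mult: "residues_of f \<otimes>\<^bsub>\<Gamma>\<^esub> residues_of g = residues_of (\<lambda>i. f i + g i)"
  by (auto simp: cyclic_power_def cyclic residues_of_def fun_eq_iff mod_add_eq)

lemma residues_one: "\<one>\<^bsub>\<Gamma>\<^esub> = residues_of (\<lambda>_. 0)"
  by (auto simp: cyclic_power_def cyclic residues_of_def fun_eq_iff)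

lemma residues_inv: "inv\<^bsub>\<Gamma>\<^esub> residues_of f = residues_of (\<lambda>i. - f i)"
proof -
  interpret comm_group \<Gamma> by (rule comm_group_\<Gamma>)
  show ?thesis
    by (rule inv_equality) (simp_all add: residues_mult residues_one residues_in_carrier)
qed

lemma residues_eqD: "residues_of f = residues_of g \<Longrightarrow> i < k \<Longrightarrow> f i mod int m = g i mod int m"
  by (auto simp: residues_of_def fun_eq_iff split: if_splits dest: spec[of _ i])

lemma carrier_residues: "g \<in> carrier \<Gamma> \<Longrightarrow> g = residues_of g"
  by (auto simp: cyclic_power_def cyclic residues_of_def carrier_integer_mod_group PiE_def Pi_iff extensional_def
      fun_eq_iff split: if_splits)

lemma standard_generators_eq: "standard_generators k n = gen 1 ` {..<k} \<union> gen (- 1) ` {..<k}"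
proof -
  have 1: "standard_generator k i = gen 1 i" for i
    using modulus by (auto simp: standard_generator_def gen_def residues_of_def fun_eq_iff)
  have 2: "inv\<^bsub>\<Gamma>\<^esub> (gen 1 i) = gen (- 1) i" for i
    unfolding gen_def residues_inv by (rule arg_cong[where f = residues_of]) auto
  show ?thesis unfolding standard_generators_def 1 2 by simp
qed

lemma standard_generatorE:
  assumes "s \<in> standard_generators k n"
  obtains \<epsilon> i where "s = gen \<epsilon> i" "i < k" "\<epsilon> = 1 \<or> \<epsilon> = - 1"
  using assms by (auto simp: standard_generators_eq)

lemma gen_in: "i < k \<Longrightarrow> \<epsilon> = 1 \<or> \<epsilon> = - 1 \<Longrightarrow> gen \<epsilon> i \<in> standard_generators k n"
  by (auto simp: standard_generators_eq)

text \<open>Signs are compared modulo m through the differences 1, 2 and 4, none of which m divides.\<close>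

lemma sign_residues:
  assumes x: "x = 1 \<or> x = - 1" and y: "y = 1 \<or> y = - 1" and z: "z = 1 \<or> z = - 1"
  shows "x mod int m \<noteq> 0 mod int m" "(x + x) mod int m \<noteq> 0 mod int m"
    "x mod int m = y mod int m \<Longrightarrow> x = y" "(x + y) mod int m = (z + z) mod int m \<Longrightarrow> x = z \<and> y = z"
proof -
  have nd: "\<not> int m dvd 1" "\<not> int m dvd 2" "\<not> int m dvd 4"
  proof -
    show "\<not> int m dvd 1" using modulus by auto
    show "\<not> int m dvd 2" using modulus zdvd_imp_le[of "int m" 2] by auto
    show "\<not> int m dvd 4" using modulus zdvd_imp_le[of "int m" 4] by auto
  qed
  hence nd': "\<not> int m dvd - 1" "\<not> int m dvd - 2" "\<not> int m dvd - 4" by (simp_all only: dvd_minus_iff) auto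
  show "x mod int m \<noteq> 0 mod int m" "(x + x) mod int m \<noteq> 0 mod int m"
    unfolding mod_eq_dvd_iff using x nd nd' by auto
  show "x = y" if "x mod int m = y mod int m"
    using that x y nd nd' unfolding mod_eq_dvd_iff by auto
  show "x = z \<and> y = z" if "(x + y) mod int m = (z + z) mod int m"
    using that x y z nd nd' unfolding mod_eq_dvd_iff by auto
qed

text \<open>A product of two generators is a vector with entries among 0, the signs, and twice the signs. Its
  support modulo \<open>m\<close> shows which coordinates are involved, and \<open>sign_residues\<close> recovers the signs. For
  \<open>m = 4\<close> the squares of a generator and of its inverse coincide.\<close>
lemma symmetric_unique_products_standard: "symmetric_unique_products \<Gamma> (standard_generators k n)"
proof -
  interpret comm_group \<Gamma> by (rule comm_group_\<Gamma>)
  show ?thesis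
  proof
    show "finite (standard_generators k n)" by (simp add: standard_generators_eq)
    show "standard_generators k n \<subseteq> carrier \<Gamma>"
      by (auto simp: standard_generators_eq gen_def residues_in_carrier)
    fix s assume "s \<in> standard_generators k n"
    then obtain \<epsilon> i where s: "s = gen \<epsilon> i" "i < k" "\<epsilon> = 1 \<or> \<epsilon> = - 1" by (rule standard_generatorE)
    have "inv\<^bsub>\<Gamma>\<^esub> s = gen (- \<epsilon>) i"
      unfolding s(1) gen_def residues_inv by (rule arg_cong[where f = residues_of]) auto
    thus "inv\<^bsub>\<Gamma>\<^esub> s \<in> standard_generators k n" using s by (auto intro!: gen_in)
    show "s \<otimes>\<^bsub>\<Gamma>\<^esub> s \<noteq> \<one>\<^bsub>\<Gamma>\<^esub>"
    proof
      assume "s \<otimes>\<^bsub>\<Gamma>\<^esub> s = \<one>\<^bsub>\<Gamma>\<^esub>"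
      from residues_eqD[OF this[unfolded s(1) gen_def residues_mult residues_one] s(2)]
      show False using sign_residues(2)[OF s(3) s(3) s(3)] by simp
    qed
    fix t p q assume "t \<in> standard_generators k n" "p \<in> standard_generators k n" "q \<in> standard_generators k n"
    then obtain \<delta> j \<epsilon>' i' \<delta>' j' where t: "t = gen \<delta> j" "j < k" "\<delta> = 1 \<or> \<delta> = - 1"
      and p: "p = gen \<epsilon>' i'" "i' < k" "\<epsilon>' = 1 \<or> \<epsilon>' = - 1" and q: "q = gen \<delta>' j'" "j' < k" "\<delta>' = 1 \<or> \<delta>' = - 1"
      by (elim standard_generatorE) blast
    assume ne: "s \<otimes>\<^bsub>\<Gamma>\<^esub> t \<noteq> \<one>\<^bsub>\<Gamma>\<^esub>" and eq: "p \<otimes>\<^bsub>\<Gamma>\<^esub> q = s \<otimes>\<^bsub>\<Gamma>\<^esub> t"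
    have not_inverse: "\<not> (i = j \<and> \<epsilon> + \<delta> = 0)"
    proof
      assume "i = j \<and> \<epsilon> + \<delta> = 0"
      hence "s \<otimes>\<^bsub>\<Gamma>\<^esub> t = \<one>\<^bsub>\<Gamma>\<^esub>"
        unfolding s(1) t(1) gen_def residues_mult residues_one by (intro arg_cong[where f = residues_of]) auto
      thus False using ne by simp
    qed
    have comp: "((if l = i' then \<epsilon>' else 0) + (if l = j' then \<delta>' else 0)) mod int m
       = ((if l = i then \<epsilon> else 0) + (if l = j then \<delta> else 0)) mod int m" if "l < k" for l
      using residues_eqD[OF eq[unfolded s(1) t(1) p(1) q(1) gen_def residues_mult] that] .
    note at_i = comp[OF s(2)] and at_j = comp[OF t(2)] and at_i' = comp[OF p(2)] and at_j' = comp[OF q(2)]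
    note nz_\<epsilon> = sign_residues(1)[OF s(3) s(3) s(3)] and nz_\<delta> = sign_residues(1)[OF t(3) t(3) t(3)]
      and nz_\<epsilon>' = sign_residues(1)[OF p(3) p(3) p(3)] and nz_\<delta>' = sign_residues(1)[OF q(3) q(3) q(3)]
    have "i' = i \<and> \<epsilon>' = \<epsilon> \<and> j' = j \<and> \<delta>' = \<delta> \<or> i' = j \<and> \<epsilon>' = \<delta> \<and> j' = i \<and> \<delta>' = \<epsilon>"
    proof (cases "i = j")
      case True
      have \<delta>: "\<delta> = \<epsilon>" using True not_inverse s(3) t(3) by auto
      note nz2 = sign_residues(2)[OF s(3) s(3) s(3)]
      have "i' = i"
      proof (rule ccontr)
        assume "i' \<noteq> i"
        thus False using at_i at_i' nz_\<epsilon>' nz2 True \<delta> by (cases "j' = i") auto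
      qed
      moreover have "j' = i"
      proof (rule ccontr)
        assume "j' \<noteq> i"
        thus False using at_i at_j' nz_\<delta>' nz2 True \<delta> by (cases "i' = i") auto
      qed
      moreover have "(\<epsilon>' + \<delta>') mod int m = (\<epsilon> + \<epsilon>) mod int m" using at_i calculation True \<delta> by simp
      ultimately show ?thesis using sign_residues(4)[OF p(3) q(3) s(3)] True \<delta> by blast
    next
      case False
      have ne': "i' \<noteq> j'"
      proof
        assume "i' = j'"
        thus False using at_i at_j nz_\<epsilon> nz_\<delta> False by (cases "i' = i") auto
      qed
      have i': "i' = i \<or> i' = j"
      proof (rule ccontr)
        assume "\<not> (i' = i \<or> i' = j)"
        thus False using at_i' nz_\<epsilon>' ne' by auto
      qed
      have j': "j' = i \<or> j' = j"
      proof (rule ccontr)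
        assume "\<not> (j' = i \<or> j' = j)"
        thus False using at_j' nz_\<delta>' ne' by auto
      qed
      show ?thesis
      proof (cases "i' = i")
        case True
        hence "j' = j" using j' ne' by auto
        have "\<epsilon>' mod int m = \<epsilon> mod int m" "\<delta>' mod int m = \<delta> mod int m"
          using at_i at_j True \<open>j' = j\<close> False by auto
        hence "\<epsilon>' = \<epsilon>" "\<delta>' = \<delta>" using sign_residues(3) s(3) t(3) p(3) q(3) by blast+
        thus ?thesis using True \<open>j' = j\<close> by blast
      next
        case i'_ne: False
        hence "i' = j" "j' = i" using i' j' ne' by auto
        have "\<epsilon>' mod int m = \<delta> mod int m" "\<delta>' mod int m = \<epsilon> mod int m"
          using at_i at_j \<open>i' = j\<close> \<open>j' = i\<close> False by auto
        hence "\<epsilon>' = \<delta>" "\<delta>' = \<epsilon>" using sign_residues(3) s(3) t(3) p(3) q(3) by blast+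
        thus ?thesis using \<open>i' = j\<close> \<open>j' = i\<close> by blast
      qed
    qed
    thus "p = s \<and> q = t \<or> p = t \<and> q = s" unfolding s(1) t(1) p(1) q(1) by auto
  qed
qed

text \<open>Splitting off one generator lowers the sum of the absolute values of the coordinates.\<close>
lemma residues_word:
  "\<exists>ws. set ws \<subseteq> standard_generators k n \<and> foldr (\<otimes>\<^bsub>\<Gamma>\<^esub>) ws \<one>\<^bsub>\<Gamma>\<^esub> = residues_of f"
proof (induction "\<Sum>i<k. nat \<bar>f i\<bar>" arbitrary: f rule: less_induct)
  case less
  show ?case
  proof (cases "\<forall>i<k. f i = 0")
    case True
    hence "residues_of f = \<one>\<^bsub>\<Gamma>\<^esub>" unfolding residues_one by (auto simp: residues_of_def fun_eq_iff)
    thus ?thesis by (intro exI[of _ "[]"]) simp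
  next
    case False
    then obtain i where i: "i < k" "f i \<noteq> 0" by blast
    define f' where "f' = f(i := f i - sgn (f i))"
    have "(\<Sum>j<k. nat \<bar>f' j\<bar>) < (\<Sum>j<k. nat \<bar>f j\<bar>)"
      by (rule sum_strict_mono_ex1) (use i in \<open>auto simp: f'_def sgn_if\<close>)
    from less[OF this] obtain ws where ws: "set ws \<subseteq> standard_generators k n"
      "foldr (\<otimes>\<^bsub>\<Gamma>\<^esub>) ws \<one>\<^bsub>\<Gamma>\<^esub> = residues_of f'" by blast
    have "gen (sgn (f i)) i \<otimes>\<^bsub>\<Gamma>\<^esub> residues_of f' = residues_of f"
      unfolding gen_def residues_mult by (rule arg_cong[where f = residues_of]) (auto simp: f'_def)
    moreover have "gen (sgn (f i)) i \<in> standard_generators k n"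
      using i by (intro gen_in) (auto simp: sgn_if)
    ultimately show ?thesis
      using ws by (intro exI[of _ "gen (sgn (f i)) i # ws"]) simp
  qed
qed

end

theorem theorem4p1:
  fixes k :: nat and n :: enat
    and Q :: "'i op set" and \<Delta> :: "'i op \<Rightarrow> ('i \<times> 'i) op"
    and \<alpha> :: "(nat \<Rightarrow> int) op \<Rightarrow> ((nat \<Rightarrow> int) \<times> 'i) op"
    and R :: "'j op set" and \<Delta>\<^sub>R :: "'j op \<Rightarrow> ('j \<times> 'j) op"
    and \<pi> :: "'i op \<Rightarrow> 'j op"
  assumes "k \<ge> 1" and "n \<ge> 3" and "n \<noteq> 4"
    and "infinite (UNIV :: 'i set)"
    and "is_quantum_isometry_group (cyclic_power k n) (standard_generators k n) Q \<Delta> \<alpha>"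
    and "is_abelianization Q \<Delta> R \<Delta>\<^sub>R \<pi>"
  shows "cqg_isomorphic Q \<Delta> R \<Delta>\<^sub>R"
proof -
  obtain m where m: "cyclic_group n = integer_mod_group m" "m = 0 \<or> m = 3 \<or> m \<ge> 5"
    using assms(2,3) by (rule cyclic_group_eq_integer_mod_group)
  interpret cyclic_power_generators k m n by unfold_locales (fact m)+
  interpret symmetric_unique_products \<Gamma> "standard_generators k n"
    by (rule symmetric_unique_products_standard)
  have "commutative_on Q"
  proof (rule quantum_isometry_group_commutative[OF _ assms(5)])
    fix g assume "g \<in> carrier \<Gamma>"
    thus "\<exists>ws. set ws \<subseteq> standard_generators k n \<and> foldr (\<otimes>\<^bsub>\<Gamma>\<^esub>) ws \<one>\<^bsub>\<Gamma>\<^esub> = g"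
      using residues_word[of g] carrier_residues[of g] by simp
  qed
  moreover have "unital_cstar_algebra Q"
    using assms(5) by (simp add: is_quantum_isometry_group_def qiso_object_def compact_quantum_group_def)
  ultimately show ?thesis using abelianization_of_commutative assms(6) by blast
qed

end
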